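(* Let $n\ge2$, $x_0\in\mathbb{R}^n$, $D\subset\mathbb{R}^n$ a domain, $n-1<p\le n$, $\alpha:=\frac{p}{p-n+1}$. Let $Q:\mathbb{R}^n\to(0,\infty)$ be Lebesgue measurable with $Q\in L^{\frac{n-1}{p-n+1}}_{\rm loc}(\mathbb{R}^n)$, and let $f:D\to\mathbb{R}^n$ be a homeomorphism with bounded image $f(D)$ which is a lower $Q$-mapping with respect to $p$-modulus at $x_0$. Then for every $0<\varepsilon<\varepsilon_0<\infty$ and any compact sets $C_2\subset D\setminus B(x_0,\varepsilon_0)$ and $C_1\subset\overline{B(x_0,\varepsilon)}\cap D$, $$M_\alpha\big(f(\Gamma(C_1,C_2,D))\big)\le\int_{A(x_0,\varepsilon,\varepsilon_0)}Q^{\frac{n-1}{p-n+1}}(x)\,\eta^\alpha(|x-x_0|)\,dm(x)$$ for every Lebesgue measurable $\eta:(\varepsilon,\varepsilon_0)\to[0,\infty]$ with $\int_\varepsilon^{\varepsilon_0}\eta(r)\,dr=1$.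
   Context: $A(x_0,r_1,r_2)=\{x\in\mathbb{R}^n:r_1<|x-x_0|<r_2\}$; $B,S$ are Euclidean balls and spheres. For a path family $\Gamma$, $M_q(\Gamma)=\inf\int\rho^q\,dm$ over Borel $\rho\ge0$ with $\int_\gamma\rho|dx|\ge1$ for all locally rectifiable $\gamma\in\Gamma$; $\Gamma(E,F,G)$ is the family of paths joining $E$ to $F$ whose interior points lie in $G$; $f(\Gamma)=\{f\circ\gamma:\gamma\in\Gamma\}$. $\mathcal{H}^{n-1}$ is normalized $(n-1)$-dimensional Hausdorff measure. Modulus of surface families: for a family $\Sigma$ of $(n-1)$-dimensional surfaces $S$ (continuous images $S:D_S\to\mathbb{R}^n$ of open sets $D_S\subset\mathbb{R}^{n-1}$, with multiplicity $N(S,y)=\#S^{-1}(y)$), set $\int_S\rho^{n-1}d\mathcal{A}=\int_{\mathbb{R}^n}\rho^{n-1}(y)N(S,y)\,d\mathcal{H}^{n-1}y$; $\rho$ (Borel, $\ge0$) is admissible for $\Sigma$ if $\int_S\rho^{n-1}d\mathcal{A}\ge1$ for all $S\in\Sigma$, and $M_p(\Sigma)=\inf\int\rho^p\,dm$ over admissible $\rho$. $\rho$ is extensively $p$-admissible for $\Sigma$ ($\rho\in\mathrm{ext}_p\,\mathrm{adm}\,\Sigma$) if $\int_S\rho^{n-1}d\mathcal{A}\ge1$ for all $S\in\Sigma$ except a subfamily of $p$-modulus zero. Lower $Q$-mapping: $f:D\to\mathbb{R}^n$ is a lower $Q$-mapping with respect to $p$-modulus at $x_0$ if, with $d_0=\sup_{x\in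 D}|x-x_0|$, for every $r_0\in(0,d_0)$ and $\varepsilon\in(0,r_0)$, $$M_p(f(\Sigma_\varepsilon))\ge\inf_{\rho\in\mathrm{ext}_p\mathrm{adm}\,\Sigma_\varepsilon}\int_{D\cap A(x_0,\varepsilon,r_0)}\frac{\rho^p(x)}{Q(x)}\,dm(x),$$ where $\Sigma_\varepsilon$ is the family of sets $S(x_0,r)\cap D$, $r\in(\varepsilon,r_0)$, and $f(\Sigma_\varepsilon)$ the family of their images. *)

theory Defs
  imports "HOL-Analysis.Analysis"
begin

text \<open>Real power of a value in [0,\<infinity>], meant for positive exponents: \<infinity> powr p = \<infinity>.\<close>
definition epowr :: "ennreal \<Rightarrow> real \<Rightarrow> ennreal" where
  "epowr x q = (if x = \<infinity> then \<infinity> else ennreal (enn2real x powr q))"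

text \<open>Carath\'eodory's construction of the s-dimensional Hausdorff (outer) measure,
  normalized by the constant unit_ball_vol s / 2^s (so that it agrees with
  s-dimensional Lebesgue measure on s-planes).\<close>
definition hausdorff_delta :: "nat \<Rightarrow> real \<Rightarrow> 'a::euclidean_space set \<Rightarrow> ennreal" where
  "hausdorff_delta s \<delta> A =
     (INF U \<in> {U :: nat \<Rightarrow> 'a set. A \<subseteq> (\<Union>i. U i) \<and>
                 (\<forall>i. bounded (U i) \<and> diameter (U i) \<le> \<delta>)}.
        (\<Sum>i. ennreal (unit_ball_vol (real s) / 2 ^ s * diameter (U i) ^ s)))"

definition hausdorff_outer :: "nat \<Rightarrow> 'a::euclidean_space set \<Rightarrow> ennreal" where
  "hausdorff_outer s A = (SUP \<delta> \<in> {0<..}. hausdorff_delta s \<delta> A)"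

definition hausdorff_measure :: "nat \<Rightarrow> 'a::euclidean_space measure" where
  "hausdorff_measure s = measure_of UNIV (sets borel) (hausdorff_outer s)"

text \<open>Surfaces are represented by their point sets (multiplicity one); this is the case
  for the families S(x0,r) \<inter> D and their images under a homeomorphism.\<close>
definition surf_integral :: "('a::euclidean_space \<Rightarrow> ennreal) \<Rightarrow> 'a set \<Rightarrow> ennreal" where
  "surf_integral \<rho> S =
     (\<integral>\<^sup>+ y. \<rho> y ^ (DIM('a) - 1) * indicator S y \<partial>hausdorff_measure (DIM('a) - 1))"

definition surf_adm :: "'a::euclidean_space set set \<Rightarrow> ('a \<Rightarrow> ennreal) set" where
  "surf_adm \<Sigma> = {\<rho> \<in> borel_measurable borel. \<forall>S\<in>\<Sigma>. surf_integral \<rho> S \<ge> 1}"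

definition surf_modulus :: "real \<Rightarrow> 'a::euclidean_space set set \<Rightarrow> ennreal" where
  "surf_modulus p \<Sigma> = (INF \<rho> \<in> surf_adm \<Sigma>. \<integral>\<^sup>+ x. epowr (\<rho> x) p \<partial>lebesgue)"

definition ext_adm :: "real \<Rightarrow> 'a::euclidean_space set set \<Rightarrow> ('a \<Rightarrow> ennreal) set" where
  "ext_adm p \<Sigma> = {\<rho> \<in> borel_measurable borel. \<exists>\<Sigma>0 \<subseteq> \<Sigma>. surf_modulus p \<Sigma>0 = 0 \<and>
                      (\<forall>S \<in> \<Sigma> - \<Sigma>0. surf_integral \<rho> S \<ge> 1)}"

definition variation_on :: "(real \<Rightarrow> 'a::metric_space) \<Rightarrow> real \<Rightarrow> real \<Rightarrow> ennreal" where
  "variation_on g a b = (SUP ts \<in> {ts :: real list. sorted ts \<and> set ts \<subseteq> {a..b}}.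
      (\<Sum>i < length ts - 1. ennreal (dist (g (ts ! Suc i)) (g (ts ! i)))))"

definition rectifiable_path :: "(real \<Rightarrow> 'a::metric_space) \<Rightarrow> bool" where
  "rectifiable_path g \<longleftrightarrow> path g \<and> variation_on g 0 1 < \<infinity>"

definition arclength :: "(real \<Rightarrow> 'a::metric_space) \<Rightarrow> real \<Rightarrow> real" where
  "arclength g t = enn2real (variation_on g 0 (max 0 (min 1 t)))"

definition line_integral :: "('a::euclidean_space \<Rightarrow> ennreal) \<Rightarrow> (real \<Rightarrow> 'a) \<Rightarrow> ennreal" where
  "line_integral \<rho> g = (\<integral>\<^sup>+ t. \<rho> (g t) * indicator {0..1} t \<partial>interval_measure (arclength g))"

definition path_adm :: "(real \<Rightarrow> 'a::euclidean_space) set \<Rightarrow> ('a \<Rightarrow> ennreal) set" where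
  "path_adm \<Gamma> = {\<rho> \<in> borel_measurable borel.
                   \<forall>g\<in>\<Gamma>. rectifiable_path g \<longrightarrow> line_integral \<rho> g \<ge> 1}"

definition path_modulus :: "real \<Rightarrow> (real \<Rightarrow> 'a::euclidean_space) set \<Rightarrow> ennreal" where
  "path_modulus q \<Gamma> = (INF \<rho> \<in> path_adm \<Gamma>. \<integral>\<^sup>+ x. epowr (\<rho> x) q \<partial>lebesgue)"

definition joining_paths :: "'a::euclidean_space set \<Rightarrow> 'a set \<Rightarrow> 'a set \<Rightarrow> (real \<Rightarrow> 'a) set" where
  "joining_paths E F G = {g. path g \<and> g 0 \<in> E \<and> g 1 \<in> F \<and> (\<forall>t\<in>{0<..<1}. g t \<in> G)}"

definition annulus :: "'a::euclidean_space \<Rightarrow> real \<Rightarrow> real \<Rightarrow> 'a set" where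
  "annulus x0 r1 r2 = {x. r1 < dist x x0 \<and> dist x x0 < r2}"

definition lower_Q_mapping ::
  "real \<Rightarrow> ('a::euclidean_space \<Rightarrow> real) \<Rightarrow> ('a \<Rightarrow> 'a) \<Rightarrow> 'a set \<Rightarrow> 'a \<Rightarrow> bool" where
  "lower_Q_mapping p Q f D x0 \<longleftrightarrow>
     (\<forall>r0 \<epsilon>. 0 < r0 \<and> ennreal r0 < (SUP x\<in>D. ennreal (dist x x0)) \<and> 0 < \<epsilon> \<and> \<epsilon> < r0 \<longrightarrow>
        (let \<Sigma> = {sphere x0 r \<inter> D | r. \<epsilon> < r \<and> r < r0} in
          surf_modulus p ((\<lambda>S. f ` S) ` \<Sigma>) \<ge>
          (INF \<rho> \<in> ext_adm p \<Sigma>.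
             \<integral>\<^sup>+ x. epowr (\<rho> x) p / ennreal (Q x) * indicator (D \<inter> annulus x0 \<epsilon> r0) x \<partial>lebesgue)))"

definition L_loc :: "real \<Rightarrow> ('a::euclidean_space \<Rightarrow> real) \<Rightarrow> bool" where
  "L_loc s Q \<longleftrightarrow> Q \<in> borel_measurable lebesgue \<and>
     (\<forall>K. compact K \<longrightarrow> (\<integral>\<^sup>+ x. ennreal (\<bar>Q x\<bar> powr s) * indicator K x \<partial>lebesgue) < \<infinity>)"

end

theory Submission
  imports Defs
begin

text \<open>
The inequality compares two sides of the lower \<open>Q\<close>-inequality for the spheres \<open>S\<^sub>r\<close> around \<open>x0\<close>.
Let \<open>n\<close> be the dimension, \<open>\<alpha> = p / (p - n + 1)\<close>, let \<open>q = p / (n - 1)\<close> be the conjugate exponent, and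
let \<open>c\<close> be the factor between the \<open>(n-1)\<close>-dimensional Hausdorff measure and Lebesgue measure on hyperplanes.

On the source side a polar coordinate inequality and Hoelder's inequality give, for every extensively
admissible \<open>\<rho>\<close>, the bound \<open>\<integral>\<eta> \<le> c (\<integral>\<rho>\<^sup>p / Q)\<^bsup>1/q\<^esup> J\<^bsup>1/\<alpha>\<^esup>\<close>, where \<open>J\<close> is the right-hand side of the claim.

On the target side the hard half of the duality between path and surface moduli is needed:
\<open>M\<^sub>p(f \<Sigma>) \<le> c\<^bsup>-q\<^esup> M\<^sub>\<alpha>(f \<Gamma>)\<^bsup>1-q\<^esup>\<close>. If \<open>S\<close> separates the endpoints of all curves stably under translations by
vectors shorter than \<open>\<delta>\<close>, then averaging over these translations shows that
\<open>\<sigma>(y) = H\<^bsup>n-1\<^esup>(S \<inter> B(y,\<delta>)) / (c |B\<^sub>\<delta>|)\<close> is admissible for the curves. Varying a nearly extremal \<open>\<rho>\<close> in the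
direction of \<open>\<sigma>\<close> gives \<open>\<integral>\<rho>\<^bsup>\<alpha>-1\<^esup>\<sigma> \<ge> M\<^sub>\<alpha>\<close> up to a small error, and by Fubini this says that the \<open>\<delta>\<close>-average of
\<open>\<rho>\<^bsup>\<alpha>-1\<^esup> / (c M\<^sub>\<alpha>)\<close>, a competitor for the surface modulus, has integral at least 1 over \<open>S\<close>. Stability under
translations holds after restricting to curves that stay away from the boundary of \<open>f(D)\<close>; the restriction is
removed by the continuity of the modulus along increasing sequences of families, a consequence of
Clarkson's inequality.
\<close>

subsection \<open>Hausdorff measures\<close>

text \<open>Three obstacles shape the proof. Images of spheres may have infinite area, so a nearly
  extremal curve density yields a competitor only for surfaces of bounded area; a small constant on
  f(D) is added to serve the others, and its cost vanishes in the limit. The sets \<open>C1\<close>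
  and \<open>C2\<close> may touch the spheres of radii \<open>\<epsilon>\<close> and
  \<open>\<epsilon>0\<close>, so the radii are restricted to a slightly smaller interval, which
  keeps the images of \<open>C1\<close> and \<open>C2\<close> at a positive distance from all
  surfaces used. Integration in polar coordinates must be done with the Hausdorff measure itself; an
  inequality with the factor \<open>c\<close> suffices, and it is obtained by cutting space into
  narrow cones, in which a sphere is almost a hyperplane. The conditions \<open>p \<le> n\<close>
  and \<open>n \<ge> 2\<close> give \<open>\<alpha> \<ge> 2\<close>, the range in which Clarkson's
  inequality is elementary. With M the path modulus the two sides combine to 1 \<le> c (c^(-q)
  M^(1-q))^(1/q) J^(1/\<alpha>) = (J / M)^(1/\<alpha>), so that c disappears.\<close>

definition hausdorff_size :: "nat \<Rightarrow> 'a::euclidean_space set \<Rightarrow> ennreal" where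
  "hausdorff_size s U = ennreal (unit_ball_vol (real s) / 2 ^ s * diameter U ^ s)"

lemma hausdorff_delta_le:
  assumes "A \<subseteq> (\<Union>i. U i)" "\<And>i. bounded (U i)" "\<And>i. diameter (U i) \<le> \<delta>"
  shows "hausdorff_delta s \<delta> A \<le> (\<Sum>i. hausdorff_size s (U i))"
  unfolding hausdorff_delta_def hausdorff_size_def
  by (rule INF_lower) (use assms in auto)

lemma hausdorff_delta_less:
  assumes "hausdorff_delta s \<delta> A < x"
  obtains U where "A \<subseteq> (\<Union>i. U i)" "\<And>i. bounded (U i)" "\<And>i. diameter (U i) \<le> \<delta>"
    "(\<Sum>i. hausdorff_size s (U i)) < x"
  using assms unfolding hausdorff_delta_def INF_less_iff hausdorff_size_def by auto

lemma hausdorff_delta_antimono: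
  "\<delta> \<le> \<delta>' \<Longrightarrow> hausdorff_delta s \<delta>' A \<le> hausdorff_delta s \<delta> A"
  unfolding hausdorff_delta_def by (rule INF_superset_mono) (auto intro: order_trans)

lemma hausdorff_delta_mono:
  "A \<subseteq> B \<Longrightarrow> hausdorff_delta s \<delta> A \<le> hausdorff_delta s \<delta> B"
  unfolding hausdorff_delta_def by (rule INF_superset_mono) auto

lemma hausdorff_delta_le_outer: "\<delta> > 0 \<Longrightarrow> hausdorff_delta s \<delta> A \<le> hausdorff_outer s A"
  unfolding hausdorff_outer_def by (rule SUP_upper) auto

lemma hausdorff_outer_le:
  "(\<And>\<delta>. \<delta> > 0 \<Longrightarrow> hausdorff_delta s \<delta> A \<le> x) \<Longrightarrow> hausdorff_outer s A \<le> x"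
  unfolding hausdorff_outer_def by (rule SUP_least) auto

lemma hausdorff_outer_mono: "A \<subseteq> B \<Longrightarrow> hausdorff_outer s A \<le> hausdorff_outer s B"
  by (rule hausdorff_outer_le) (meson hausdorff_delta_le_outer hausdorff_delta_mono order_trans)

text \<open>For \<open>s = 0\<close> this fails: \<open>0 ^ 0 = 1\<close> gives each of the
  infinitely many covering sets size 1, empty or not. Hence the recurring condition
  \<open>s \<ge> 1\<close>.\<close>

lemma hausdorff_outer_empty:
  assumes "s \<ge> 1" shows "hausdorff_outer s ({}::'a::euclidean_space set) = 0"
proof -
  have "hausdorff_outer s ({}::'a set) \<le> 0"
  proof (rule hausdorff_outer_le)
    fix \<delta> :: real assume "\<delta> > 0"
    then have "hausdorff_delta s \<delta> ({}::'a set) \<le> (\<Sum>i. hausdorff_size s ((\<lambda>_. {}) i :: 'a set))"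
      by (intro hausdorff_delta_le) auto
    also have "\<dots> = 0" using assms by (simp add: hausdorff_size_def power_0_left)
    finally show "hausdorff_delta s \<delta> ({}::'a set) \<le> 0" .
  qed
  then show ?thesis by simp
qed

lemma hausdorff_delta_UN:
  fixes A :: "nat \<Rightarrow> 'a::euclidean_space set"
  shows "hausdorff_delta s \<delta> (\<Union>i. A i) \<le> (\<Sum>i. hausdorff_delta s \<delta> (A i))"
proof (rule ennreal_le_epsilon)
  fix e :: real assume fin: "(\<Sum>i. hausdorff_delta s \<delta> (A i)) < top" and e: "0 < e"
  have "\<exists>U. A i \<subseteq> (\<Union>j. U j) \<and> (\<forall>j. bounded (U j)) \<and> (\<forall>j. diameter (U j) \<le> \<delta>) \<and>
      (\<Sum>j. hausdorff_size s (U j)) \<le> hausdorff_delta s \<delta> (A i) + ennreal (e * (1/2) ^ Suc i)" for i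
  proof -
    have "hausdorff_delta s \<delta> (A i) < top"
      using fin by (metis ennreal_suminf_lessD)
    then have "hausdorff_delta s \<delta> (A i) < hausdorff_delta s \<delta> (A i) + ennreal (e * (1/2) ^ Suc i)"
      using e by (simp add: less_top[symmetric])
    from hausdorff_delta_less[OF this] show ?thesis by (metis less_imp_le)
  qed
  then obtain U where U: "\<And>i. A i \<subseteq> (\<Union>j. U i j)" "\<And>i j. bounded (U i j)"
      "\<And>i j. diameter (U i j) \<le> \<delta>"
      "\<And>i. (\<Sum>j. hausdorff_size s (U i j)) \<le> hausdorff_delta s \<delta> (A i) + ennreal (e * (1/2) ^ Suc i)"
    by metis
  let ?C = "\<lambda>k. case prod_decode k of (i, j) \<Rightarrow> U i j"
  have "hausdorff_delta s \<delta> (\<Union>i. A i) \<le> (\<Sum>k. hausdorff_size s (?C k))"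
  proof (rule hausdorff_delta_le)
    show "(\<Union>i. A i) \<subseteq> (\<Union>k. ?C k)"
    proof
      fix x assume "x \<in> (\<Union>i. A i)"
      then obtain i j where "x \<in> U i j" using U(1) by blast
      then show "x \<in> (\<Union>k. ?C k)" by (intro UN_I[of "prod_encode (i, j)"]) auto
    qed
  qed (auto split: prod.split simp: U)
  also have "\<dots> = (\<Sum>k. (\<lambda>(i, j). hausdorff_size s (U i j)) (prod_decode k))"
    by (intro suminf_cong) (auto split: prod.split)
  also have "\<dots> = (\<Sum>i. \<Sum>j. hausdorff_size s (U i j))"
    by (rule suminf_ennreal_2dimen) auto
  also have "\<dots> \<le> (\<Sum>i. hausdorff_delta s \<delta> (A i) + ennreal (e * (1/2) ^ Suc i))"
    by (intro suminf_le U summableI)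
  also have "\<dots> = (\<Sum>i. hausdorff_delta s \<delta> (A i)) + (\<Sum>i. ennreal (e * (1/2) ^ Suc i))"
    by (rule suminf_add[symmetric]) auto
  also have "(\<Sum>i. ennreal (e * (1/2) ^ Suc i)) = ennreal e"
    using e sums_mult[OF power_half_series, of e] by (intro suminf_ennreal_eq) auto
  finally show "hausdorff_delta s \<delta> (\<Union>i. A i) \<le> (\<Sum>i. hausdorff_delta s \<delta> (A i)) + ennreal e" .
qed

lemma hausdorff_outer_UN:
  fixes A :: "nat \<Rightarrow> 'a::euclidean_space set"
  shows "hausdorff_outer s (\<Union>i. A i) \<le> (\<Sum>i. hausdorff_outer s (A i))"
proof (rule hausdorff_outer_le)
  fix \<delta> :: real assume "\<delta> > 0"
  then have "(\<Sum>i. hausdorff_delta s \<delta> (A i)) \<le> (\<Sum>i. hausdorff_outer s (A i))"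
    by (intro suminf_le hausdorff_delta_le_outer) auto
  then show "hausdorff_delta s \<delta> (\<Union>i. A i) \<le> (\<Sum>i. hausdorff_outer s (A i))"
    using hausdorff_delta_UN order_trans by blast
qed

text \<open>A set of diameter at most \<open>\<delta> < d\<close> cannot meet both \<open>A\<close>
  and \<open>B\<close>. A cover of the union therefore splits into one of \<open>A\<close> and one
  of \<open>B\<close>, the discarded sets being replaced by the empty set, whose size is 0.\<close>

lemma hausdorff_delta_separated:
  fixes A B :: "'a::euclidean_space set"
  assumes s: "s \<ge> 1" and \<delta>: "0 \<le> \<delta>" "\<delta> < d" and sep: "\<And>x y. x \<in> A \<Longrightarrow> y \<in> B \<Longrightarrow> d \<le> dist x y"
  shows "hausdorff_delta s \<delta> A + hausdorff_delta s \<delta> B \<le> hausdorff_delta s \<delta> (A \<union> B)"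
proof (rule ccontr)
  assume "\<not> ?thesis"
  then have "hausdorff_delta s \<delta> (A \<union> B) < hausdorff_delta s \<delta> A + hausdorff_delta s \<delta> B" by simp
  from hausdorff_delta_less[OF this] obtain U where U: "A \<union> B \<subseteq> (\<Union>i. U i)" "\<And>i. bounded (U i)"
    "\<And>i. diameter (U i) \<le> \<delta>"
    and lt: "(\<Sum>i. hausdorff_size s (U i)) < hausdorff_delta s \<delta> A + hausdorff_delta s \<delta> B" by blast
  let ?V = "\<lambda>C i. if U i \<inter> C = {} then {} else U i"
  have C: "hausdorff_delta s \<delta> C \<le> (\<Sum>i. hausdorff_size s (?V C i))" if "C \<subseteq> A \<union> B" for C
    using that U \<delta> by (intro hausdorff_delta_le) fastforce+
  have "hausdorff_size s (?V A i) + hausdorff_size s (?V B i) \<le> hausdorff_size s (U i)" for i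
  proof -
    have "U i \<inter> A = {} \<or> U i \<inter> B = {}"
    proof (rule ccontr)
      assume "\<not> ?thesis"
      then obtain x y where "x \<in> U i" "x \<in> A" "y \<in> U i" "y \<in> B" by blast
      then show False
        using sep[of x y] diameter_bounded_bound[OF U(2), of x i y] U(3)[of i] \<delta> by simp
    qed
    moreover have "hausdorff_size s ({}::'a set) = 0"
      using s by (simp add: hausdorff_size_def power_0_left)
    ultimately show ?thesis by auto
  qed
  then have "(\<Sum>i. hausdorff_size s (?V A i)) + (\<Sum>i. hausdorff_size s (?V B i)) \<le> (\<Sum>i. hausdorff_size s (U i))"
    by (subst suminf_add) (auto intro!: suminf_le)
  with lt have "(\<Sum>i. hausdorff_size s (?V A i)) + (\<Sum>i. hausdorff_size s (?V B i)) < hausdorff_delta s \<delta> A + hausdorff_delta s \<delta> B"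
    by (rule order_le_less_trans[rotated])
  then show False using add_mono[OF C[of A] C[of B]] by (simp add: not_le[symmetric])
qed

lemma hausdorff_outer_separated:
  fixes A B :: "'a::euclidean_space set"
  assumes s: "s \<ge> 1" and d: "0 < d" and sep: "\<And>x y. x \<in> A \<Longrightarrow> y \<in> B \<Longrightarrow> d \<le> dist x y"
  shows "hausdorff_outer s A + hausdorff_outer s B \<le> hausdorff_outer s (A \<union> B)"
proof -
  \<comment> \<open>The supremum over all \<open>\<delta>\<close> is taken along a decreasing
    sequence, so that the sum of two suprema is the supremum of the sums. The offset 2 keeps every
    member strictly below \<open>d\<close>.\<close>
  let ?d = "\<lambda>k::nat. d / (real k + 2)"
  have dpos: "0 < ?d k" "?d k < d" for k using d by (auto simp: divide_less_eq intro!: mult_strict_left_mono[of 1 _ d, simplified])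
  have *: "hausdorff_outer s C = (SUP k. hausdorff_delta s (?d k) C)" for C :: "'a set"
  proof (rule antisym)
    show "hausdorff_outer s C \<le> (SUP k. hausdorff_delta s (?d k) C)"
    proof (rule hausdorff_outer_le)
      fix \<delta> :: real assume \<delta>: "\<delta> > 0"
      obtain k :: nat where "d / \<delta> < real k" using reals_Archimedean2 by blast
      then have "?d k \<le> \<delta>" using \<delta> by (simp add: field_simps)
      then show "hausdorff_delta s \<delta> C \<le> (SUP k. hausdorff_delta s (?d k) C)"
        by (intro SUP_upper2[of k] hausdorff_delta_antimono) auto
    qed
    show "(SUP k. hausdorff_delta s (?d k) C) \<le> hausdorff_outer s C"
      using dpos by (intro SUP_least hausdorff_delta_le_outer) auto
  qed
  have inc: "incseq (\<lambda>k. hausdorff_delta s (?d k) C)" for C :: "'a set"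
    using d by (intro monoI hausdorff_delta_antimono divide_left_mono) auto
  have "hausdorff_outer s A + hausdorff_outer s B
      = (SUP k. hausdorff_delta s (?d k) A + hausdorff_delta s (?d k) B)"
    unfolding * by (rule ennreal_SUP_add[OF inc inc, symmetric])
  also have "\<dots> \<le> hausdorff_outer s (A \<union> B)"
  proof (rule SUP_least)
    fix k
    have "hausdorff_delta s (?d k) A + hausdorff_delta s (?d k) B \<le> hausdorff_delta s (?d k) (A \<union> B)"
      using dpos[of k] by (intro hausdorff_delta_separated[OF s _ _ sep]) auto
    also have "\<dots> \<le> hausdorff_outer s (A \<union> B)" using dpos by (intro hausdorff_delta_le_outer) auto
    finally show "hausdorff_delta s (?d k) A + hausdorff_delta s (?d k) B \<le> hausdorff_outer s (A \<union> B)" .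
  qed
  finally show ?thesis .
qed

text \<open>The classical argument for metric outer measures: the annular layers around \<open>C\<close> of equal
  parity are mutually separated, so their measures are summable.\<close>

lemma metric_outer_measure_closed:
  fixes \<phi> :: "'a::metric_space set \<Rightarrow> ennreal"
  assumes empty: "\<phi> {} = 0" and mono: "\<And>A B. A \<subseteq> B \<Longrightarrow> \<phi> A \<le> \<phi> B"
    and sub: "\<And>A. \<phi> (\<Union>i::nat. A i) \<le> (\<Sum>i. \<phi> (A i))"
    and sep: "\<And>A B d. 0 < d \<Longrightarrow> (\<And>x y. x \<in> A \<Longrightarrow> y \<in> B \<Longrightarrow> d \<le> dist x y) \<Longrightarrow> \<phi> A + \<phi> B \<le> \<phi> (A \<union> B)"
    and C: "closed C"
  shows "\<phi> (X \<inter> C) + \<phi> (X - C) \<le> \<phi> X"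
proof (cases "C = {} \<or> \<phi> X = top")
  case True then show ?thesis by (auto simp: empty)
next
  case False
  then have ne: "C \<noteq> {}" and fin: "\<phi> X < top" by (auto simp: less_top)
  let ?a = "\<lambda>k::nat. 1 / (real k + 1)"
  define Y where "Y k = {x \<in> X. ?a k \<le> infdist x C}" for k :: nat
  define R where "R k = {x \<in> X. ?a (Suc k) \<le> infdist x C \<and> infdist x C < ?a k}" for k :: nat
  have dist: "infdist x C - infdist y C \<le> dist x y" for x y
    using infdist_triangle[of x C y] by simp
  have par: "(\<Sum>j<m. \<phi> (R (2 * j + o'))) \<le> \<phi> (\<Union>j<m. R (2 * j + o'))" for m o'
  proof (induction m)
    case (Suc m)
    have "(\<Sum>j<Suc m. \<phi> (R (2 * j + o'))) \<le> \<phi> (\<Union>j<m. R (2 * j + o')) + \<phi> (R (2 * m + o'))"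
      using Suc by (simp add: add_mono)
    \<comment> \<open>The skipped layer of the other parity leaves a gap: earlier points have
      distance at least \<open>1 / (2m + o')\<close> from \<open>C\<close>, later ones less than
      \<open>1 / (2m + o' + 1)\<close>. The empty union at \<open>m = 0\<close> is treated apart,
      since there the first fraction can be 1/0.\<close>
    also have "\<dots> \<le> \<phi> ((\<Union>j<m. R (2 * j + o')) \<union> R (2 * m + o'))"
    proof (cases "m = 0")
      case False
      show ?thesis
      proof (rule sep[of "1 / (2 * real m + real o') - 1 / (2 * real m + real o' + 1)"])
        show "0 < 1 / (2 * real m + real o') - 1 / (2 * real m + real o' + 1)"
          using False by (simp add: frac_less2)
      next
        fix x y assume "x \<in> (\<Union>j<m. R (2 * j + o'))" and y: "y \<in> R (2 * m + o')"
        then obtain j where j: "j < m" "x \<in> R (2 * j + o')" by auto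
        have "1 / (2 * real m + real o') \<le> 1 / (2 * real j + real o' + 2)"
          using j(1) by (intro divide_left_mono) auto
        also have "\<dots> \<le> infdist x C" using j(2) by (simp add: R_def algebra_simps)
        finally have "1 / (2 * real m + real o') \<le> infdist x C" .
        moreover have "infdist y C < 1 / (2 * real m + real o' + 1)"
          using y by (simp add: R_def algebra_simps)
        ultimately show "1 / (2 * real m + real o') - 1 / (2 * real m + real o' + 1) \<le> dist x y"
          using dist[of x y] by linarith
      qed
    qed (simp add: empty)
    finally show ?case by (simp add: lessThan_Suc Un_commute)
  qed (simp add: empty)
  have par': "(\<Sum>j<m. \<phi> (R (2 * j + o'))) \<le> \<phi> X" for m o'
    using par[of o' m] mono[of "\<Union>j<m. R (2 * j + o')" X] unfolding R_def by (auto intro: order_trans)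
  have "(\<Sum>j<m. \<phi> (R j)) \<le> 2 * \<phi> X" for m
  proof -
    have "(\<Sum>j<m. \<phi> (R j)) \<le> (\<Sum>j<2*m. \<phi> (R j))" by (intro sum_mono2) auto
    also have "\<dots> = (\<Sum>j<m. \<phi> (R (2 * j + 0))) + (\<Sum>j<m. \<phi> (R (2 * j + 1)))"
      by (induction m) (auto simp: ac_simps)
    also have "\<dots> \<le> 2 * \<phi> X" using add_mono[OF par'[of 0 m] par'[of 1 m]] by (simp add: mult_2)
    finally show ?thesis .
  qed
  then have "(\<Sum>j. \<phi> (R j)) \<le> 2 * \<phi> X" by (simp add: suminf_eq_SUP SUP_least)
  also have "\<dots> < top" using fin by (simp add: ennreal_mult_less_top)
  finally have sumfin: "(\<Sum>j. \<phi> (R j)) < top" .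
  show ?thesis
  proof (rule ennreal_le_epsilon)
    fix e :: real assume e: "0 < e"
    have "\<exists>k. (\<Sum>j. \<phi> (R j)) < (\<Sum>j<k. \<phi> (R j)) + ennreal e"
    proof (cases "(\<Sum>j. \<phi> (R j)) = 0")
      case False
      then have "(\<Sum>j. \<phi> (R j)) - ennreal e < (\<Sum>j. \<phi> (R j))"
        using e sumfin by (auto intro!: ennreal_between simp: zero_less_iff_neq_zero)
      then obtain k where "(\<Sum>j. \<phi> (R j)) - ennreal e < (\<Sum>j<k. \<phi> (R j))"
        by (subst (asm) (2) suminf_eq_SUP) (auto simp: less_SUP_iff)
      moreover obtain a where "0 \<le> a" "(\<Sum>j. \<phi> (R j)) = ennreal a" using sumfin by (cases "\<Sum>j. \<phi> (R j)") auto
      moreover have "(\<Sum>j<k. \<phi> (R j)) \<le> (\<Sum>j. \<phi> (R j))" by (intro sum_le_suminf) auto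
      then obtain b where "0 \<le> b" "(\<Sum>j<k. \<phi> (R j)) = ennreal b"
        using sumfin by (cases "\<Sum>j<k. \<phi> (R j)") auto
      ultimately show ?thesis
        using e by (intro exI[of _ k])
          (auto simp: ennreal_minus ennreal_less_iff ennreal_lessI less_diff_eq[symmetric] simp flip: ennreal_plus
              intro: ccontr dest!: ennreal_leI[of b "a - e"])
    qed (use e in \<open>auto intro!: exI[of _ 0]\<close>)
    then obtain k where k: "(\<Sum>j. \<phi> (R j)) < (\<Sum>j<k. \<phi> (R j)) + ennreal e" by blast
    have "(\<Sum>j<k. \<phi> (R j)) + (\<Sum>j. \<phi> (R (j + k))) = (\<Sum>j. \<phi> (R j))"
      by (subst suminf_offset[of _ k]) (auto simp: add.commute)
    with k have tail: "(\<Sum>j. \<phi> (R (j + k))) \<le> ennreal e"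
      using sumfin by (metis ennreal_add_left_cancel_less less_imp_le)
    \<comment> \<open>Off \<open>C\<close> the distance is positive because \<open>C\<close> is
      closed. So a point of \<open>X - C\<close> has distance at least \<open>1 / (k + 1)\<close> or
      lies in a layer of index at least \<open>k\<close>; these layers have total mass at most
      \<open>e\<close>.\<close>
    have "X - C \<subseteq> (\<Union>j. case j of 0 \<Rightarrow> Y k | Suc j \<Rightarrow> R (j + k))"
    proof
      fix x assume x: "x \<in> X - C"
      then have pos: "0 < infdist x C"
        using C ne by (metis DiffD2 in_closed_iff_infdist_zero infdist_nonneg order_le_less)
      show "x \<in> (\<Union>j. case j of 0 \<Rightarrow> Y k | Suc j \<Rightarrow> R (j + k))"
      proof (cases "?a k \<le> infdist x C")
        case True then show ?thesis using x by (intro UN_I[of 0]) (auto simp: Y_def)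
      next
        case False
        obtain m where "?a m < infdist x C"
          using reals_Archimedean[OF pos] by (auto simp: inverse_eq_divide add.commute)
        then have ex: "\<exists>m. ?a m \<le> infdist x C" by (meson less_imp_le)
        define l where "l = (LEAST m. ?a m \<le> infdist x C)"
        have l: "?a l \<le> infdist x C" unfolding l_def using ex by (rule LeastI_ex)
        have lk: "l > k"
        proof (rule ccontr)
          assume "\<not> l > k"
          then have "?a k \<le> ?a l" by (intro divide_left_mono) auto
          then show False using l False by simp
        qed
        then have "\<not> ?a (l - 1) \<le> infdist x C"
          unfolding l_def by (intro not_less_Least) auto
        then have "x \<in> R (l - 1)" using l lk x unfolding R_def by (auto simp: Suc_diff_Suc)
        then show ?thesis using lk by (intro UN_I[of "Suc (l - 1 - k)"]) auto
      qed
    qed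
    then have "\<phi> (X - C) \<le> \<phi> (\<Union>j. case j of 0 \<Rightarrow> Y k | Suc j \<Rightarrow> R (j + k))" by (rule mono)
    also have "\<dots> \<le> (\<Sum>j. \<phi> (case j of 0 \<Rightarrow> Y k | Suc j \<Rightarrow> R (j + k)))" by (rule sub)
    also have "\<dots> = (\<Sum>j. \<phi> (R (j + k))) + \<phi> (Y k)"
      by (subst suminf_offset[of _ 1]) auto
    also have "\<dots> \<le> ennreal e + \<phi> (Y k)" using tail by (rule add_right_mono)
    finally have "\<phi> (X \<inter> C) + \<phi> (X - C) \<le> \<phi> (Y k) + \<phi> (X \<inter> C) + ennreal e"
      by (metis add.assoc add.commute add_left_mono)
    also have "\<phi> (Y k) + \<phi> (X \<inter> C) \<le> \<phi> (Y k \<union> (X \<inter> C))"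
    proof (rule sep[of "?a k"])
      fix x y assume "x \<in> Y k" "y \<in> X \<inter> C"
      then show "?a k \<le> dist x y" unfolding Y_def using infdist_le[of y C x] by auto
    qed simp
    also have "\<phi> (Y k \<union> (X \<inter> C)) \<le> \<phi> X" by (rule mono) (auto simp: Y_def)
    finally show "\<phi> (X \<inter> C) + \<phi> (X - C) \<le> \<phi> X + ennreal e" by (simp add: add_right_mono)
  qed
qed

lemma hausdorff_outer_Un:
  fixes A B :: "'a::euclidean_space set"
  assumes "s \<ge> 1"
  shows "hausdorff_outer s (A \<union> B) \<le> hausdorff_outer s A + hausdorff_outer s B"
proof -
  have "hausdorff_outer s (\<Union>i::nat. if i = 0 then A else if i = 1 then B else {})
      \<le> (\<Sum>i::nat. hausdorff_outer s (if i = 0 then A else if i = 1 then B else {}))"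
    by (rule hausdorff_outer_UN)
  also have "\<dots> = (\<Sum>i<2::nat. hausdorff_outer s (if i = 0 then A else if i = 1 then B else {}))"
    using assms by (intro suminf_finite) (auto simp: hausdorff_outer_empty)
  also have "\<dots> = hausdorff_outer s A + hausdorff_outer s B"
    by (simp add: numeral_2_eq_2)
  finally have "hausdorff_outer s (\<Union>i::nat. if i = 0 then A else if i = 1 then B else {})
      \<le> hausdorff_outer s A + hausdorff_outer s B" .
  moreover have "(\<Union>i::nat. if i = 0 then A else if i = 1 then B else {}) = A \<union> B"
    by (auto split: if_splits)
  ultimately show ?thesis by simp
qed

text \<open>\<open>measure_of\<close> reproduces the outer measure only if it is countably additive
  on the Borel sets. Caratheodory's theorem provides this once closed sets split every set
  additively, which is what additivity on separated sets yields.\<close>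

lemma measure_space_hausdorff_outer:
  assumes s: "s \<ge> 1"
  shows "measure_space UNIV (sets borel) (hausdorff_outer s :: 'a::euclidean_space set \<Rightarrow> ennreal)"
proof -
  let ?h = "hausdorff_outer s :: 'a set \<Rightarrow> ennreal"
  interpret sigma_algebra "UNIV :: 'a set" UNIV
    using sigma_algebra_Pow[of "UNIV :: 'a set"] by simp
  have "outer_measure_space UNIV ?h"
    unfolding outer_measure_space_def positive_def increasing_def countably_subadditive_def
    using s by (auto intro: hausdorff_outer_mono hausdorff_outer_UN simp: hausdorff_outer_empty)
  from caratheodory_lemma[OF this] have ms: "measure_space UNIV (lambda_system UNIV UNIV ?h) ?h" .
  then interpret L: sigma_algebra UNIV "lambda_system UNIV UNIV ?h" by (simp add: measure_space_def)
  have "closed C \<Longrightarrow> C \<in> lambda_system UNIV UNIV ?h" for C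
  proof -
    assume C: "closed C"
    have "?h (X \<inter> C) + ?h (X - C) = ?h X" for X
    proof (rule antisym)
      show "?h (X \<inter> C) + ?h (X - C) \<le> ?h X"
        using hausdorff_outer_empty[OF s] hausdorff_outer_mono hausdorff_outer_UN
          hausdorff_outer_separated[OF s] C by (rule metric_outer_measure_closed)
      show "?h X \<le> ?h (X \<inter> C) + ?h (X - C)"
        using hausdorff_outer_Un[OF s, of "X \<inter> C" "X - C"] by (simp add: Un_Diff_Int Un_commute Int_Diff_Un)
    qed
    then show ?thesis unfolding lambda_system_eq by simp
  qed
  then have "sets borel \<subseteq> lambda_system UNIV UNIV ?h"
    unfolding borel_eq_closed by (auto intro!: L.sigma_sets_subset)
  moreover have "sigma_algebra UNIV (sets (borel :: 'a measure))"
    using sets.sigma_algebra_axioms[of "borel :: 'a measure"] by simp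
  ultimately show ?thesis using ms
    unfolding measure_space_def positive_def countably_additive_def by auto
qed

lemma sets_hausdorff_measure [simp, measurable_cong]: "sets (hausdorff_measure s) = sets borel"
  unfolding hausdorff_measure_def
  using sets.sigma_sets_eq[of "borel :: 'a measure"] by (simp add: sets_measure_of)

lemma space_hausdorff_measure [simp]: "space (hausdorff_measure s) = UNIV"
  unfolding hausdorff_measure_def by (simp add: space_measure_of)

lemma emeasure_hausdorff_measure:
  assumes "s \<ge> 1" "A \<in> sets borel"
  shows "emeasure (hausdorff_measure s) A = hausdorff_outer s A"
proof -
  have ms: "measure_space UNIV (sets borel) (hausdorff_outer s :: 'a set \<Rightarrow> ennreal)"
    by (rule measure_space_hausdorff_outer[OF assms(1)])
  show ?thesis
    by (rule emeasure_measure_of[OF hausdorff_measure_def])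
      (use ms assms in \<open>auto simp: measure_space_def\<close>)
qed

text \<open>Covering sets are cut down to \<open>A\<close> before they are mapped, so the Lipschitz
  bound is used on \<open>A\<close> only; a cover at scale \<open>\<delta> / L\<close> becomes one
  at scale \<open>\<delta>\<close>, each set growing in size by at most \<open>L ^ s\<close>.
  Applied later to projections and to their partial inverses.\<close>

lemma hausdorff_outer_Lipschitz_image:
  fixes f :: "'a::euclidean_space \<Rightarrow> 'a"
  assumes L: "L > 0" and lip: "\<And>x y. x \<in> A \<Longrightarrow> y \<in> A \<Longrightarrow> dist (f x) (f y) \<le> L * dist x y"
  shows "hausdorff_outer s (f ` A) \<le> ennreal (L ^ s) * hausdorff_outer s A"
proof (rule hausdorff_outer_le)
  fix \<delta> :: real assume \<delta>: "\<delta> > 0"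
  have "hausdorff_delta s \<delta> (f ` A) \<le> ennreal (L ^ s) * hausdorff_delta s (\<delta> / L) A"
  proof (rule ccontr)
    assume "\<not> ?thesis"
    then have lt: "ennreal (L ^ s) * hausdorff_delta s (\<delta> / L) A < hausdorff_delta s \<delta> (f ` A)" by simp
    have "hausdorff_delta s (\<delta> / L) A < hausdorff_delta s \<delta> (f ` A) / ennreal (L ^ s)"
    proof (rule ccontr)
      assume "\<not> ?thesis"
      then have "ennreal (L ^ s) * (hausdorff_delta s \<delta> (f ` A) / ennreal (L ^ s)) \<le> ennreal (L ^ s) * hausdorff_delta s (\<delta> / L) A"
        by (intro mult_left_mono) auto
      moreover have "ennreal (L ^ s) * (hausdorff_delta s \<delta> (f ` A) / ennreal (L ^ s)) = hausdorff_delta s \<delta> (f ` A)"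
        using L by (subst ennreal_times_divide, subst mult.commute) (simp add: mult_divide_eq_ennreal)
      ultimately show False using lt by simp
    qed
    from hausdorff_delta_less[OF this] obtain U where U: "A \<subseteq> (\<Union>i. U i)" "\<And>i. bounded (U i)"
      "\<And>i. diameter (U i) \<le> \<delta> / L"
      and lt: "(\<Sum>i. hausdorff_size s (U i)) < hausdorff_delta s \<delta> (f ` A) / ennreal (L ^ s)" by blast
    have d: "dist x y \<le> L * diameter (U i)" if "x \<in> f ` (A \<inter> U i)" "y \<in> f ` (A \<inter> U i)" for x y i
    proof -
      obtain u v where uv: "u \<in> A \<inter> U i" "v \<in> A \<inter> U i" "x = f u" "y = f v" using \<open>x \<in> _\<close> \<open>y \<in> _\<close> by blast
      have "dist x y \<le> L * dist u v" using uv lip by auto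
      also have "\<dots> \<le> L * diameter (U i)"
        using uv L U(2)[of i] by (intro mult_left_mono diameter_bounded_bound) auto
      finally show ?thesis .
    qed
    have bd: "bounded (f ` (A \<inter> U i))" for i
      unfolding bounded_def using d by blast
    have di: "diameter (f ` (A \<inter> U i)) \<le> L * diameter (U i)" for i
      using d[of _ i] diameter_ge_0[OF U(2)[of i]] L by (intro diameter_le) (auto simp: dist_norm)
    have "hausdorff_delta s \<delta> (f ` A) \<le> (\<Sum>i. hausdorff_size s (f ` (A \<inter> U i)))"
    proof (rule hausdorff_delta_le)
      show "f ` A \<subseteq> (\<Union>i. f ` (A \<inter> U i))" using U(1) by blast
      show "diameter (f ` (A \<inter> U i)) \<le> \<delta>" for i
        using di[of i] U(3)[of i] L by (simp add: field_simps)
    qed (rule bd)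
    also have "\<dots> \<le> (\<Sum>i. ennreal (L ^ s) * hausdorff_size s (U i))"
    proof (rule suminf_le)
      fix i
      have "diameter (f ` (A \<inter> U i)) ^ s \<le> (L * diameter (U i)) ^ s"
        by (intro power_mono di diameter_ge_0 bd)
      then have "unit_ball_vol (real s) / 2 ^ s * diameter (f ` (A \<inter> U i)) ^ s
        \<le> L ^ s * (unit_ball_vol (real s) / 2 ^ s * diameter (U i) ^ s)"
        using mult_left_mono[of "diameter (f ` (A \<inter> U i)) ^ s" "(L * diameter (U i)) ^ s" "unit_ball_vol (real s) / 2 ^ s"]
        by (simp add: power_mult_distrib algebra_simps)
      then show "hausdorff_size s (f ` (A \<inter> U i)) \<le> ennreal (L ^ s) * hausdorff_size s (U i)"
        unfolding hausdorff_size_def using L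
        by (subst ennreal_mult'[symmetric]) (auto intro!: ennreal_leI)
    qed auto
    also have "\<dots> = ennreal (L ^ s) * (\<Sum>i. hausdorff_size s (U i))" by simp
    also have "\<dots> < ennreal (L ^ s) * (hausdorff_delta s \<delta> (f ` A) / ennreal (L ^ s))"
      using lt L by (intro ennreal_mult_strict_left_mono) auto
    also have "\<dots> = hausdorff_delta s \<delta> (f ` A)"
      using L by (subst ennreal_times_divide, subst mult.commute) (simp add: mult_divide_eq_ennreal)
    finally show False by simp
  qed
  also have "\<dots> \<le> ennreal (L ^ s) * hausdorff_outer s A"
    using L \<delta> by (intro mult_left_mono hausdorff_delta_le_outer) auto
  finally show "hausdorff_delta s \<delta> (f ` A) \<le> ennreal (L ^ s) * hausdorff_outer s A" .
qed

subsection \<open>Translation invariant measures on subspaces\<close>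

lemma ennreal_mult_cancel_inverse:
  assumes "a > 0" "a * b = 1"
  shows "ennreal a * (ennreal b * x) = x"
  using assms by (simp add: mult.assoc[symmetric] ennreal_mult'[symmetric])

text \<open>Uniqueness of Haar measure on \<open>W\<close> by double integration of
  \<open>indicator B y * indicator A (x + y)\<close>: once with \<open>x\<close> integrated first,
  once after replacing \<open>y\<close> by \<open>y - x\<close>. The reflected set comes from
  \<open>y - x \<in> B\<close> read as a condition on \<open>x\<close>. The measures live on the
  ambient space, so invariance under \<open>W\<close> is applied almost everywhere.\<close>

lemma translation_invariant_measure_unique:
  fixes \<mu> \<nu> :: "'a::euclidean_space measure"
  assumes W: "subspace W"
    and [measurable_cong]: "sets \<mu> = sets borel" "sets \<nu> = sets borel"
    and sf: "sigma_finite_measure \<mu>" "sigma_finite_measure \<nu>"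
    and AE: "AE x in \<mu>. x \<in> W" "AE x in \<nu>. x \<in> W"
    and inv: "\<And>w A. w \<in> W \<Longrightarrow> A \<in> sets borel \<Longrightarrow> emeasure \<mu> ((\<lambda>x. x + w) -` A) = emeasure \<mu> A"
      "\<And>w A. w \<in> W \<Longrightarrow> A \<in> sets borel \<Longrightarrow> emeasure \<nu> ((\<lambda>x. x + w) -` A) = emeasure \<nu> A"
    and [measurable]: "A \<in> sets borel" "B \<in> sets borel"
  shows "emeasure \<mu> A * emeasure \<nu> B = emeasure \<nu> A * emeasure \<mu> (uminus -` B)"
proof -
  interpret \<mu>: sigma_finite_measure \<mu> by fact
  interpret \<nu>: sigma_finite_measure \<nu> by fact
  interpret P: pair_sigma_finite \<mu> \<nu> ..
  have sp [simp]: "space \<mu> = UNIV" "space \<nu> = UNIV"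
    using sets_eq_imp_space_eq[OF assms(2)] sets_eq_imp_space_eq[OF assms(3)] by auto
  have [measurable]: "(\<lambda>x::'a. x + w) -` C \<in> sets borel" if "C \<in> sets borel" for w C
    using measurable_sets[of "\<lambda>x::'a. x + w" borel borel C] that by simp
  have [measurable]: "uminus -` B \<in> sets borel"
    using measurable_sets[of "uminus :: 'a \<Rightarrow> 'a" borel borel B] by simp
  have distr: "distr \<nu> borel (\<lambda>y. y + x) = \<nu>" if "x \<in> W" for x
    by (rule measure_eqI) (auto simp: assms emeasure_distr inv(2)[OF that])
  have "emeasure \<mu> A * emeasure \<nu> B = (\<integral>\<^sup>+y. indicator B y * emeasure \<mu> A \<partial>\<nu>)"
    by (simp add: nn_integral_multc mult.commute)
  also have "\<dots> = (\<integral>\<^sup>+y. (\<integral>\<^sup>+x. indicator B y * indicator A (x + y) \<partial>\<mu>) \<partial>\<nu>)"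
  proof (rule nn_integral_cong_AE)
    show "AE y in \<nu>. indicator B y * emeasure \<mu> A = (\<integral>\<^sup>+x. indicator B y * indicator A (x + y) \<partial>\<mu>)"
      using AE(2)
    proof eventually_elim
      case (elim y)
      have "(\<integral>\<^sup>+x. indicator A (x + y) \<partial>\<mu>) = (\<integral>\<^sup>+x. indicator ((\<lambda>x. x + y) -` A) x \<partial>\<mu>)"
        by (intro nn_integral_cong) (auto simp: indicator_def)
      also have "\<dots> = emeasure \<mu> A" by (simp add: inv(1)[OF elim] assms)
      finally show ?case by (simp add: nn_integral_cmult)
    qed
  qed
  also have "\<dots> = (\<integral>\<^sup>+x. (\<integral>\<^sup>+y. indicator B y * indicator A (x + y) \<partial>\<nu>) \<partial>\<mu>)"
    by (rule P.Fubini') simp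
  also have "\<dots> = (\<integral>\<^sup>+x. (\<integral>\<^sup>+y. indicator B (y - x) * indicator A y \<partial>\<nu>) \<partial>\<mu>)"
  proof (rule nn_integral_cong_AE)
    show "AE x in \<mu>. (\<integral>\<^sup>+y. indicator B y * indicator A (x + y) \<partial>\<nu>)
        = (\<integral>\<^sup>+y. indicator B (y - x) * indicator A y \<partial>\<nu>)"
      using AE(1)
    proof eventually_elim
      case (elim x)
      have "(\<integral>\<^sup>+y. indicator B (y - x) * indicator A y \<partial>\<nu>)
          = (\<integral>\<^sup>+y. indicator B (y - x) * indicator A y \<partial>(distr \<nu> borel (\<lambda>y. y + x)))"
        by (simp only: distr[OF elim])
      also have "\<dots> = (\<integral>\<^sup>+y. indicator B y * indicator A (x + y) \<partial>\<nu>)"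
        by (subst nn_integral_distr) (auto simp: add.commute)
      finally show ?case by simp
    qed
  qed
  also have "\<dots> = (\<integral>\<^sup>+y. (\<integral>\<^sup>+x. indicator B (y - x) * indicator A y \<partial>\<mu>) \<partial>\<nu>)"
    by (rule P.Fubini'[symmetric]) simp
  also have "\<dots> = (\<integral>\<^sup>+y. indicator A y * emeasure \<mu> (uminus -` B) \<partial>\<nu>)"
  proof (rule nn_integral_cong_AE)
    show "AE y in \<nu>. (\<integral>\<^sup>+x. indicator B (y - x) * indicator A y \<partial>\<mu>) = indicator A y * emeasure \<mu> (uminus -` B)"
      using AE(2)
    proof eventually_elim
      case (elim y)
      then have y: "- y \<in> W" using W by (simp add: subspace_neg)
      have "(\<integral>\<^sup>+x. indicator B (y - x) \<partial>\<mu>) = (\<integral>\<^sup>+x. indicator ((\<lambda>x. x + - y) -` (uminus -` B)) x \<partial>\<mu>)"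
        by (intro nn_integral_cong) (auto simp: indicator_def)
      also have "\<dots> = emeasure \<mu> (uminus -` B)"
        using inv(1)[OF y, of "uminus -` B"] by (subst nn_integral_indicator) (simp_all add: assms(2) del: add_uminus_conv_diff)
      finally show ?case by (subst nn_integral_multc) (simp_all add: mult.commute)
    qed
  qed
  also have "\<dots> = emeasure \<nu> A * emeasure \<mu> (uminus -` B)"
    by (simp add: nn_integral_multc)
  finally show ?thesis .
qed

section \<open>Hausdorff measure under similarities and against Ahlfors regular measures\<close>

lemma hausdorff_outer_isometry_image:
  fixes f :: "'a::euclidean_space \<Rightarrow> 'a"
  assumes iso: "\<And>x y. dist (f x) (f y) = dist x y"
  shows "hausdorff_outer s (f ` A) = hausdorff_outer s A"
proof (rule antisym)
  have inj: "inj f" by (rule injI) (metis iso dist_eq_0_iff)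
  show "hausdorff_outer s (f ` A) \<le> hausdorff_outer s A"
    using hausdorff_outer_Lipschitz_image[of 1 A f s] iso by simp
  have "hausdorff_outer s (inv f ` (f ` A)) \<le> hausdorff_outer s (f ` A)"
  proof -
    have "dist (inv f x) (inv f y) \<le> 1 * dist x y" if "x \<in> f ` A" "y \<in> f ` A" for x y
      using that inj by (auto simp: iso)
    from hausdorff_outer_Lipschitz_image[OF zero_less_one this] show ?thesis by simp
  qed
  then show "hausdorff_outer s A \<le> hausdorff_outer s (f ` A)"
    using inj by (simp add: image_comp comp_def)
qed

lemma hausdorff_outer_scaleR:
  assumes r: "r > 0"
  shows "hausdorff_outer s ((\<lambda>x. r *\<^sub>R x) ` A) = ennreal (r ^ s) * hausdorff_outer s A"
proof (rule antisym)
  show "hausdorff_outer s ((\<lambda>x. r *\<^sub>R x) ` A) \<le> ennreal (r ^ s) * hausdorff_outer s A"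
    using r by (intro hausdorff_outer_Lipschitz_image) (auto simp: dist_norm simp flip: scaleR_diff_right)
  have "hausdorff_outer s ((\<lambda>x. inverse r *\<^sub>R x) ` ((\<lambda>x. r *\<^sub>R x) ` A))
      \<le> ennreal (inverse r ^ s) * hausdorff_outer s ((\<lambda>x. r *\<^sub>R x) ` A)"
    using r by (intro hausdorff_outer_Lipschitz_image) (auto simp: dist_norm simp flip: scaleR_diff_right)
  then have "ennreal (r ^ s) * hausdorff_outer s A
      \<le> ennreal (r ^ s) * (ennreal (inverse r ^ s) * hausdorff_outer s ((\<lambda>x. r *\<^sub>R x) ` A))"
    using r by (intro mult_left_mono) (auto simp: image_comp comp_def)
  also have "\<dots> = hausdorff_outer s ((\<lambda>x. r *\<^sub>R x) ` A)"
    using r by (simp add: mult.assoc[symmetric] ennreal_mult'[symmetric] power_mult_distrib[symmetric])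
  finally show "ennreal (r ^ s) * hausdorff_outer s A \<le> hausdorff_outer s ((\<lambda>x. r *\<^sub>R x) ` A)" .
qed

text \<open>The mass distribution principle: a covering set that meets \<open>A\<close> lies in a
  ball around a point of \<open>A\<close> with its diameter as radius, so its
  \<open>\<mu>\<close>-mass on \<open>A\<close> is at most a constant times its size.\<close>

lemma hausdorff_outer_pos_of_upper_regular:
  fixes \<mu> :: "'a::euclidean_space measure"
  assumes s: "s \<ge> 1" and [measurable_cong]: "sets \<mu> = sets borel" and A[measurable]: "A \<in> sets borel"
    and K: "K > 0" and up: "\<And>y r. y \<in> A \<Longrightarrow> r > 0 \<Longrightarrow> emeasure \<mu> (cball y r) \<le> ennreal (K * r ^ s)"
    and pos: "emeasure \<mu> A > 0"
  shows "hausdorff_outer s A > 0"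
proof -
  define k where "k = unit_ball_vol (real s) / 2 ^ s"
  have k: "k > 0" unfolding k_def by simp
  \<comment> \<open>Covering sets may be single points, so the upper bound is needed for radius 0 as
    well; there the mass is 0, as shrinking radii show.\<close>
  have up0: "emeasure \<mu> (cball y r) \<le> ennreal (K * r ^ s)" if y: "y \<in> A" and r: "r \<ge> 0" for y r
  proof (cases "r = 0")
    case True
    have "emeasure \<mu> (cball y 0) \<le> 0"
    proof (rule ennreal_le_epsilon)
      fix e :: real assume e: "0 < e"
      define t where "t = min 1 (e / K)"
      have t: "t > 0" "t \<le> 1" "K * t \<le> e"
      proof -
        have "K * t \<le> K * (e / K)" using K unfolding t_def by (intro mult_left_mono) auto
        then show "K * t \<le> e" using K by simp
      qed (use e K in \<open>auto simp: t_def\<close>)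
      have "t ^ s \<le> t" using t s power_decreasing[of 1 s t] by simp
      then have "K * t ^ s \<le> K * t" using K by (intro mult_left_mono) auto
      then have "K * t ^ s \<le> e" using t by linarith
      have "emeasure \<mu> (cball y 0) \<le> emeasure \<mu> (cball y t)" using t by (intro emeasure_mono) auto
      also have "\<dots> \<le> ennreal (K * t ^ s)" using up y t by simp
      also have "\<dots> \<le> ennreal e" using \<open>K * t ^ s \<le> e\<close> by (rule ennreal_leI)
      finally show "emeasure \<mu> (cball y 0) \<le> 0 + ennreal e" by simp
    qed
    then show ?thesis using True by simp
  qed (use up y r in auto)
  have "emeasure \<mu> A \<le> ennreal (K / k) * hausdorff_delta s 1 A"
  proof (rule ccontr)
    assume "\<not> ?thesis"
    then have lt: "ennreal (K / k) * hausdorff_delta s 1 A < emeasure \<mu> A" by simp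
    have "hausdorff_delta s 1 A < ennreal (k / K) * emeasure \<mu> A"
    proof -
      have "hausdorff_delta s 1 A = ennreal (k / K) * (ennreal (K / k) * hausdorff_delta s 1 A)"
        using K k by (intro ennreal_mult_cancel_inverse[symmetric]) auto
      also have "\<dots> < ennreal (k / K) * emeasure \<mu> A"
        using lt K k by (intro ennreal_mult_strict_left_mono) auto
      finally show ?thesis .
    qed
    from hausdorff_delta_less[OF this] obtain U where U: "A \<subseteq> (\<Union>i. U i)" "\<And>i. bounded (U i)"
      "\<And>i. diameter (U i) \<le> 1" and lt: "(\<Sum>i. hausdorff_size s (U i)) < ennreal (k / K) * emeasure \<mu> A" by blast
    define y where "y i = (SOME y. y \<in> U i \<inter> A)" for i
    define V where "V i = (if U i \<inter> A = {} then {} else cball (y i) (diameter (U i)))" for i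
    have y: "y i \<in> U i \<inter> A" if ne: "U i \<inter> A \<noteq> {}" for i
    proof -
      obtain z where "z \<in> U i \<inter> A" using ne by blast
      then show ?thesis unfolding y_def by (rule someI)
    qed
    have "A \<subseteq> (\<Union>i. V i)"
    proof
      fix x assume "x \<in> A"
      then obtain i where i: "x \<in> U i" using U by auto
      then have "y i \<in> U i" using y \<open>x \<in> A\<close> by blast
      then have "dist (y i) x \<le> diameter (U i)" using i U(2) by (intro diameter_bounded_bound) auto
      then show "x \<in> (\<Union>i. V i)" using i \<open>x \<in> A\<close> by (auto simp: V_def intro!: exI[of _ i])
    qed
    then have "emeasure \<mu> A \<le> emeasure \<mu> (\<Union>i. V i)" by (rule emeasure_mono) (auto simp: V_def assms)
    also have "\<dots> \<le> (\<Sum>i. emeasure \<mu> (V i))"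
      by (rule emeasure_subadditive_countably) (auto simp: V_def assms)
    also have "\<dots> \<le> (\<Sum>i. ennreal (K / k) * hausdorff_size s (U i))"
    proof (rule suminf_le)
      fix i
      have "emeasure \<mu> (V i) \<le> ennreal (K * diameter (U i) ^ s)"
        using up0[of "y i" "diameter (U i)"] y[of i] diameter_ge_0[OF U(2)[of i]] by (auto simp: V_def)
      also have "\<dots> = ennreal (K / k) * hausdorff_size s (U i)"
        unfolding hausdorff_size_def k_def[symmetric] using K k by (subst ennreal_mult'[symmetric]) (auto simp: field_simps)
      finally show "emeasure \<mu> (V i) \<le> ennreal (K / k) * hausdorff_size s (U i)" .
    qed auto
    also have "\<dots> = ennreal (K / k) * (\<Sum>i. hausdorff_size s (U i))" by simp
    also have "\<dots> < ennreal (K / k) * (ennreal (k / K) * emeasure \<mu> A)"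
      using lt K k by (intro ennreal_mult_strict_left_mono) auto
    also have "\<dots> = emeasure \<mu> A"
      using K k by (intro ennreal_mult_cancel_inverse) auto
    finally show False by simp
  qed
  also have "\<dots> \<le> ennreal (K / k) * hausdorff_outer s A"
    by (intro mult_left_mono hausdorff_delta_le_outer) auto
  finally have "emeasure \<mu> A \<le> ennreal (K / k) * hausdorff_outer s A" .
  then show ?thesis using pos by (cases "hausdorff_outer s A = 0") (auto simp: zero_less_iff_neq_zero)
qed

text \<open>A packing argument: the balls of radius \<open>r / 2\<close> around an
  \<open>r\<close>-separated set are disjoint and each has mass at least
  \<open>K * (r / 2) ^ s\<close>, which bounds its cardinality. A maximal such set gives a cover by
  \<open>r\<close>-balls, and \<open>4 ^ s\<close> is the quotient of \<open>(2 * r) ^ s\<close> and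
  \<open>(r / 2) ^ s\<close>.\<close>

lemma hausdorff_outer_finite_of_lower_regular:
  fixes \<mu> :: "'a::euclidean_space measure"
  assumes s: "s \<ge> 1" and [measurable_cong]: "sets \<mu> = sets borel"
    and K: "K > 0" and low: "\<And>y r. y \<in> A \<Longrightarrow> r > 0 \<Longrightarrow> ennreal (K * r ^ s) \<le> emeasure \<mu> (ball y r)"
    and A: "A \<subseteq> ball 0 1" and fin: "emeasure \<mu> (ball 0 2) < top"
  shows "hausdorff_outer s A < top"
proof -
  let ?k = "unit_ball_vol (real s) / 2 ^ s"
  obtain m where m: "m \<ge> 0" "emeasure \<mu> (ball 0 2) = ennreal m"
    using fin by (cases "emeasure \<mu> (ball 0 2)") auto
  have "hausdorff_outer s A \<le> ennreal (?k * m / K * 4 ^ s)"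
  proof (rule hausdorff_outer_le)
    fix \<delta> :: real assume \<delta>: "\<delta> > 0"
    \<comment> \<open>\<open>r \<le> 1\<close> keeps the balls of radius \<open>r / 2\<close> inside
      \<open>ball 0 2\<close>, and \<open>2 * r \<le> \<delta>\<close> makes the covering balls fine
      enough.\<close>
    define r where "r = min 1 (\<delta> / 2)"
    have r: "r > 0" "r \<le> 1" "2 * r \<le> \<delta>" using \<delta> by (auto simp: r_def)
    define F where "F = {F. finite F \<and> F \<subseteq> A \<and> (\<forall>x\<in>F. \<forall>y\<in>F. x \<noteq> y \<longrightarrow> r \<le> dist x y)}"
    have bd: "real (card T) * (K * (r / 2) ^ s) \<le> m" if T: "T \<in> F" for T
    proof -
      have "disjoint_family_on (\<lambda>y. ball y (r / 2)) T"
      proof (unfold disjoint_family_on_def, intro ballI impI)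
        fix x y assume "x \<in> T" "y \<in> T" "x \<noteq> y"
        then have "r \<le> dist x y" using T by (auto simp: F_def)
        then show "ball x (r/2) \<inter> ball y (r/2) = {}"
          by (intro disjoint_ballI) auto
      qed
      then have "(\<Sum>y\<in>T. emeasure \<mu> (ball y (r / 2))) = emeasure \<mu> (\<Union>y\<in>T. ball y (r / 2))"
        using T by (intro sum_emeasure) (auto simp: F_def assms)
      also have "\<dots> \<le> emeasure \<mu> (ball 0 2)"
      proof (rule emeasure_mono)
        show "(\<Union>y\<in>T. ball y (r / 2)) \<subseteq> ball 0 2"
        proof
          fix x assume "x \<in> (\<Union>y\<in>T. ball y (r / 2))"
          then obtain y where y: "y \<in> T" "dist y x < r / 2" by auto
          then have "dist 0 y < 1" using T A by (auto simp: F_def)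
          then show "x \<in> ball 0 2" using y r dist_triangle[of 0 x y] by simp
        qed
      qed (simp add: assms)
      finally have "(\<Sum>y\<in>T. emeasure \<mu> (ball y (r / 2))) \<le> ennreal m" using m by simp
      moreover have "(\<Sum>y\<in>T. ennreal (K * (r / 2) ^ s)) \<le> (\<Sum>y\<in>T. emeasure \<mu> (ball y (r / 2)))"
        using T r by (intro sum_mono low) (auto simp: F_def)
      ultimately have "(\<Sum>y\<in>T. ennreal (K * (r / 2) ^ s)) \<le> ennreal m" by simp
      then show ?thesis
        using K r m by (simp add: ennreal_of_nat_eq_real_of_nat ennreal_mult'[symmetric])
    qed
    have Kr: "K * (r / 2) ^ s > 0" using K r by simp
    have "\<exists>T\<in>F. \<forall>T'\<in>F. card T' \<le> card T"
    proof -
      have "card ` F \<subseteq> {..nat \<lfloor>m / (K * (r / 2) ^ s)\<rfloor>}"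
      proof safe
        fix T assume "T \<in> F"
        then have "real (card T) \<le> m / (K * (r / 2) ^ s)" using bd Kr by (simp add: pos_le_divide_eq)
        then show "card T \<le> nat \<lfloor>m / (K * (r / 2) ^ s)\<rfloor>" by (simp add: le_nat_floor)
      qed
      then have "finite (card ` F)" using finite_subset by blast
      moreover have "{} \<in> F" by (auto simp: F_def)
      ultimately have "Max (card ` F) \<in> card ` F" "\<forall>c\<in>card ` F. c \<le> Max (card ` F)" by (auto intro!: Max_in)
      then obtain T where "T \<in> F" "\<forall>T'\<in>F. card T' \<le> card T" by fastforce
      then show ?thesis by (rule bexI[rotated])
    qed
    then obtain T where T: "T \<in> F" "\<And>T'. T' \<in> F \<Longrightarrow> card T' \<le> card T" by blast
    have finT: "finite T" using T by (auto simp: F_def)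
    have cov: "A \<subseteq> (\<Union>y\<in>T. cball y r)"
    proof
      fix x assume x: "x \<in> A"
      show "x \<in> (\<Union>y\<in>T. cball y r)"
      proof (rule ccontr)
        assume "x \<notin> (\<Union>y\<in>T. cball y r)"
        then have far: "\<forall>y\<in>T. r < dist y x" by (auto simp: not_le)
        then have "insert x T \<in> F" using T(1) x by (auto simp: F_def dist_commute less_imp_le)
        moreover have "x \<notin> T" using far r by force
        ultimately show False using T(2)[of "insert x T"] finT by simp
      qed
    qed
    obtain e where e: "bij_betw e {..<card T} T"
      using finT by (metis atLeast0LessThan ex_bij_betw_nat_finite)
    define U where "U i = (if i < card T then cball (e i) r else {})" for i
    have "hausdorff_delta s \<delta> A \<le> (\<Sum>i. hausdorff_size s (U i))"
    proof (rule hausdorff_delta_le)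
      show "A \<subseteq> (\<Union>i. U i)"
      proof
        fix x assume "x \<in> A"
        then obtain y where "y \<in> T" "x \<in> cball y r" using cov by blast
        then have "y \<in> e ` {..<card T}" using e by (simp add: bij_betw_def)
        then obtain i where "i < card T" "e i = y" by auto
        with \<open>x \<in> cball y r\<close> show "x \<in> (\<Union>i. U i)" by (auto simp: U_def intro!: exI[of _ i])
      qed
      show "diameter (U i) \<le> \<delta>" for i
        using r \<delta> by (auto simp: U_def)
    qed (auto simp: U_def)
    also have "\<dots> = (\<Sum>i<card T. hausdorff_size s (U i))"
      using s by (intro suminf_finite) (auto simp: U_def hausdorff_size_def power_0_left)
    also have "\<dots> \<le> (\<Sum>i<card T. ennreal (?k * (2 * r) ^ s))"
    proof (rule sum_mono)
      fix i assume "i \<in> {..<card T}"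
      then show "hausdorff_size s (U i) \<le> ennreal (?k * (2 * r) ^ s)"
        using r unfolding hausdorff_size_def
        by (intro ennreal_leI mult_left_mono power_mono diameter_ge_0) (auto simp: U_def)
    qed
    also have "\<dots> = ennreal (real (card T) * (?k * (2 * r) ^ s))"
      using r by (simp add: ennreal_of_nat_eq_real_of_nat ennreal_mult'[symmetric])
    also have "\<dots> \<le> ennreal (?k * m / K * 4 ^ s)"
    proof (rule ennreal_leI)
      have "real (card T) * (?k * (2 * r) ^ s) = real (card T) * (K * (r / 2) ^ s) * (?k / K * 4 ^ s)"
      proof -
        have "(2 * r) ^ s = (r / 2) ^ s * 4 ^ s" by (subst power_mult_distrib[symmetric]) simp
        then show ?thesis using K by simp
      qed
      also have "\<dots> \<le> m * (?k / K * 4 ^ s)" using bd[OF T(1)] K by (intro mult_right_mono) auto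
      finally show "real (card T) * (?k * (2 * r) ^ s) \<le> ?k * m / K * 4 ^ s" by (simp add: algebra_simps)
    qed
    finally show "hausdorff_delta s \<delta> A \<le> ennreal (?k * m / K * 4 ^ s)" .
  qed
  then show ?thesis by (rule order_le_less_trans) simp
qed

text \<open>The two regularity bounds make the Hausdorff measure of the unit ball of
  \<open>W\<close> positive and finite, and scaling extends finiteness to all balls. Both measures
  are then sigma-finite and invariant under \<open>W\<close>, and the uniqueness lemma with
  \<open>B\<close> the unit ball makes them proportional; the ball is symmetric, so the reflection
  disappears.\<close>

lemma hausdorff_eq_invariant_measure:
  fixes \<nu> :: "'a::euclidean_space measure"
  assumes s: "s \<ge> 1" and W: "subspace W"
    and sets [measurable_cong]: "sets \<nu> = sets borel"
    and AE: "AE x in \<nu>. x \<in> W"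
    and inv: "\<And>w A. w \<in> W \<Longrightarrow> A \<in> sets borel \<Longrightarrow> emeasure \<nu> ((\<lambda>x. x + w) -` A) = emeasure \<nu> A"
    and K: "K1 > 0" "K2 > 0"
    and low: "\<And>y r. y \<in> W \<Longrightarrow> r > 0 \<Longrightarrow> ennreal (K1 * r ^ s) \<le> emeasure \<nu> (ball y r)"
    and up: "\<And>y r. y \<in> W \<Longrightarrow> r > 0 \<Longrightarrow> emeasure \<nu> (cball y r) \<le> ennreal (K2 * r ^ s)"
  shows "\<exists>c>0. \<forall>A\<in>sets borel. hausdorff_outer s (A \<inter> W) = ennreal c * emeasure \<nu> A"
proof -
  have 0: "0 \<in> W" using W by (rule subspace_0)
  have Wb [measurable]: "W \<in> sets borel" using W by (intro borel_closed closed_subspace)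
  have sp [simp]: "space \<nu> = UNIV" using sets_eq_imp_space_eq[OF sets] by simp
  have bfin: "emeasure \<nu> (ball 0 r) < top" if "r > 0" for r
  proof -
    have "emeasure \<nu> (ball 0 r) \<le> emeasure \<nu> (cball 0 r)" by (intro emeasure_mono) (auto simp: sets)
    also have "\<dots> \<le> ennreal (K2 * r ^ s)" using 0 that by (rule up)
    finally show ?thesis by (rule order_le_less_trans) simp
  qed
  have eqW: "emeasure \<nu> (A \<inter> W) = emeasure \<nu> A" if [measurable]: "A \<in> sets borel" for A
    using AE by (intro emeasure_eq_AE) auto
  have "ennreal K1 \<le> emeasure \<nu> (ball 0 1)" using low[OF 0, of 1] by simp
  then have bpos: "emeasure \<nu> (ball 0 1) > 0"
    using K by (metis ennreal_less_zero_iff less_le_trans)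
  have Hpos: "hausdorff_outer s (ball 0 1 \<inter> W) > 0"
    using s K up bpos by (intro hausdorff_outer_pos_of_upper_regular[of s \<nu> _ K2]) (auto simp: sets eqW)
  have Hfin: "hausdorff_outer s (ball 0 1 \<inter> W) < top"
    using s K low bfin[of 2] by (intro hausdorff_outer_finite_of_lower_regular[of s \<nu> K1]) (auto simp: sets)
  define \<mu> where "\<mu> = density (hausdorff_measure s :: 'a measure) (indicator W)"
  have sets\<mu> [measurable_cong, simp]: "sets \<mu> = sets borel" by (simp add: \<mu>_def)
  have \<mu>: "emeasure \<mu> A = hausdorff_outer s (A \<inter> W)" if [measurable]: "A \<in> sets borel" for A
  proof -
    have "emeasure \<mu> A = (\<integral>\<^sup>+x. indicator W x * indicator A x \<partial>hausdorff_measure s)"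
      unfolding \<mu>_def by (rule emeasure_density) auto
    also have "\<dots> = (\<integral>\<^sup>+x. indicator (A \<inter> W) x \<partial>hausdorff_measure s)"
      by (intro nn_integral_cong) (auto simp: indicator_def)
    also have "\<dots> = hausdorff_outer s (A \<inter> W)" using s by (simp add: emeasure_hausdorff_measure)
    finally show ?thesis .
  qed
  have ballfin: "hausdorff_outer s (ball 0 r \<inter> W) < top" if r: "r > 0" for r
  proof -
    have "ball 0 r \<inter> W \<subseteq> (\<lambda>x. r *\<^sub>R x) ` (ball 0 1 \<inter> W)"
    proof
      fix x assume x: "x \<in> ball 0 r \<inter> W"
      then have "x = r *\<^sub>R ((1 / r) *\<^sub>R x)" "(1 / r) *\<^sub>R x \<in> ball 0 1 \<inter> W"
        using r W by (auto simp: subspace_scale)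
      then show "x \<in> (\<lambda>x. r *\<^sub>R x) ` (ball 0 1 \<inter> W)" by (rule image_eqI)
    qed
    then have "hausdorff_outer s (ball 0 r \<inter> W) \<le> ennreal (r ^ s) * hausdorff_outer s (ball 0 1 \<inter> W)"
      using hausdorff_outer_mono hausdorff_outer_scaleR[OF r] by metis
    also have "\<dots> < top" using Hfin by (simp add: ennreal_mult_less_top)
    finally show ?thesis .
  qed
  have exhaust: "(\<Union>k. ball 0 (real (Suc k))) = (UNIV :: 'a set)"
  proof safe
    fix x :: 'a
    obtain k where "norm x < real k" using reals_Archimedean2 by blast
    then show "x \<in> (\<Union>k. ball 0 (real (Suc k)))" by (intro UN_I[of k]) auto
  qed auto
  have sf: "sigma_finite_measure M"
    if "sets M = sets borel" "\<And>k. emeasure M (ball 0 (real (Suc k))) < top" for M :: "'a measure"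
  proof
    show "\<exists>A. countable A \<and> A \<subseteq> sets M \<and> \<Union>A = space M \<and> (\<forall>a\<in>A. emeasure M a \<noteq> \<infinity>)"
      using that exhaust sets_eq_imp_space_eq[OF that(1)]
      by (intro exI[of _ "range (\<lambda>k. ball 0 (real (Suc k)))"]) (auto simp: less_top)
  qed
  have inv\<mu>: "emeasure \<mu> ((\<lambda>x. x + w) -` A) = emeasure \<mu> A" if w: "w \<in> W" and [measurable]: "A \<in> sets borel" for w A
  proof -
    have [measurable]: "(\<lambda>x::'a. x + w) -` A \<in> sets borel"
      using measurable_sets[of "\<lambda>x::'a. x + w" borel borel A] by simp
    have "A \<inter> W = (\<lambda>x. x + w) ` ((\<lambda>x. x + w) -` A \<inter> W)"
    proof safe
      fix x assume "x \<in> A" "x \<in> W"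
      then show "x \<in> (\<lambda>x. x + w) ` ((\<lambda>x. x + w) -` A \<inter> W)"
        using w W by (intro image_eqI[of _ _ "x - w"]) (auto simp: subspace_diff)
    qed (use w W in \<open>auto simp: subspace_add\<close>)
    then have "hausdorff_outer s (A \<inter> W) = hausdorff_outer s ((\<lambda>x. x + w) -` A \<inter> W)"
      using hausdorff_outer_isometry_image[of "\<lambda>x. x + w" s] by simp
    then show ?thesis by (simp add: \<mu>)
  qed
  have key: "emeasure \<mu> A * emeasure \<nu> (ball 0 1) = emeasure \<nu> A * emeasure \<mu> (ball 0 1)"
    if A: "A \<in> sets borel" for A
  proof -
    have "emeasure \<mu> A * emeasure \<nu> (ball 0 1) = emeasure \<nu> A * emeasure \<mu> (uminus -` ball 0 1)"
    proof (rule translation_invariant_measure_unique[OF W])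
      show "sigma_finite_measure \<mu>" by (rule sf) (use ballfin in \<open>auto simp: \<mu>\<close>)
      show "sigma_finite_measure \<nu>" by (rule sf) (use bfin in \<open>auto simp: sets\<close>)
      show "AE x in \<mu>. x \<in> W" unfolding \<mu>_def by (subst AE_density) (auto simp: indicator_def)
    qed (use AE inv inv\<mu> A in \<open>auto simp: sets\<close>)
    also have "uminus -` ball 0 1 = (ball 0 1 :: 'a set)" by auto
    finally show ?thesis .
  qed
  obtain a where a: "a > 0" "emeasure \<nu> (ball 0 1) = ennreal a"
    using bpos bfin[of 1] by (cases "emeasure \<nu> (ball 0 1)") auto
  obtain b where b: "b > 0" "hausdorff_outer s (ball 0 1 \<inter> W) = ennreal b"
    using Hpos Hfin by (cases "hausdorff_outer s (ball 0 1 \<inter> W)") auto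
  have "hausdorff_outer s (A \<inter> W) = ennreal (b / a) * emeasure \<nu> A" if A: "A \<in> sets borel" for A
  proof -
    have "hausdorff_outer s (A \<inter> W) * ennreal a = emeasure \<nu> A * ennreal b"
      using key[OF A] A a b by (simp add: \<mu>)
    then have "ennreal (1 / a) * (ennreal a * hausdorff_outer s (A \<inter> W)) = ennreal (1 / a) * (ennreal b * emeasure \<nu> A)"
      by (simp add: mult.commute)
    then show ?thesis
      using a b by (simp add: ennreal_mult_cancel_inverse mult.assoc[symmetric] ennreal_mult'[symmetric])
  qed
  then show ?thesis using a b by (intro exI[of _ "b / a"]) auto
qed

subsection \<open>Hyperplanes\<close>

definition hproj :: "'a::euclidean_space \<Rightarrow> 'a \<Rightarrow> 'a" where
  "hproj v x = x - (x \<bullet> v) *\<^sub>R v"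

text \<open>Lebesgue measure of the hyperplane orthogonal to a unit vector \<open>v\<close>,
  obtained without choosing coordinates there: the measure of a set is the volume of the cylinder of
  height 1 over it.\<close>

definition perp_measure :: "'a::euclidean_space \<Rightarrow> 'a measure" where
  "perp_measure v = distr (density lborel (indicator {x. 0 \<le> x \<bullet> v \<and> x \<bullet> v < 1})) borel (hproj v)"

lemma borel_measurable_hproj [measurable]: "hproj v \<in> borel_measurable borel"
  unfolding hproj_def by measurable

lemma hproj_inner: "norm v = 1 \<Longrightarrow> hproj v x \<bullet> v = 0"
  by (simp add: hproj_def inner_diff_left norm_eq_1)

lemma hproj_add: "hproj v (x + y) = hproj v x + hproj v y"
  by (simp add: hproj_def inner_add_left scaleR_add_left)

lemma hproj_diff: "hproj v (x - y) = hproj v x - hproj v y"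
  by (simp add: hproj_def inner_diff_left scaleR_diff_left)

lemma hproj_scaleR_self: "norm v = 1 \<Longrightarrow> hproj v (t *\<^sub>R v) = 0"
  by (simp add: hproj_def norm_eq_1)

lemma hproj_perp: "w \<bullet> v = 0 \<Longrightarrow> hproj v w = w"
  by (simp add: hproj_def)

lemma hproj_decomp: "x = hproj v x + (x \<bullet> v) *\<^sub>R v"
  by (simp add: hproj_def)

lemma norm_hproj_decomp:
  assumes v: "norm v = 1" shows "(norm x)\<^sup>2 = (norm (hproj v x))\<^sup>2 + (x \<bullet> v)\<^sup>2"
proof -
  have "(norm (hproj v x))\<^sup>2 = x \<bullet> x - (x \<bullet> v)\<^sup>2"
    unfolding hproj_def power2_norm_eq_inner using v
    by (simp add: inner_diff_left inner_diff_right norm_eq_1 inner_commute power2_eq_square)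
  then show ?thesis by (simp add: power2_norm_eq_inner)
qed

lemma norm_hproj_le:
  assumes "norm v = 1" shows "norm (hproj v x) \<le> norm x"
proof (rule power2_le_imp_le)
  show "(norm (hproj v x))\<^sup>2 \<le> (norm x)\<^sup>2"
    using norm_hproj_decomp[OF assms, of x] zero_le_power2[of "x \<bullet> v"] by linarith
qed simp

lemma dist_hproj_le: "norm v = 1 \<Longrightarrow> dist (hproj v x) (hproj v y) \<le> dist x y"
  by (simp add: dist_norm norm_hproj_le flip: hproj_diff)

lemma sets_perp_measure [simp, measurable_cong]: "sets (perp_measure v) = sets borel"
  by (simp add: perp_measure_def)

lemma space_perp_measure [simp]: "space (perp_measure v) = UNIV"
  by (simp add: perp_measure_def)

lemma emeasure_perp_measure:
  assumes [measurable]: "P \<in> sets borel"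
  shows "emeasure (perp_measure v) P = emeasure lborel {x. 0 \<le> x \<bullet> v \<and> x \<bullet> v < 1 \<and> hproj v x \<in> P}"
proof -
  have "emeasure (perp_measure v) P = emeasure (density lborel (indicator {x. 0 \<le> x \<bullet> v \<and> x \<bullet> v < 1})) (hproj v -` P)"
    unfolding perp_measure_def by (subst emeasure_distr) auto
  also have "\<dots> = (\<integral>\<^sup>+x. indicator {x. 0 \<le> x \<bullet> v \<and> x \<bullet> v < 1} x * indicator (hproj v -` P) x \<partial>lborel)"
    using measurable_sets[of "hproj v" borel borel P] by (intro emeasure_density) auto
  also have "\<dots> = (\<integral>\<^sup>+x. indicator {x. 0 \<le> x \<bullet> v \<and> x \<bullet> v < 1 \<and> hproj v x \<in> P} x \<partial>lborel)"
    by (intro nn_integral_cong) (auto simp: indicator_def)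
  also have "\<dots> = emeasure lborel {x. 0 \<le> x \<bullet> v \<and> x \<bullet> v < 1 \<and> hproj v x \<in> P}"
    by (intro nn_integral_indicator) measurable
  finally show ?thesis .
qed

lemma emeasure_lborel_translate:
  fixes A :: "'a::euclidean_space set"
  assumes [measurable]: "A \<in> sets borel"
  shows "emeasure lborel ((\<lambda>x. x + w) -` A) = emeasure lborel A"
proof -
  have "emeasure lborel A = emeasure (distr lborel borel ((+) w)) A"
    by (simp add: lborel_distr_plus)
  also have "\<dots> = emeasure lborel ((+) w -` A)" by (subst emeasure_distr) auto
  finally show ?thesis by (simp add: vimage_def add.commute)
qed

lemma bounded_slab:
  assumes v: "norm v = 1" and "bounded P" "bounded I"
  shows "bounded {x. x \<bullet> v \<in> I \<and> hproj v x \<in> P}"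
proof -
  obtain a b where ab: "\<And>x. x \<in> P \<Longrightarrow> norm x \<le> a" "\<And>t. t \<in> I \<Longrightarrow> norm t \<le> b"
    using assms(2,3) unfolding bounded_iff by blast
  have "norm x \<le> a + b" if "x \<bullet> v \<in> I" "hproj v x \<in> P" for x
  proof -
    have "norm x \<le> norm (hproj v x) + norm ((x \<bullet> v) *\<^sub>R v)"
      using norm_triangle_ineq[of "hproj v x" "(x \<bullet> v) *\<^sub>R v"] hproj_decomp[of x v] by simp
    then show ?thesis using ab(1)[OF that(2)] ab(2)[OF that(1)] v by simp
  qed
  then show ?thesis unfolding bounded_iff by blast
qed

text \<open>For fixed \<open>P\<close> the volume is a translation invariant measure in
  \<open>I\<close>, hence a multiple of length; height 1 identifies the factor. Boundedness of
  \<open>P\<close> provides sigma-finiteness.\<close>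

lemma emeasure_slab_bounded:
  assumes v: "norm v = 1" and [measurable]: "P \<in> sets borel" "I \<in> sets borel" and P: "bounded P"
  shows "emeasure lborel {x. x \<bullet> v \<in> I \<and> hproj v x \<in> P} = emeasure lborel I * emeasure (perp_measure v) P"
proof -
  define \<nu> where "\<nu> = distr (density lborel (indicator (hproj v -` P))) borel (\<lambda>x. x \<bullet> v)"
  have [measurable]: "hproj v -` P \<in> sets borel" using measurable_sets[of "hproj v" borel borel P] by simp
  have \<nu>: "emeasure \<nu> J = emeasure lborel {x. x \<bullet> v \<in> J \<and> hproj v x \<in> P}" if [measurable]: "J \<in> sets borel" for J
  proof -
    have [measurable]: "(\<lambda>x. x \<bullet> v) -` J \<in> sets borel"
      using measurable_sets[of "\<lambda>x. x \<bullet> v" borel borel J] by simp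
    have "emeasure \<nu> J = emeasure (density lborel (indicator (hproj v -` P))) ((\<lambda>x. x \<bullet> v) -` J)"
      unfolding \<nu>_def by (subst emeasure_distr) auto
    also have "\<dots> = (\<integral>\<^sup>+x. indicator (hproj v -` P) x * indicator ((\<lambda>x. x \<bullet> v) -` J) x \<partial>lborel)"
      by (intro emeasure_density) auto
    also have "\<dots> = (\<integral>\<^sup>+x. indicator {x. x \<bullet> v \<in> J \<and> hproj v x \<in> P} x \<partial>lborel)"
      by (intro nn_integral_cong) (auto simp: indicator_def)
    also have "\<dots> = emeasure lborel {x. x \<bullet> v \<in> J \<and> hproj v x \<in> P}"
      by (intro nn_integral_indicator) measurable
    finally show ?thesis .
  qed
  have sets\<nu>: "sets \<nu> = sets borel" by (simp add: \<nu>_def)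
  \<comment> \<open>The second interval is chosen so that its reflection is \<open>{0..<1}\<close>,
    the range of heights in the definition of \<open>perp_measure\<close>.\<close>
  have "emeasure \<nu> I * emeasure lborel {-1<..0::real} = emeasure lborel I * emeasure \<nu> (uminus -` {-1<..0})"
  proof (rule translation_invariant_measure_unique[of UNIV])
    show "sigma_finite_measure \<nu>"
    proof
      have fin: "emeasure \<nu> {-real k<..<real k} < top" for k
        using emeasure_bounded_finite[OF bounded_slab[OF v P, of "{-real k<..<real k}"]] by (simp add: \<nu>)
      have "(\<Union>k. {-real k<..<real k}) = (UNIV :: real set)"
      proof safe
        fix x :: real
        obtain k where "\<bar>x\<bar> < real k" using reals_Archimedean2 by blast
        then show "x \<in> (\<Union>k. {-real k<..<real k})" by (intro UN_I[of k]) auto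
      qed auto
      then show "\<exists>A. countable A \<and> A \<subseteq> sets \<nu> \<and> \<Union>A = space \<nu> \<and> (\<forall>a\<in>A. emeasure \<nu> a \<noteq> \<infinity>)"
        using fin sets_eq_imp_space_eq[OF sets\<nu>]
        by (intro exI[of _ "range (\<lambda>k. {-real k<..<real k})"]) (auto simp: sets\<nu> less_top)
    qed
    fix w :: real and J :: "real set" assume [measurable]: "J \<in> sets borel"
    have [measurable]: "(\<lambda>x. x + w) -` J \<in> sets borel"
      using measurable_sets[of "\<lambda>x. x + w" borel borel J] by simp
    show "emeasure \<nu> ((\<lambda>x. x + w) -` J) = emeasure \<nu> J"
    proof -
      have "(\<lambda>x. x + w *\<^sub>R v) -` {x. x \<bullet> v \<in> J \<and> hproj v x \<in> P}
          = {x. x \<bullet> v \<in> (\<lambda>x. x + w) -` J \<and> hproj v x \<in> P}"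
        using v by (auto simp: hproj_add hproj_scaleR_self inner_add_left norm_eq_1)
      moreover have "{x. x \<bullet> v \<in> J \<and> hproj v x \<in> P} \<in> sets borel" by measurable
      ultimately show ?thesis using emeasure_lborel_translate[of "{x. x \<bullet> v \<in> J \<and> hproj v x \<in> P}" "w *\<^sub>R v"]
        by (simp add: \<nu>)
    qed
  qed (auto simp: sets\<nu> emeasure_lborel_translate sigma_finite_lborel)
  moreover have "uminus -` {-1<..0} = {0..<1::real}" by auto
  ultimately have "emeasure \<nu> I = emeasure lborel I * emeasure \<nu> {0..<1}" by simp
  then show ?thesis by (simp add: \<nu> emeasure_perp_measure conj_assoc)
qed

lemma UN_ball_nat: "(\<Union>k. ball 0 (real k)) = (UNIV :: 'a::real_normed_vector set)"
proof safe
  fix x :: 'a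
  obtain k where "norm x < real k" using reals_Archimedean2 by blast
  then show "x \<in> (\<Union>k. ball 0 (real k))" by (intro UN_I[of k]) auto
qed auto

lemma emeasure_slab:
  assumes v: "norm v = 1" and [measurable]: "P \<in> sets borel" "I \<in> sets borel"
  shows "emeasure lborel {x. x \<bullet> v \<in> I \<and> hproj v x \<in> P} = emeasure lborel I * emeasure (perp_measure v) P"
proof -
  let ?P = "\<lambda>k::nat. P \<inter> ball 0 (real k)"
  have P: "(\<Union>k. ?P k) = P"
    using UN_ball_nat by blast
  have inc: "incseq ?P" by (auto simp: incseq_def)
  have "emeasure lborel {x. x \<bullet> v \<in> I \<and> hproj v x \<in> P}
      = emeasure lborel (\<Union>k. {x. x \<bullet> v \<in> I \<and> hproj v x \<in> ?P k})"
    by (rule arg_cong[of _ _ "emeasure lborel"]) (use UN_ball_nat in blast)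
  also have "\<dots> = (SUP k. emeasure lborel {x. x \<bullet> v \<in> I \<and> hproj v x \<in> ?P k})"
    by (rule SUP_emeasure_incseq[symmetric]) (auto simp: incseq_def)
  also have "\<dots> = (SUP k. emeasure lborel I * emeasure (perp_measure v) (?P k))"
    by (intro SUP_cong refl emeasure_slab_bounded v) (auto intro: bounded_Int)
  also have "\<dots> = emeasure lborel I * (SUP k. emeasure (perp_measure v) (?P k))"
    by (rule SUP_mult_left_ennreal[symmetric])
  also have "(SUP k. emeasure (perp_measure v) (?P k)) = emeasure (perp_measure v) P"
    using inc by (subst SUP_emeasure_incseq) (auto simp: P simp del: UN_simps)
  finally show ?thesis .
qed

lemma sigma_finite_perp_measure:
  assumes v: "norm v = 1" shows "sigma_finite_measure (perp_measure v)"
proof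
  have fin: "emeasure (perp_measure v) (ball 0 (real k)) < top" for k
  proof -
    have "bounded {x. 0 \<le> x \<bullet> v \<and> x \<bullet> v < 1 \<and> hproj v x \<in> ball 0 (real k)}"
      by (rule bounded_subset[OF bounded_slab[OF v bounded_ball[of 0 "real k"] bounded_closed_interval[of 0 1]]]) auto
    from emeasure_bounded_finite[OF this] show ?thesis by (simp add: emeasure_perp_measure)
  qed
  show "\<exists>A. countable A \<and> A \<subseteq> sets (perp_measure v) \<and> \<Union>A = space (perp_measure v)
      \<and> (\<forall>a\<in>A. emeasure (perp_measure v) a \<noteq> \<infinity>)"
    using fin UN_ball_nat by (intro exI[of _ "range (\<lambda>k. ball 0 (real k))"]) (auto simp: less_top)
qed

lemma perp_measure_translate:
  assumes v: "norm v = 1" and w: "w \<bullet> v = 0" and [measurable]: "A \<in> sets borel"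
  shows "emeasure (perp_measure v) ((\<lambda>x. x + w) -` A) = emeasure (perp_measure v) A"
proof -
  have [measurable]: "(\<lambda>x. x + w) -` A \<in> sets borel"
    using measurable_sets[of "\<lambda>x. x + w" borel borel A] by simp
  have "(\<lambda>x. x + w) -` {x. 0 \<le> x \<bullet> v \<and> x \<bullet> v < 1 \<and> hproj v x \<in> A}
      = {x. 0 \<le> x \<bullet> v \<and> x \<bullet> v < 1 \<and> hproj v x \<in> (\<lambda>x. x + w) -` A}"
    using w by (auto simp: hproj_add hproj_perp inner_add_left)
  moreover have "{x. 0 \<le> x \<bullet> v \<and> x \<bullet> v < 1 \<and> hproj v x \<in> A} \<in> sets borel" by measurable
  ultimately show ?thesis
    using emeasure_lborel_translate[of "{x. 0 \<le> x \<bullet> v \<and> x \<bullet> v < 1 \<and> hproj v x \<in> A}" w]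
    by (simp add: emeasure_perp_measure)
qed

lemma AE_perp_measure: "norm v = 1 \<Longrightarrow> AE x in perp_measure v. x \<bullet> v = 0"
  unfolding perp_measure_def by (subst AE_distr_iff) (auto simp: hproj_inner)

text \<open>A slab of height \<open>r\<close> over the disc sits in a ball of radius
  \<open>2 * r\<close>. Together with the next lemma, where a ball sits in a slab of height
  \<open>2 * r\<close>, this is the regularity needed for the comparison with Hausdorff
  measure.\<close>

lemma perp_measure_cball_le:
  fixes v :: "'a::euclidean_space"
  assumes v: "norm v = 1" and y: "y \<bullet> v = 0" and r: "r > 0"
  shows "emeasure (perp_measure v) (cball y r)
    \<le> ennreal (unit_ball_vol (real DIM('a)) * 2 ^ DIM('a) * r ^ (DIM('a) - 1))"
proof -
  have "ennreal r * emeasure (perp_measure v) (cball y r) = emeasure lborel {x. x \<bullet> v \<in> {0..r} \<and> hproj v x \<in> cball y r}"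
    using v r by (subst emeasure_slab) auto
  also have "\<dots> \<le> emeasure lborel (cball y (2 * r))"
  proof (rule emeasure_mono)
    show "{x. x \<bullet> v \<in> {0..r} \<and> hproj v x \<in> cball y r} \<subseteq> cball y (2 * r)"
    proof safe
      fix x assume x: "x \<bullet> v \<in> {0..r}" "hproj v x \<in> cball y r"
      have "dist y x \<le> dist y (hproj v x) + dist (hproj v x) x" by (rule dist_triangle)
      also have "dist (hproj v x) x = \<bar>x \<bullet> v\<bar>" using v by (simp add: hproj_def dist_norm)
      finally show "x \<in> cball y (2 * r)" using x by auto
    qed
  qed simp
  also have "\<dots> = ennreal (unit_ball_vol (real DIM('a)) * (2 * r) ^ DIM('a))"
    using r by (simp add: emeasure_cball)
  finally have "ennreal (1 / r) * (ennreal r * emeasure (perp_measure v) (cball y r))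
      \<le> ennreal (1 / r) * ennreal (unit_ball_vol (real DIM('a)) * (2 * r) ^ DIM('a))"
    by (rule mult_left_mono) simp
  then have "emeasure (perp_measure v) (cball y r) \<le> ennreal ((1 / r) * (unit_ball_vol (real DIM('a)) * (2 * r) ^ DIM('a)))"
    using r by (subst (asm) ennreal_mult_cancel_inverse) (auto simp: ennreal_mult'[symmetric])
  also have "(1 / r) * (unit_ball_vol (real DIM('a)) * (2 * r) ^ DIM('a))
      = unit_ball_vol (real DIM('a)) * 2 ^ DIM('a) * r ^ (DIM('a) - 1)"
    using r by (simp add: power_mult_distrib power_eq_if[of r "DIM('a)"])
  finally show ?thesis .
qed

lemma perp_measure_ball_ge:
  fixes v :: "'a::euclidean_space"
  assumes v: "norm v = 1" and y: "y \<bullet> v = 0" and r: "r > 0"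
  shows "ennreal (unit_ball_vol (real DIM('a)) / 2 * r ^ (DIM('a) - 1)) \<le> emeasure (perp_measure v) (ball y r)"
proof -
  have "ennreal (unit_ball_vol (real DIM('a)) * r ^ DIM('a)) = emeasure lborel (ball y r)"
    using r by (simp add: emeasure_ball)
  also have "\<dots> \<le> emeasure lborel {x. x \<bullet> v \<in> {-r..r} \<and> hproj v x \<in> ball y r}"
  proof (rule emeasure_mono)
    show "ball y r \<subseteq> {x. x \<bullet> v \<in> {-r..r} \<and> hproj v x \<in> ball y r}"
    proof safe
      fix x assume x: "x \<in> ball y r"
      have "\<bar>(x - y) \<bullet> v\<bar> \<le> norm (x - y) * norm v" by (rule Cauchy_Schwarz_ineq2)
      also have "\<dots> < r" using x v by (simp add: dist_norm norm_minus_commute)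
      finally show "x \<bullet> v \<in> {-r..r}" using y by (auto simp: inner_diff_left abs_less_iff)
      show "hproj v x \<in> ball y r" using x dist_hproj_le[OF v, of y x] hproj_perp[OF y] by auto
    qed
    show "{x. x \<bullet> v \<in> {-r..r} \<and> hproj v x \<in> ball y r} \<in> sets lborel"
      using measurable_sets[OF borel_measurable_hproj, of "ball y r" v] by (auto simp: vimage_def)
  qed
  also have "\<dots> = ennreal (2 * r) * emeasure (perp_measure v) (ball y r)"
    using v r by (subst emeasure_slab) auto
  finally have "ennreal (1 / (2 * r)) * ennreal (unit_ball_vol (real DIM('a)) * r ^ DIM('a))
      \<le> ennreal (1 / (2 * r)) * (ennreal (2 * r) * emeasure (perp_measure v) (ball y r))"
    by (rule mult_left_mono) simp
  then have "ennreal ((1 / (2 * r)) * (unit_ball_vol (real DIM('a)) * r ^ DIM('a))) \<le> emeasure (perp_measure v) (ball y r)"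
    using r by (subst (asm) ennreal_mult_cancel_inverse) (auto simp: ennreal_mult'[symmetric])
  also have "(1 / (2 * r)) * (unit_ball_vol (real DIM('a)) * r ^ DIM('a)) = unit_ball_vol (real DIM('a)) / 2 * r ^ (DIM('a) - 1)"
    using r by (simp add: power_eq_if[of r "DIM('a)"])
  finally show ?thesis .
qed

text \<open>Serves to transfer the behaviour of Hausdorff measure under Lipschitz maps and
  isometries to Lebesgue measure; the unknown constant occurs on both sides and cancels.\<close>

lemma hausdorff_eq_lborel:
  "\<exists>c>0. \<forall>A\<in>sets borel. hausdorff_outer DIM('a) A = ennreal c * emeasure lborel (A :: 'a::euclidean_space set)"
proof -
  have "\<exists>c>0. \<forall>A\<in>sets borel. hausdorff_outer DIM('a) (A \<inter> UNIV) = ennreal c * emeasure lborel (A :: 'a set)"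
    by (rule hausdorff_eq_invariant_measure[of _ _ _ "unit_ball_vol (real DIM('a))" "unit_ball_vol (real DIM('a))"])
      (auto simp: emeasure_lborel_translate emeasure_ball emeasure_cball Suc_le_eq)
  then show ?thesis by simp
qed

lemma emeasure_lborel_Lipschitz_image:
  fixes f :: "'a::euclidean_space \<Rightarrow> 'a"
  assumes L: "L > 0" and lip: "\<And>x y. x \<in> A \<Longrightarrow> y \<in> A \<Longrightarrow> dist (f x) (f y) \<le> L * dist x y"
    and A: "A \<in> sets borel" "f ` A \<in> sets borel"
  shows "emeasure lborel (f ` A) \<le> ennreal (L ^ DIM('a)) * emeasure lborel A"
proof -
  obtain c where c: "c > 0" "\<And>A::'a set. A \<in> sets borel \<Longrightarrow> hausdorff_outer DIM('a) A = ennreal c * emeasure lborel A"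
    using hausdorff_eq_lborel by metis
  have "ennreal c * emeasure lborel (f ` A) \<le> ennreal (L ^ DIM('a)) * (ennreal c * emeasure lborel A)"
    using hausdorff_outer_Lipschitz_image[OF L lip, of A "DIM('a)"] A by (simp add: c(2))
  also have "\<dots> = ennreal c * (ennreal (L ^ DIM('a)) * emeasure lborel A)"
    by (rule mult.left_commute)
  finally have "ennreal (1 / c) * (ennreal c * emeasure lborel (f ` A))
      \<le> ennreal (1 / c) * (ennreal c * (ennreal (L ^ DIM('a)) * emeasure lborel A))"
    by (rule mult_left_mono) simp
  moreover have "ennreal (1 / c) * (ennreal c * z) = z" for z
    using c(1) by (intro ennreal_mult_cancel_inverse) auto
  ultimately show ?thesis by simp
qed

lemma emeasure_lborel_isometry_image:
  fixes f :: "'a::euclidean_space \<Rightarrow> 'a"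
  assumes iso: "\<And>x y. dist (f x) (f y) = dist x y" and A: "A \<in> sets borel" "f ` A \<in> sets borel"
  shows "emeasure lborel (f ` A) = emeasure lborel A"
proof -
  obtain c where c: "c > 0" "\<And>A::'a set. A \<in> sets borel \<Longrightarrow> hausdorff_outer DIM('a) A = ennreal c * emeasure lborel A"
    using hausdorff_eq_lborel by metis
  have "ennreal c * emeasure lborel (f ` A) = ennreal c * emeasure lborel A"
    using hausdorff_outer_isometry_image[of f, OF iso, of "DIM('a)" A] A by (simp only: c(2))
  then have "ennreal (1 / c) * (ennreal c * emeasure lborel (f ` A)) = ennreal (1 / c) * (ennreal c * emeasure lborel A)"
    by (rule arg_cong)
  moreover have "ennreal (1 / c) * (ennreal c * z) = z" for z
    using c(1) by (intro ennreal_mult_cancel_inverse) auto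
  ultimately show ?thesis by simp
qed

text \<open>The constant \<open>c\<close> is in fact 1, but this requires the isodiametric inequality and is not needed,
  since \<open>c\<close> cancels in the comparison of the two sides of a lower \<open>Q\<close>-inequality.\<close>

lemma hausdorff_eq_perp_measure:
  assumes n2: "DIM('a::euclidean_space) \<ge> 2"
  shows "\<exists>c>0. \<forall>v::'a. norm v = 1 \<longrightarrow>
    (\<forall>A\<in>sets borel. hausdorff_outer (DIM('a) - 1) (A \<inter> {x. x \<bullet> v = 0}) = ennreal c * emeasure (perp_measure v) A)"
proof -
  let ?H = "hausdorff_outer (DIM('a) - 1) :: 'a set \<Rightarrow> ennreal"
  let ?B = "ball (0::'a) 1"
  have ex: "\<exists>c>0. \<forall>A\<in>sets borel. ?H (A \<inter> {x. x \<bullet> v = 0}) = ennreal c * emeasure (perp_measure v) A"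
    if v: "norm v = 1" for v :: 'a
  proof (rule hausdorff_eq_invariant_measure[of _ _ _ "unit_ball_vol (real DIM('a)) / 2"
        "unit_ball_vol (real DIM('a)) * 2 ^ DIM('a)"])
    show "subspace {x. x \<bullet> v = 0}" by (auto simp: subspace_def inner_add_left)
  qed (use n2 v AE_perp_measure[OF v] perp_measure_translate[OF v] perp_measure_cball_le[OF v]
      perp_measure_ball_ge[OF v] in auto)
  obtain b :: 'a where b: "b \<in> Basis" by fastforce
  then have nb: "norm b = 1" by simp
  obtain c where c: "c > 0" "\<And>A. A \<in> sets borel \<Longrightarrow> ?H (A \<inter> {x. x \<bullet> b = 0}) = ennreal c * emeasure (perp_measure b) A"
    using ex[OF nb] by blast
  have "?H (A \<inter> {x. x \<bullet> v = 0}) = ennreal c * emeasure (perp_measure v) A"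
    if v: "norm v = 1" and A: "A \<in> sets borel" for v A
  proof -
    obtain d where d: "d > 0" "\<And>A. A \<in> sets borel \<Longrightarrow> ?H (A \<inter> {x. x \<bullet> v = 0}) = ennreal d * emeasure (perp_measure v) A"
      using ex[OF v] by blast
    \<comment> \<open>\<open>R\<close> is the reflection exchanging \<open>b\<close> and
      \<open>v\<close>; for \<open>b = v\<close> division by zero makes it the identity. It carries
      the unit disc and the unit cylinder for \<open>b\<close> to those for \<open>v\<close>, so
      both directions share one constant.\<close>
    define u where "u = b - v"
    define R where "R x = x - (2 * (x \<bullet> u) / (u \<bullet> u)) *\<^sub>R u" for x
    have R_inner: "R x \<bullet> R y = x \<bullet> y" for x y
      by (cases "u = 0") (auto simp: R_def inner_diff_left inner_diff_right inner_commute field_simps)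
    have R_diff: "R x - R y = R (x - y)" for x y
      by (simp add: R_def inner_diff_left diff_divide_distrib right_diff_distrib scaleR_diff_left)
    have iso: "dist (R x) (R y) = dist x y" for x y
      unfolding dist_norm R_diff norm_eq_sqrt_inner R_inner ..
    have RR: "R (R x) = x" for x
    proof (cases "u = 0")
      case False
      have "R x \<bullet> u = - (x \<bullet> u)" using False by (simp add: R_def inner_diff_left)
      then have "R (R x) = R x + (2 * (x \<bullet> u) / (u \<bullet> u)) *\<^sub>R u" by (subst (1) R_def) simp
      then show ?thesis by (simp add: R_def)
    qed (simp add: R_def)
    have "R b = v"
    proof (cases "u = 0")
      case False
      have "u \<bullet> u = 2 * (b \<bullet> u)" using nb v by (simp add: u_def inner_diff_left inner_diff_right norm_eq_1 inner_commute)
      then have "2 * (b \<bullet> u) / (u \<bullet> u) = 1" using False by (metis divide_self inner_eq_zero_iff)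
      then have "R b = b - 1 *\<^sub>R u" by (simp only: R_def)
      then show ?thesis by (simp add: u_def)
    qed (simp add: R_def u_def)
    then have Rv: "R x \<bullet> v = x \<bullet> b" for x using R_inner[of x b] by simp
    have Rn: "norm (R x) = norm x" for x by (simp add: norm_eq_sqrt_inner R_inner)
    have Rproj: "norm (hproj v (R x)) = norm (hproj b x)" for x
      using norm_hproj_decomp[OF v, of "R x"] norm_hproj_decomp[OF nb, of x] by (simp add: Rv Rn)
    have img: "{x. P x} = R ` {x. P (R x)}" for P
      by (auto intro!: image_eqI[of _ _ "R _"] simp: RR)
    have "?H (?B \<inter> {x. x \<bullet> v = 0}) = ?H (R ` (?B \<inter> {x. x \<bullet> b = 0}))"
      using img[of "\<lambda>x. norm x < 1 \<and> x \<bullet> v = 0"] by (simp add: Rv Rn Int_def)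
    then have H: "?H (?B \<inter> {x. x \<bullet> v = 0}) = ?H (?B \<inter> {x. x \<bullet> b = 0})"
      by (simp add: hausdorff_outer_isometry_image[OF iso])
    have eq: "{x. 0 \<le> x \<bullet> v \<and> x \<bullet> v < 1 \<and> hproj v x \<in> ?B} = R ` {x. 0 \<le> x \<bullet> b \<and> x \<bullet> b < 1 \<and> hproj b x \<in> ?B}"
      using img[of "\<lambda>x. 0 \<le> x \<bullet> v \<and> x \<bullet> v < 1 \<and> norm (hproj v x) < 1"] by (simp add: Rv Rproj)
    have [measurable]: "?B \<in> sets borel" by simp
    have m: "{x. 0 \<le> x \<bullet> w \<and> x \<bullet> w < 1 \<and> hproj w x \<in> ?B} \<in> sets borel" for w by measurable
    have L: "emeasure (perp_measure v) ?B = emeasure (perp_measure b) ?B"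
      unfolding emeasure_perp_measure[OF borel_open[OF open_ball]] eq
      by (rule emeasure_lborel_isometry_image[OF iso m]) (use m[of v, unfolded eq] in assumption)
    have "ennreal (unit_ball_vol (real DIM('a)) / 2) \<le> emeasure (perp_measure b) ?B"
      using perp_measure_ball_ge[OF nb, of 0 1] by simp
    then have pos: "emeasure (perp_measure b) ?B > 0"
      by (rule order_less_le_trans[rotated]) simp
    have "emeasure (perp_measure b) ?B \<le> emeasure (perp_measure b) (cball 0 1)" by (intro emeasure_mono) auto
    also have "\<dots> < top"
      using perp_measure_cball_le[OF nb, of 0 1] by (auto simp: order_le_less_trans)
    finally have fin: "emeasure (perp_measure b) ?B < top" .
    have "ennreal d * emeasure (perp_measure b) ?B = ennreal c * emeasure (perp_measure b) ?B"
      using c(2)[of ?B] d(2)[of ?B] H L by simp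
    moreover obtain m where "m > 0" "emeasure (perp_measure b) ?B = ennreal m"
      using pos fin by (cases "emeasure (perp_measure b) ?B") auto
    ultimately have "d = c" using c(1) d(1) by (simp add: ennreal_mult'[symmetric])
    then show ?thesis using d(2)[OF A] by simp
  qed
  then show ?thesis using c(1) by blast
qed

subsection \<open>Line integrals\<close>

text \<open>List recursion for the sum in \<open>variation_on\<close>, so that inserting and joining
  partition points become list inductions.\<close>

fun chain_length :: "(real \<Rightarrow> 'a::metric_space) \<Rightarrow> real list \<Rightarrow> real" where
  "chain_length g [] = 0"
| "chain_length g [x] = 0"
| "chain_length g (x # y # zs) = dist (g y) (g x) + chain_length g (y # zs)"

lemma chain_length_nonneg: "0 \<le> chain_length g ts"
  by (induction g ts rule: chain_length.induct) auto

lemma sum_dist_eq_chain_length: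
  "(\<Sum>i < length ts - 1. ennreal (dist (g (ts ! Suc i)) (g (ts ! i)))) = ennreal (chain_length g ts)"
proof (induction g ts rule: chain_length.induct)
  case (3 g x y zs)
  have "(\<Sum>i < length (x # y # zs) - 1. ennreal (dist (g ((x # y # zs) ! Suc i)) (g ((x # y # zs) ! i))))
    = (\<Sum>i < Suc (length (y # zs) - 1). ennreal (dist (g ((x # y # zs) ! Suc i)) (g ((x # y # zs) ! i))))"
    by simp
  also have "\<dots> = ennreal (dist (g y) (g x))
      + (\<Sum>i < length (y # zs) - 1. ennreal (dist (g ((y # zs) ! Suc i)) (g ((y # zs) ! i))))"
    by (subst sum.lessThan_Suc_shift) simp
  also have "\<dots> = ennreal (chain_length g (x # y # zs))"
    unfolding 3 by (simp add: chain_length_nonneg)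
  finally show ?case .
qed auto

lemma variation_on_eq:
  "variation_on g a b = (SUP ts \<in> {ts. sorted ts \<and> set ts \<subseteq> {a..b}}. ennreal (chain_length g ts))"
  unfolding variation_on_def sum_dist_eq_chain_length ..

lemma chain_length_le_variation:
  "sorted ts \<Longrightarrow> set ts \<subseteq> {a..b} \<Longrightarrow> ennreal (chain_length g ts) \<le> variation_on g a b"
  unfolding variation_on_eq by (rule SUP_upper) auto

lemma chain_length_join:
  "chain_length g (us @ a # vs) = chain_length g (us @ [a]) + chain_length g (a # vs)"
proof (induction us)
  case (Cons x us)
  then show ?case by (cases us) auto
qed simp

lemma chain_length_Cons: "chain_length g vs \<le> chain_length g (a # vs)"
  by (cases vs) auto

lemma chain_length_append_ge: "chain_length g us + chain_length g vs \<le> chain_length g (us @ vs)"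
proof (induction us)
  case (Cons x us)
  then show ?case using chain_length_Cons[of g vs x] by (cases us) auto
qed simp

lemma chain_length_insert: "chain_length g (us @ vs) \<le> chain_length g (us @ a # vs)"
proof (induction us)
  case Nil
  then show ?case using chain_length_Cons by auto
next
  case (Cons x us)
  then show ?case
  proof (cases us)
    case Nil
    show ?thesis
    proof (cases vs)
      case (Cons y ws)
      then show ?thesis using Nil dist_triangle[of "g y" "g x" "g a"] by simp
    qed (use Nil in auto)
  qed auto
qed

lemma variation_on_superadditive:
  assumes "a \<le> b" "b \<le> c"
  shows "variation_on g a b + variation_on g b c \<le> variation_on g a c"
proof -
  have ne: "{ts::real list. sorted ts \<and> set ts \<subseteq> {l..u}} \<noteq> {}" for l u
    by (auto intro!: exI[of _ "[]"])
  have "variation_on g a b + ennreal (chain_length g us) \<le> variation_on g a c"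
    if us: "sorted us" "set us \<subseteq> {b..c}" for us
    unfolding variation_on_eq[of g a b]
  proof (subst ennreal_SUP_add_left[OF ne, symmetric], rule SUP_least)
    fix ts assume ts: "ts \<in> {ts. sorted ts \<and> set ts \<subseteq> {a..b}}"
    have "ennreal (chain_length g ts) + ennreal (chain_length g us) \<le> ennreal (chain_length g (ts @ us))"
      using chain_length_append_ge[of g ts us]
      by (simp add: ennreal_leI chain_length_nonneg flip: ennreal_plus)
    also have "\<dots> \<le> variation_on g a c"
      using ts us assms by (intro chain_length_le_variation) (fastforce simp: sorted_append)+
    finally show "ennreal (chain_length g ts) + ennreal (chain_length g us) \<le> variation_on g a c" .
  qed
  then show ?thesis
    unfolding variation_on_eq[of g b c] ennreal_SUP_add_right[OF ne] by (auto intro!: SUP_least)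
qed

lemma dist_le_variation_on: "a \<le> b \<Longrightarrow> ennreal (dist (g b) (g a)) \<le> variation_on g a b"
  using chain_length_le_variation[of "[a, b]" a b g] by simp

section \<open>Arc length as the distribution function of a measure\<close>

context
  fixes g :: "real \<Rightarrow> 'a::metric_space"
  assumes rect: "rectifiable_path g"
begin

lemma variation_on_finite: "0 \<le> t \<Longrightarrow> t \<le> 1 \<Longrightarrow> variation_on g 0 t < top"
proof -
  assume "0 \<le> t" "t \<le> 1"
  then have "variation_on g 0 t + variation_on g t 1 \<le> variation_on g 0 1"
    by (rule variation_on_superadditive)
  moreover have "variation_on g 0 t \<le> variation_on g 0 t + variation_on g t 1" by simp
  ultimately have "variation_on g 0 t \<le> variation_on g 0 1" by (rule order_trans[rotated])
  also have "\<dots> < top" using rect by (simp add: rectifiable_path_def)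
  finally show ?thesis .
qed

lemma ennreal_arclength: "0 \<le> t \<Longrightarrow> t \<le> 1 \<Longrightarrow> ennreal (arclength g t) = variation_on g 0 t"
  using variation_on_finite[of t] by (simp add: arclength_def max_absorb2 min_absorb2)

lemma arclength_diff_ge:
  assumes "0 \<le> a" "a \<le> b" "b \<le> 1"
  shows "dist (g b) (g a) \<le> arclength g b - arclength g a"
proof -
  have "variation_on g 0 a + ennreal (dist (g b) (g a)) \<le> variation_on g 0 b"
    using variation_on_superadditive[of 0 a b g] dist_le_variation_on[of a b g] assms
    by (meson add_left_mono order_trans)
  then have "ennreal (arclength g a) + ennreal (dist (g b) (g a)) \<le> ennreal (arclength g b)"
    using assms by (simp add: ennreal_arclength)
  then show ?thesis by (simp add: arclength_def flip: ennreal_plus)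
qed

lemma arclength_mono: "a \<le> b \<Longrightarrow> arclength g a \<le> arclength g b"
proof -
  assume "a \<le> b"
  have "arclength g a = arclength g (max 0 (min 1 a))" "arclength g b = arclength g (max 0 (min 1 b))"
    by (simp_all add: arclength_def)
  moreover have "0 \<le> arclength g (max 0 (min 1 b)) - arclength g (max 0 (min 1 a))"
    using \<open>a \<le> b\<close> by (intro order_trans[OF zero_le_dist arclength_diff_ge]) auto
  ultimately show ?thesis by simp
qed

text \<open>Aims at right continuity, under which \<open>interval_measure\<close> gives
  \<open>{a<..b}\<close> the increment as mass. A partition almost exhausting the total variation
  leaves at most \<open>e\<close> for a short interval \<open>{a..b}\<close> with no partition point
  in \<open>{a<..b}\<close>.\<close>

lemma arclength_right_small:
  assumes e: "e > 0"
  shows "\<exists>b>a. arclength g b \<le> arclength g a + e"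
proof -
  consider "a < 0" | "0 \<le> a" "a < 1" | "a \<ge> 1" by linarith
  then show ?thesis
  proof cases
    case 1 then show ?thesis using e by (intro exI[of _ 0]) (auto simp: arclength_def)
  next
    case 3 then show ?thesis using e by (intro exI[of _ "a + 1"]) (auto simp: arclength_def)
  next
    case 2
    have fin: "variation_on g 0 1 < top" by (rule variation_on_finite) auto
    have "\<exists>ts. sorted ts \<and> set ts \<subseteq> {0..1} \<and> variation_on g 0 1 \<le> ennreal (chain_length g ts) + ennreal (e / 2)"
    proof (cases "variation_on g 0 1 = 0")
      case False
      then have "variation_on g 0 1 - ennreal (e / 2) < variation_on g 0 1"
        using e fin by (auto intro!: ennreal_between simp: zero_less_iff_neq_zero)
      then obtain ts where ts: "sorted ts" "set ts \<subseteq> {0..1}"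
        "variation_on g 0 1 - ennreal (e / 2) < ennreal (chain_length g ts)"
        by (subst (asm) (2) variation_on_eq) (auto simp: less_SUP_iff)
      then have "variation_on g 0 1 \<le> ennreal (chain_length g ts) + ennreal (e / 2)"
        using fin by (auto simp: ennreal_minus_le_iff add.commute dest!: less_imp_le)
      then show ?thesis using ts by blast
    qed (auto intro!: exI[of _ "[]"])
    then obtain ts where ts: "sorted ts" "set ts \<subseteq> {0..1}"
      "variation_on g 0 1 \<le> ennreal (chain_length g ts) + ennreal (e / 2)" by blast
    have "continuous_on {0..1} g" using rect by (simp add: rectifiable_path_def path_def)
    then obtain d where d: "d > 0" "\<And>t. t \<in> {0..1} \<Longrightarrow> dist t a < d \<Longrightarrow> dist (g t) (g a) < e / 2"
      using continuous_on_iff[THEN iffD1, rule_format, of "{0..1}" g a "e / 2"] 2 e by auto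
    \<comment> \<open>The first partition point to the right of \<open>a\<close>, or 1. With
      \<open>b\<close> below it no partition point lies in \<open>{a<..b}\<close>, so between the
      parts on \<open>{0..a}\<close> and \<open>{b..1}\<close> only the chord from \<open>a\<close>
      to \<open>b\<close> remains, at most \<open>e / 2\<close> by continuity.\<close>
    define m where "m = Min (insert 1 {x \<in> set ts. a < x})"
    have m: "a < m" "m \<le> 1" "\<And>x. x \<in> set ts \<Longrightarrow> a < x \<Longrightarrow> m \<le> x"
      unfolding m_def using 2 by (auto simp: Min_le_iff)
    define b where "b = (a + min m (a + d)) / 2"
    have b: "a < b" "b < m" "b < 1" "dist b a < d" "b \<in> {0..1}"
      using m d 2 unfolding b_def dist_real_def by (auto simp: min_def)
    define us where "us = filter (\<lambda>x. x \<le> a) ts"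
    define vs where "vs = filter (\<lambda>x. \<not> x \<le> a) ts"
    have split: "ts = us @ vs"
    proof -
      have "sorted us \<and> sorted vs" using ts(1) by (simp add: us_def vs_def sorted_wrt_filter)
      then have "sorted (us @ vs)" by (auto simp: sorted_append us_def vs_def)
      moreover have "mset (us @ vs) = mset ts"
        unfolding us_def vs_def mset_append mset_filter by (rule multiset_partition[symmetric])
      ultimately show ?thesis using ts(1) properties_for_sort[of "us @ vs" ts] by (simp add: sorted_sort_id)
    qed
    have "chain_length g ts \<le> chain_length g (us @ a # b # vs)"
      unfolding split by (meson chain_length_insert order_trans)
    also have "\<dots> = chain_length g (us @ [a]) + (dist (g b) (g a) + chain_length g (b # vs))"
      by (subst chain_length_join) simp
    finally have 1: "chain_length g ts \<le> chain_length g (us @ [a]) + dist (g b) (g a) + chain_length g (b # vs)" by simp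
    have A: "ennreal (chain_length g (us @ [a])) \<le> variation_on g 0 a"
      using ts 2 by (intro chain_length_le_variation) (auto simp: us_def sorted_append sorted_wrt_filter)
    have B: "ennreal (chain_length g (b # vs)) \<le> variation_on g b 1"
    proof (rule chain_length_le_variation)
      have "b \<le> x" if "x \<in> set vs" for x using m(3)[of x] that b by (auto simp: vs_def)
      then show "sorted (b # vs)" "set (b # vs) \<subseteq> {b..1}"
        using ts b by (auto simp: vs_def sorted_wrt_filter)
    qed
    have db: "dist (g b) (g a) \<le> e / 2" using d(2) b by (auto intro: less_imp_le)
    have "variation_on g 0 b + variation_on g b 1 \<le> variation_on g 0 1"
      using b by (intro variation_on_superadditive) auto
    also have "\<dots> \<le> ennreal (chain_length g ts) + ennreal (e / 2)" by fact
    also have "\<dots> \<le> ennreal (chain_length g (us @ [a]) + e / 2 + chain_length g (b # vs)) + ennreal (e / 2)"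
      using 1 db by (intro add_right_mono ennreal_leI) auto
    also have "\<dots> = (ennreal (chain_length g (us @ [a])) + ennreal e) + ennreal (chain_length g (b # vs))"
      using e by (simp add: chain_length_nonneg flip: ennreal_plus)
    also have "\<dots> \<le> (variation_on g 0 a + ennreal e) + variation_on g b 1"
      by (intro add_mono A B order_refl)
    finally have "variation_on g 0 b + variation_on g b 1 \<le> (variation_on g 0 a + ennreal e) + variation_on g b 1" .
    moreover have "variation_on g b 1 < top"
    proof -
      have "variation_on g b 1 \<le> variation_on g 0 b + variation_on g b 1" by simp
      also have "\<dots> \<le> variation_on g 0 1" using b by (intro variation_on_superadditive) auto
      finally show ?thesis using fin by (rule order_le_less_trans)
    qed
    ultimately have "variation_on g 0 b \<le> variation_on g 0 a + ennreal e"
      by (subst (asm) (1 2) add.commute[of _ "variation_on g b 1"]) (auto simp: ennreal_add_left_cancel_le)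
    then have "ennreal (arclength g b) \<le> ennreal (arclength g a) + ennreal e"
      using 2 b by (simp add: ennreal_arclength)
    then show ?thesis using b e by (intro exI[of _ b]) (auto simp: arclength_def simp flip: ennreal_plus)
  qed
qed

lemma arclength_right_continuous: "continuous (at_right a) (arclength g)"
proof -
  have "\<exists>d>0. \<forall>x>a. dist x a < d \<longrightarrow> dist (arclength g x) (arclength g a) < e" if e: "e > 0" for e
  proof -
    obtain b where b: "b > a" "arclength g b \<le> arclength g a + e / 2"
      using arclength_right_small[of "e / 2" a] e by auto
    have "dist (arclength g x) (arclength g a) < e" if "x > a" "dist x a < b - a" for x
    proof -
      have "x \<le> b" using that by (simp add: dist_real_def)
      then have "arclength g x \<le> arclength g a + e / 2" using b arclength_mono[of x b] by linarith
      moreover have "arclength g a \<le> arclength g x" using that by (intro arclength_mono) simp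
      ultimately show ?thesis using e by (simp add: dist_real_def)
    qed
    then show ?thesis using b by (intro exI[of _ "b - a"]) auto
  qed
  then show ?thesis unfolding continuous_within Lim_within by (simp add: Ball_def)
qed

lemma emeasure_arclength_Ioc:
  "a \<le> b \<Longrightarrow> emeasure (interval_measure (arclength g)) {a<..b} = ennreal (arclength g b - arclength g a)"
  by (rule emeasure_interval_measure_Ioc) (auto intro: arclength_mono arclength_right_continuous)

end

lemma borel_measurable_path:
  fixes g :: "real \<Rightarrow> 'a::euclidean_space" and \<phi> :: "'a \<Rightarrow> ennreal"
  assumes "path g" and [measurable]: "\<phi> \<in> borel_measurable borel"
  shows "(\<lambda>t. \<phi> (g t) * indicator {0..1} t) \<in> borel_measurable borel"
proof -
  \<comment> \<open>A path is only known to be continuous on the unit interval; clamping the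
    parameter gives a globally continuous curve that agrees with it there.\<close>
  have "continuous_on UNIV (\<lambda>t. g (max 0 (min 1 t)))"
    by (rule continuous_on_compose2[of "{0..1}" g]) (use assms in \<open>auto simp: path_def intro!: continuous_intros\<close>)
  then have [measurable]: "(\<lambda>t. g (max 0 (min 1 t))) \<in> borel_measurable borel"
    by (rule borel_measurable_continuous_onI)
  have "(\<lambda>t. \<phi> (g t) * indicator {0..1} t) = (\<lambda>t. \<phi> (g (max 0 (min 1 t))) * indicator {0..1} t)"
    by (auto simp: fun_eq_iff indicator_def max_def min_def)
  then show ?thesis by simp
qed

lemma line_integral_linear:
  fixes g :: "real \<Rightarrow> 'a::euclidean_space"
  assumes "path g" and [measurable]: "\<rho> \<in> borel_measurable borel" "\<sigma> \<in> borel_measurable borel"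
  shows "line_integral (\<lambda>x. a * \<rho> x + b * \<sigma> x) g = a * line_integral \<rho> g + b * line_integral \<sigma> g"
proof -
  note [measurable] = borel_measurable_path[OF assms(1)]
  have "line_integral (\<lambda>x. a * \<rho> x + b * \<sigma> x) g
    = (\<integral>\<^sup>+ t. a * (\<rho> (g t) * indicator {0..1} t) + b * (\<sigma> (g t) * indicator {0..1} t) \<partial>interval_measure (arclength g))"
    unfolding line_integral_def by (simp add: distrib_right mult.assoc)
  also have "\<dots> = a * line_integral \<rho> g + b * line_integral \<sigma> g"
    unfolding line_integral_def by (simp add: nn_integral_add nn_integral_cmult)
  finally show ?thesis .
qed

lemma line_integral_mono:
  "(\<And>x. \<rho> x \<le> \<sigma> x) \<Longrightarrow> line_integral \<rho> g \<le> line_integral \<sigma> g"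
  unfolding line_integral_def by (intro nn_integral_mono mult_right_mono) auto

text \<open>The measure of a half-open piece is the increment of arc length, which dominates the
  chord. Line integrals are bounded from below by such Riemann sums.\<close>

lemma line_integral_ge_partition:
  fixes g :: "real \<Rightarrow> 'a::euclidean_space" and \<phi> :: "'a \<Rightarrow> ennreal"
  assumes rect: "rectifiable_path g" and N: "N > 0"
    and m: "\<And>i t. i < N \<Longrightarrow> real i / real N < t \<Longrightarrow> t \<le> real (Suc i) / real N \<Longrightarrow> m i \<le> \<phi> (g t)"
  shows "(\<Sum>i<N. m i * ennreal (dist (g (real (Suc i) / real N)) (g (real i / real N)))) \<le> line_integral \<phi> g"
proof -
  let ?t = "\<lambda>i::nat. real i / real N"
  let ?M = "interval_measure (arclength g)"
  have t: "0 \<le> ?t i" "?t i \<le> ?t (Suc i)" for i using N by (auto simp: divide_right_mono)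
  have t1: "?t (Suc i) \<le> 1" if "i < N" for i using that N by simp
  have "(\<Sum>i<N. m i * ennreal (dist (g (?t (Suc i))) (g (?t i)))) \<le> (\<Sum>i<N. m i * emeasure ?M {?t i<..?t (Suc i)})"
    using t t1 by (intro sum_mono mult_left_mono)
      (auto simp: emeasure_arclength_Ioc[OF rect] intro!: ennreal_leI arclength_diff_ge[OF rect])
  also have "\<dots> = (\<integral>\<^sup>+t. (\<Sum>i<N. m i * indicator {?t i<..?t (Suc i)} t) \<partial>?M)"
  proof (subst nn_integral_sum)
    show "(\<Sum>i<N. m i * emeasure ?M {?t i<..?t (Suc i)}) = (\<Sum>i<N. \<integral>\<^sup>+t. m i * indicator {?t i<..?t (Suc i)} t \<partial>?M)"
      by (intro sum.cong refl nn_integral_cmult_indicator[symmetric]) simp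
  qed simp
  also have "\<dots> \<le> line_integral \<phi> g"
    unfolding line_integral_def
  proof (rule nn_integral_mono)
    fix t
    show "(\<Sum>i<N. m i * indicator {?t i<..?t (Suc i)} t) \<le> \<phi> (g t) * indicator {0..1} t"
    proof (cases "\<exists>i<N. t \<in> {?t i<..?t (Suc i)}")
      case False
      then have "(\<Sum>i<N. m i * indicator {?t i<..?t (Suc i)} t) = 0" by (intro sum.neutral) (auto simp: indicator_def)
      then show ?thesis by simp
    next
      case True
      then obtain i where i: "i < N" "t \<in> {?t i<..?t (Suc i)}" by blast
      have uniq: "j = i" if "j < N" "t \<in> {?t j<..?t (Suc j)}" for j
      proof (rule ccontr)
        assume "j \<noteq> i"
        then have "Suc j \<le> i \<or> Suc i \<le> j" by auto
        then have "?t (Suc j) \<le> ?t i \<or> ?t (Suc i) \<le> ?t j" using N by (auto simp: divide_right_mono simp del: of_nat_Suc)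
        then show False using i that by auto
      qed
      have "(\<Sum>i<N. m i * indicator {?t i<..?t (Suc i)} t) = (\<Sum>j\<in>{i}. m j * indicator {?t j<..?t (Suc j)} t)"
      proof (rule sum.mono_neutral_right)
        show "\<forall>j\<in>{..<N} - {i}. m j * indicator {?t j<..?t (Suc j)} t = 0"
        proof
          fix j assume "j \<in> {..<N} - {i}"
          then have "t \<notin> {?t j<..?t (Suc j)}" using uniq[of j] by blast
          then show "m j * indicator {?t j<..?t (Suc j)} t = 0" by (simp del: of_nat_Suc)
        qed
      qed (use i in auto)
      also have "\<dots> = m i" using i by simp
      also have "\<dots> \<le> \<phi> (g t)" using m[of i t] i by auto
      also have "\<dots> = \<phi> (g t) * indicator {0..1} t"
      proof -
        have "t \<in> {0..1}" using i(2) t(1)[of i] t1[OF i(1)] unfolding greaterThanAtMost_iff atLeastAtMost_iff by linarith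
        then show ?thesis by simp
      qed
      finally show ?thesis .
    qed
  qed
  finally show ?thesis .
qed

subsection \<open>Crossing a surface\<close>

text \<open>Diameters do not change under closure, so nearly optimal covers at the scales
  \<open>1 / (k + 1)\<close> may be taken closed, and the intersection over \<open>k\<close> of
  their unions is a Borel set of no larger measure. The hull will replace projections of Borel sets,
  which need not be Borel.\<close>

lemma hausdorff_outer_borel_hull:
  fixes A :: "'a::euclidean_space set"
  assumes fin: "hausdorff_outer s A < top"
  shows "\<exists>B\<in>sets borel. A \<subseteq> B \<and> hausdorff_outer s B \<le> hausdorff_outer s A"
proof -
  let ?d = "\<lambda>k::nat. 1 / (real k + 1)"
  have "\<exists>U. A \<subseteq> (\<Union>i. U i) \<and> (\<forall>i. bounded (U i)) \<and> (\<forall>i. diameter (U i) \<le> ?d k) \<and>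
      (\<Sum>i. hausdorff_size s (U i)) < hausdorff_outer s A + ennreal (?d k)" for k
  proof -
    have "hausdorff_delta s (?d k) A \<le> hausdorff_outer s A" by (rule hausdorff_delta_le_outer) simp
    also have "\<dots> < hausdorff_outer s A + ennreal (?d k)"
      using fin by (simp add: ennreal_less_iff less_top[symmetric])
    finally have lt: "hausdorff_delta s (?d k) A < hausdorff_outer s A + ennreal (?d k)" .
    from hausdorff_delta_less[OF lt] obtain U where "A \<subseteq> (\<Union>i. U i)" "\<And>i. bounded (U i)" "\<And>i. diameter (U i) \<le> ?d k"
      "(\<Sum>i. hausdorff_size s (U i)) < hausdorff_outer s A + ennreal (?d k)" by blast
    then show ?thesis by (intro exI[of _ U]) simp
  qed
  then obtain U where U: "\<And>k. A \<subseteq> (\<Union>i. U k i)" "\<And>k i. bounded (U k i)" "\<And>k i. diameter (U k i) \<le> ?d k"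
      "\<And>k. (\<Sum>i. hausdorff_size s (U k i)) < hausdorff_outer s A + ennreal (?d k)"
    by metis
  define B where "B = (\<Inter>k. \<Union>i. closure (U k i))"
  have "hausdorff_outer s B \<le> hausdorff_outer s A"
  proof (rule hausdorff_outer_le, rule ennreal_le_epsilon)
    fix \<delta> e :: real assume \<delta>: "\<delta> > 0" and e: "e > 0"
    obtain k :: nat where k: "1 / (real k + 1) < min \<delta> e"
      using reals_Archimedean[of "min \<delta> e"] \<delta> e by (auto simp: inverse_eq_divide add.commute)
    have "hausdorff_delta s \<delta> B \<le> (\<Sum>i. hausdorff_size s (closure (U k i)))"
    proof (rule hausdorff_delta_le)
      show "diameter (closure (U k i)) \<le> \<delta>" for i
        using U(2)[of k i] U(3)[of k i] k by (simp add: diameter_closure)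
    qed (auto simp: B_def U(2))
    also have "\<dots> = (\<Sum>i. hausdorff_size s (U k i))" using U(2) by (simp add: hausdorff_size_def diameter_closure)
    also have "\<dots> \<le> hausdorff_outer s A + ennreal (?d k)" using U(4)[of k] by (rule less_imp_le)
    also have "\<dots> \<le> hausdorff_outer s A + ennreal e"
      using k by (intro add_left_mono ennreal_leI) auto
    finally show "hausdorff_delta s \<delta> B \<le> hausdorff_outer s A + ennreal e" .
  qed
  moreover have "A \<subseteq> B"
    unfolding B_def
  proof (rule INF_greatest)
    fix k
    have "(\<Union>i. U k i) \<subseteq> (\<Union>i. closure (U k i))" by (intro UN_mono closure_subset) auto
    then show "A \<subseteq> (\<Union>i. closure (U k i))" using U(1)[of k] by (rule subset_trans[rotated])
  qed
  moreover have "B \<in> sets borel" unfolding B_def by (intro sets.countable_INT' sets.countable_UN) auto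
  ultimately show ?thesis by blast
qed

lemma borel_partition_small:
  fixes \<kappa> :: real assumes "\<kappa> > 0"
  obtains P :: "nat \<Rightarrow> 'a::euclidean_space set" and x :: "nat \<Rightarrow> 'a"
  where "disjoint_family P" "(\<Union>k. P k) = UNIV" "\<And>k. P k \<in> sets borel" "\<And>k. P k \<subseteq> ball (x k) \<kappa>"
proof -
  obtain X :: "'a set" where X: "countable X" "\<And>Y :: 'a set. open Y \<Longrightarrow> Y \<noteq> {} \<Longrightarrow> \<exists>d\<in>X. d \<in> Y"
    using countable_dense_setE by blast
  have Xne: "X \<noteq> {}" using X(2)[of UNIV] by auto
  let ?x = "from_nat_into X"
  let ?B = "\<lambda>k. ball (?x k) \<kappa>"
  have "(\<Union>k. ?B k) = UNIV"
  proof safe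
    fix y
    obtain d where "d \<in> X" "d \<in> ball y \<kappa>" using X(2)[of "ball y \<kappa>"] assms by auto
    moreover obtain k where "?x k = d" using from_nat_into_surj[OF X(1) \<open>d \<in> X\<close>] by blast
    ultimately show "y \<in> (\<Union>k. ?B k)" by (auto simp: dist_commute)
  qed auto
  moreover have "disjointed ?B k \<in> sets borel" for k
    unfolding disjointed_def by auto
  ultimately show thesis
    using that[OF disjoint_family_disjointed _ _ disjointed_subset] by (simp add: UN_disjointed_eq)
qed

text \<open>Every part of \<open>S\<close> of small diameter sweeps out a subset of a cylinder over its projection,
  of height barely larger than the norm of \<open>v\<close>.\<close>

lemma emeasure_sweep_le:
  fixes S :: "'a::euclidean_space set"
  assumes n2: "DIM('a) \<ge> 2"
    and c: "c > 0" "\<And>v A::'a set. norm v = 1 \<Longrightarrow> A \<in> sets borel \<Longrightarrow>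
        hausdorff_outer (DIM('a) - 1) (A \<inter> {x. x \<bullet> v = 0}) = ennreal c * emeasure (perp_measure v) A"
    and S[measurable]: "S \<in> sets borel" and fin: "hausdorff_outer (DIM('a) - 1) S < top" and e: "e > 0"
  shows "\<exists>T\<in>sets borel. (\<forall>x\<in>S. \<forall>t\<in>{0..1}. x - t *\<^sub>R v \<in> T) \<and>
    ennreal c * emeasure lborel T \<le> ennreal (norm v) * hausdorff_outer (DIM('a) - 1) S + ennreal e"
proof -
  let ?s = "DIM('a) - 1"
  let ?H = "hausdorff_outer ?s :: 'a set \<Rightarrow> ennreal"
  have s1: "?s \<ge> 1" using n2 by simp
  obtain b :: 'a where "b \<in> Basis" by fastforce
  then have nb: "norm b = 1" by simp
  \<comment> \<open>For \<open>v = 0\<close> any unit direction will do;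
    \<open>v = norm v *\<^sub>R u\<close> holds in both cases.\<close>
  define u where "u = (if v = 0 then b else (1 / norm v) *\<^sub>R v)"
  have u: "norm u = 1" and vu: "v = norm v *\<^sub>R u" using nb by (auto simp: u_def)
  obtain h where h: "h \<ge> 0" "?H S = ennreal h" using fin by (cases "?H S") auto
  \<comment> \<open>Each cylinder is higher than \<open>norm v\<close> by
    \<open>2 * \<kappa>\<close>, at a total cost of \<open>2 * \<kappa> * h \<le> e\<close>.\<close>
  define \<kappa> where "\<kappa> = e / (2 * (h + 1))"
  have \<kappa>: "\<kappa> > 0" using e h by (simp add: \<kappa>_def)
  have \<kappa>h: "2 * \<kappa> * h \<le> e" using e h by (simp add: \<kappa>_def field_simps)
  obtain P :: "nat \<Rightarrow> 'a set" and x where P: "disjoint_family P" "(\<Union>k. P k) = UNIV"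
      "\<And>k. P k \<in> sets borel" "\<And>k. P k \<subseteq> ball (x k) \<kappa>"
    by (rule borel_partition_small[OF \<kappa>]) (rule that)
  have "\<exists>B. B \<in> sets borel \<and> hproj u ` (S \<inter> P k) \<subseteq> B \<and> ?H B \<le> ?H (S \<inter> P k)" for k
  proof -
    have le: "?H (hproj u ` (S \<inter> P k)) \<le> ?H (S \<inter> P k)"
      using hausdorff_outer_Lipschitz_image[of 1 "S \<inter> P k" "hproj u" ?s] dist_hproj_le[OF u] by simp
    also have "\<dots> \<le> ?H S" by (rule hausdorff_outer_mono) auto
    finally have "?H (hproj u ` (S \<inter> P k)) < top" using fin by (rule order_le_less_trans)
    then show ?thesis using hausdorff_outer_borel_hull[of ?s "hproj u ` (S \<inter> P k)"] le by (meson order_trans)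
  qed
  then obtain B where B: "\<And>k. B k \<in> sets borel" "\<And>k. hproj u ` (S \<inter> P k) \<subseteq> B k" "\<And>k. ?H (B k) \<le> ?H (S \<inter> P k)"
    by metis
  \<comment> \<open>The heights of points of \<open>P k\<close> differ from that of
    \<open>x k\<close> by at most \<open>\<kappa>\<close>; moving back along \<open>v\<close> lowers
    them by at most \<open>norm v\<close> and leaves the projection unchanged.\<close>
  define T where "T k = {y. y \<bullet> u \<in> {x k \<bullet> u - \<kappa> - norm v..x k \<bullet> u + \<kappa>} \<and> hproj u y \<in> B k}" for k
  have Tm: "T k \<in> sets borel" for k
    unfolding T_def using B(1)[of k, measurable] by measurable
  have cT: "ennreal c * emeasure lborel (T k) \<le> ennreal (norm v + 2 * \<kappa>) * ?H (S \<inter> P k)" for k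
  proof -
    have "emeasure lborel (T k) = ennreal (norm v + 2 * \<kappa>) * emeasure (perp_measure u) (B k)"
      unfolding T_def using \<kappa> B(1)[of k] by (subst emeasure_slab[OF u]) (auto simp: algebra_simps)
    then have "ennreal c * emeasure lborel (T k) = ennreal (norm v + 2 * \<kappa>) * (ennreal c * emeasure (perp_measure u) (B k))"
      by (simp add: mult.left_commute)
    also have "\<dots> = ennreal (norm v + 2 * \<kappa>) * ?H (B k \<inter> {x. x \<bullet> u = 0})" by (simp only: c(2)[OF u B(1)])
    also have "\<dots> \<le> ennreal (norm v + 2 * \<kappa>) * ?H (S \<inter> P k)"
      by (intro mult_left_mono order_trans[OF hausdorff_outer_mono B(3)]) auto
    finally show ?thesis .
  qed
  have cover: "y - t *\<^sub>R v \<in> (\<Union>k. T k)" if y: "y \<in> S" and t: "t \<in> {0..1}" for y t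
  proof -
    obtain k where k: "y \<in> P k" using P(2) by auto
    have "\<bar>(y - x k) \<bullet> u\<bar> \<le> norm (y - x k) * norm u" by (rule Cauchy_Schwarz_ineq2)
    also have "\<dots> \<le> \<kappa>" using P(4)[of k] k u by (auto simp: dist_norm norm_minus_commute dest!: subsetD)
    finally have 1: "\<bar>y \<bullet> u - x k \<bullet> u\<bar> \<le> \<kappa>" by (simp add: inner_diff_left)
    have 2: "v \<bullet> u = norm v" using u by (subst vu) (simp add: norm_eq_1)
    have 3: "0 \<le> t * norm v" "t * norm v \<le> norm v" using t by (auto simp: mult_left_le_one_le)
    have "hproj u (y - t *\<^sub>R v) = hproj u y"
      by (subst vu) (simp add: hproj_diff hproj_scaleR_self[OF u])
    moreover have "hproj u y \<in> B k" using B(2)[of k] y k by blast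
    ultimately have "y - t *\<^sub>R v \<in> T k"
      unfolding T_def using 1 2 3 by (auto simp: inner_diff_left)
    then show ?thesis by blast
  qed
  have "ennreal c * emeasure lborel (\<Union>k. T k) \<le> ennreal c * (\<Sum>k. emeasure lborel (T k))"
    using Tm by (intro mult_left_mono emeasure_subadditive_countably) auto
  also have "\<dots> = (\<Sum>k. ennreal c * emeasure lborel (T k))" by simp
  also have "\<dots> \<le> (\<Sum>k. ennreal (norm v + 2 * \<kappa>) * ?H (S \<inter> P k))"
    by (intro suminf_le cT) auto
  also have "\<dots> = ennreal (norm v + 2 * \<kappa>) * (\<Sum>k. ?H (S \<inter> P k))" by simp
  also have "(\<Sum>k. ?H (S \<inter> P k)) = ?H S"
  proof -
    have "(\<Sum>k. emeasure (hausdorff_measure ?s) (S \<inter> P k)) = emeasure (hausdorff_measure ?s) (\<Union>k. S \<inter> P k)"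
      using P(1,3) S by (intro suminf_emeasure) (auto simp: disjoint_family_on_def)
    moreover have "(\<Union>k. S \<inter> P k) = S" using P(2) by auto
    ultimately show ?thesis using s1 P(3) S by (simp add: emeasure_hausdorff_measure)
  qed
  also have "ennreal (norm v + 2 * \<kappa>) * ?H S = ennreal (norm v) * ?H S + ennreal (2 * \<kappa> * h)"
    using h \<kappa> by (simp add: distrib_right ennreal_mult')
  also have "\<dots> \<le> ennreal (norm v) * ?H S + ennreal e" using \<kappa>h by (intro add_left_mono ennreal_leI)
  finally have "ennreal c * emeasure lborel (\<Union>k. T k) \<le> ennreal (norm v) * ?H S + ennreal e" .
  moreover have "(\<Union>k. T k) \<in> sets borel" using Tm by auto
  ultimately show ?thesis using cover by blast
qed

lemma connected_stays_in_open:
  assumes "connected C" "open U" "open V" "U \<inter> V = {}" "C \<subseteq> U \<union> V" "x \<in> C" "x \<in> U"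
  shows "C \<subseteq> U"
  using connectedD[OF assms(1-3)] assms(4-) by blast

text \<open>The path is replaced by a fine polygon. If its translate by \<open>z\<close> never met
  \<open>S\<close>, it would run from \<open>U\<close> to \<open>V\<close> inside their disjoint
  union; hence \<open>z\<close> lies in a set swept out by a part of \<open>S\<close> along one
  edge. The sweep volumes add up to a Riemann sum for the line integral, while the swept sets cover
  almost the whole ball of radius \<open>\<delta>\<close>.\<close>

lemma line_integral_crossing_ge:
  fixes S :: "'a::euclidean_space set"
  assumes n2: "DIM('a) \<ge> 2"
    and c: "c > 0" "\<And>v A::'a set. norm v = 1 \<Longrightarrow> A \<in> sets borel \<Longrightarrow>
        hausdorff_outer (DIM('a) - 1) (A \<inter> {x. x \<bullet> v = 0}) = ennreal c * emeasure (perp_measure v) A"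
    and S: "S \<in> sets borel" and fin: "hausdorff_outer (DIM('a) - 1) S < top"
    and g: "rectifiable_path g" and \<delta>: "\<delta> > 0"
    and UV: "open U" "open V" "U \<inter> V = {}" "ball (g 0) \<delta> \<subseteq> U" "ball (g 1) \<delta> \<subseteq> V"
    and sep: "\<And>t. t \<in> {0..1} \<Longrightarrow> ball (g t) \<delta> \<subseteq> U \<union> S \<union> V"
  shows "ennreal c * emeasure lborel (ball (0::'a) \<delta>)
    \<le> line_integral (\<lambda>y. hausdorff_outer (DIM('a) - 1) (S \<inter> ball y \<delta>)) g" (is "_ \<le> ?I")
proof -
  let ?s = "DIM('a) - 1"
  let ?H = "hausdorff_outer ?s :: 'a set \<Rightarrow> ennreal"
  \<comment> \<open>The radius loses one \<open>\<tau>\<close> because a point on an edge may be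
    that far from its initial node, and another because the area near the node is compared with the
    area near arbitrary points of the arc.\<close>
  have main: "ennreal c * emeasure lborel (ball (0::'a) (\<delta> - 2 * \<tau>)) \<le> ?I" if \<tau>: "0 < \<tau>" "2 * \<tau> < \<delta>" for \<tau>
  proof (rule ennreal_le_epsilon)
    fix e :: real assume e: "e > 0"
    have "uniformly_continuous_on {0..1} g"
      using g by (intro compact_uniformly_continuous) (auto simp: rectifiable_path_def path_def)
    then obtain d where d: "d > 0" "\<And>s t. s \<in> {0..1} \<Longrightarrow> t \<in> {0..1} \<Longrightarrow> dist s t < d \<Longrightarrow> dist (g s) (g t) < \<tau>"
      unfolding uniformly_continuous_on_def using \<tau>(1) by meson
    obtain N :: nat where N: "1 / d < real N" using reals_Archimedean2 by blast
    have "0 < 1 / d" using d(1) by simp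
    then have N0: "N > 0" using N by (cases N) auto
    have Nd: "1 / real N < d" using N d(1) N0 by (simp add: field_simps)
    let ?t = "\<lambda>i::nat. real i / real N"
    have tI: "?t i \<in> {0..1}" if "i \<le> N" for i using that N0 by simp
    have step: "dist (g t) (g (?t i)) < \<tau>" if "i < N" "?t i \<le> t" "t \<le> ?t (Suc i)" for i t
    proof -
      have "dist t (?t i) \<le> ?t (Suc i) - ?t i" using that by (simp add: dist_real_def)
      also have "\<dots> = 1 / real N" by (simp add: add_divide_distrib)
      finally have "dist t (?t i) < d" using Nd by simp
      moreover have "t \<in> {0..1}"
        using that tI[of i] tI[of "Suc i"] unfolding atLeastAtMost_iff by linarith
      ultimately show ?thesis using d(2) tI[of i] that by simp
    qed
    define v where "v i = g (?t (Suc i)) - g (?t i)" for i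
    define R where "R i = S \<inter> ball (g (?t i)) (\<delta> - \<tau>)" for i
    have "\<exists>T. T \<in> sets borel \<and> (\<forall>x\<in>R i. \<forall>t\<in>{0..1}. x - t *\<^sub>R v i \<in> T) \<and>
        ennreal c * emeasure lborel T \<le> ennreal (norm (v i)) * ?H (R i) + ennreal (e / real N)" for i
    proof -
      have "?H (R i) < top"
        using fin hausdorff_outer_mono[of "R i" S ?s] by (auto simp: R_def intro: order_le_less_trans)
      then have "\<exists>T\<in>sets borel. (\<forall>x\<in>R i. \<forall>t\<in>{0..1}. x - t *\<^sub>R v i \<in> T) \<and>
        ennreal c * emeasure lborel T \<le> ennreal (norm (v i)) * ?H (R i) + ennreal (e / real N)"
        using S e N0 by (intro emeasure_sweep_le[OF n2 c]) (auto simp: R_def)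
      then show ?thesis by blast
    qed
    then obtain T where T: "\<And>i. T i \<in> sets borel" "\<And>i x t. x \<in> R i \<Longrightarrow> t \<in> {0..1} \<Longrightarrow> x - t *\<^sub>R v i \<in> T i"
        "\<And>i. ennreal c * emeasure lborel (T i) \<le> ennreal (norm (v i)) * ?H (R i) + ennreal (e / real N)"
      by metis
    \<comment> \<open>Contains every translation \<open>z\<close> for which the edge starting at
      \<open>z + g (?t i)\<close> hits \<open>R i\<close>: a hit at
      \<open>x = z + g (?t i) + a *\<^sub>R v i\<close> puts \<open>x - a *\<^sub>R v i\<close> into
      \<open>T i\<close>.\<close>
    let ?T' = "\<lambda>i. (\<lambda>z. z + g (?t i)) -` T i"
    have T'm: "?T' i \<in> sets borel" for i
      using measurable_sets[of "\<lambda>z. z + g (?t i)" borel borel "T i"] T(1) by simp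
    have cover: "ball 0 (\<delta> - 2 * \<tau>) \<subseteq> (\<Union>i<N. ?T' i)"
    proof
      fix z :: 'a assume z: "z \<in> ball 0 (\<delta> - 2 * \<tau>)"
      show "z \<in> (\<Union>i<N. ?T' i)"
      proof (rule ccontr)
        assume no: "z \<notin> (\<Union>i<N. ?T' i)"
        have near: "z + g (?t i) + a *\<^sub>R v i \<in> ball (g (?t i)) (\<delta> - \<tau>)" if i: "i < N" and a: "a \<in> {0..1}" for i a
        proof -
          have "norm (v i) < \<tau>" using step[OF i, of "?t (Suc i)"] N0 by (simp add: v_def dist_norm divide_right_mono)
          moreover have "norm (a *\<^sub>R v i) \<le> norm (v i)" using a by (simp add: mult_left_le_one_le)
          ultimately have "norm (a *\<^sub>R v i) < \<tau>" by linarith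
          then have "norm (z + a *\<^sub>R v i) < \<delta> - \<tau>" using z norm_triangle_ineq[of z "a *\<^sub>R v i"] by simp
          moreover have "dist (g (?t i)) (z + g (?t i) + a *\<^sub>R v i) = norm (z + a *\<^sub>R v i)"
          proof -
            have "g (?t i) - (z + g (?t i) + a *\<^sub>R v i) = - (z + a *\<^sub>R v i)" by (simp add: algebra_simps)
            then show ?thesis by (simp only: dist_norm norm_minus_cancel)
          qed
          ultimately show ?thesis by simp
        qed
        have notS: "z + g (?t i) + a *\<^sub>R v i \<notin> S" if i: "i < N" and a: "a \<in> {0..1}" for i a
        proof
          assume "z + g (?t i) + a *\<^sub>R v i \<in> S"
          then have "z + g (?t i) + a *\<^sub>R v i \<in> R i" using near[OF i a] by (simp add: R_def)
          from T(2)[OF this a] have "z \<in> ?T' i" by simp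
          then show False using no i by auto
        qed
        have inU: "z + g (?t i) \<in> U" if "i \<le> N" for i
          using that
        proof (induction i)
          case 0
          have "z + g 0 \<in> ball (g 0) \<delta>" using z \<tau> by (simp add: dist_norm)
          then show ?case using UV(4) by auto
        next
          case (Suc i)
          then have i: "i < N" by simp
          let ?C = "(\<lambda>a. z + g (?t i) + a *\<^sub>R v i) ` {0..1}"
          have "connected ?C"
            by (intro connected_continuous_image continuous_intros connected_Icc)
          moreover have "?C \<subseteq> U \<union> V"
          proof
            fix y assume "y \<in> ?C"
            then obtain a where a: "a \<in> {0..1}" "y = z + g (?t i) + a *\<^sub>R v i" by blast
            have "y \<in> ball (g (?t i)) \<delta>" using near[OF i a(1)] a(2) \<tau> by auto
            then have "y \<in> U \<union> S \<union> V" using sep tI[of i] i by (meson less_imp_le subsetD)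
            then show "y \<in> U \<union> V" using notS[OF i a(1)] a(2) by auto
          qed
          moreover have "z + g (?t i) \<in> ?C" by (rule image_eqI[of _ _ 0]) auto
          moreover have "z + g (?t i) \<in> U" using Suc i by simp
          ultimately have "?C \<subseteq> U" by (rule connected_stays_in_open[OF _ UV(1-3)])
          moreover have "z + g (?t (Suc i)) \<in> ?C" by (rule image_eqI[of _ _ 1]) (auto simp: v_def)
          ultimately show ?case by blast
        qed
        have "z + g (?t N) \<in> U" by (rule inU) simp
        moreover have "z + g 1 \<in> V" using z \<tau> UV(5) by (auto simp: dist_norm subset_iff)
        ultimately show False using N0 UV(3) by auto
      qed
    qed
    have "ennreal c * emeasure lborel (ball (0::'a) (\<delta> - 2 * \<tau>)) \<le> ennreal c * emeasure lborel (\<Union>i<N. ?T' i)"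
      using cover T'm by (intro mult_left_mono emeasure_mono) auto
    also have "\<dots> \<le> ennreal c * (\<Sum>i<N. emeasure lborel (?T' i))"
      using T'm by (intro mult_left_mono emeasure_subadditive_finite) auto
    also have "\<dots> = (\<Sum>i<N. ennreal c * emeasure lborel (T i))"
      by (simp add: sum_distrib_left emeasure_lborel_translate T(1))
    also have "\<dots> \<le> (\<Sum>i<N. ennreal (norm (v i)) * ?H (R i) + ennreal (e / real N))"
      by (intro sum_mono T(3))
    also have "\<dots> = (\<Sum>i<N. ?H (R i) * ennreal (dist (g (?t (Suc i))) (g (?t i)))) + (\<Sum>i<N. ennreal (e / real N))"
      by (simp add: sum.distrib v_def dist_norm mult.commute)
    also have "(\<Sum>i<N. ennreal (e / real N)) = ennreal e"
      using e N0 by (simp add: ennreal_of_nat_eq_real_of_nat ennreal_mult'[symmetric])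
    also have "(\<Sum>i<N. ?H (R i) * ennreal (dist (g (?t (Suc i))) (g (?t i)))) \<le> ?I"
    proof (rule line_integral_ge_partition[OF g N0])
      fix i t assume it: "i < N" "?t i < t" "t \<le> ?t (Suc i)"
      have "dist (g t) (g (?t i)) < \<tau>" using step it by auto
      then have "ball (g (?t i)) (\<delta> - \<tau>) \<subseteq> ball (g t) \<delta>"
        using dist_triangle_less_add[of "g t" "g (?t i)" \<tau> _ "\<delta> - \<tau>"] by (auto simp: dist_commute)
      then show "?H (R i) \<le> ?H (S \<inter> ball (g t) \<delta>)" unfolding R_def by (intro hausdorff_outer_mono) auto
    qed
    finally show "ennreal c * emeasure lborel (ball (0::'a) (\<delta> - 2 * \<tau>)) \<le> ?I + ennreal e"
      by (simp add: add_right_mono)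
  qed
  let ?w = "unit_ball_vol (real DIM('a))"
  have "((\<lambda>\<tau>. ennreal (c * (?w * (\<delta> - 2 * \<tau>) ^ DIM('a)))) \<longlongrightarrow> ennreal (c * (?w * (\<delta> - 2 * 0) ^ DIM('a)))) (at_right 0)"
    by (intro tendsto_ennrealI tendsto_intros)
  moreover have "\<forall>\<^sub>F \<tau> in at_right 0. ennreal (c * (?w * (\<delta> - 2 * \<tau>) ^ DIM('a))) \<le> ?I"
  proof (rule eventually_mono[OF eventually_at_right_real[of 0 "\<delta> / 2"]])
    fix \<tau> assume \<tau>: "\<tau> \<in> {0<..<\<delta> / 2}"
    then have "ennreal c * emeasure lborel (ball (0::'a) (\<delta> - 2 * \<tau>)) \<le> ?I" by (intro main) auto
    then show "ennreal (c * (?w * (\<delta> - 2 * \<tau>) ^ DIM('a))) \<le> ?I"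
      using \<tau> c(1) by (simp add: emeasure_ball ennreal_mult')
  qed (use \<delta> in simp)
  ultimately have "ennreal (c * (?w * (\<delta> - 2 * 0) ^ DIM('a))) \<le> ?I"
    by (rule tendsto_upperbound) simp
  then show ?thesis using \<delta> c(1) by (simp add: emeasure_ball ennreal_mult')
qed

subsection \<open>Integration over spheres\<close>

lemma indicator_times_cong: "(r \<in> I \<Longrightarrow> a = b) \<Longrightarrow> indicator I r * a = indicator I r * (b :: ennreal)"
  by (auto split: split_indicator)

text \<open>By the slab formula the decomposition of a point into projection and height carries
  Lebesgue measure to the product of \<open>perp_measure u\<close> and length, since both agree on
  rectangles.\<close>

lemma emeasure_lborel_hyperplane_slices:
  assumes u: "norm u = 1" and A[measurable]: "A \<in> sets borel"
  shows "emeasure lborel A = (\<integral>\<^sup>+r. emeasure (perp_measure u) {w. w + r *\<^sub>R u \<in> A} \<partial>lborel)"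
proof -
  interpret P: sigma_finite_measure "perp_measure u" by (rule sigma_finite_perp_measure[OF u])
  interpret PP: pair_sigma_finite "perp_measure u" "lborel :: real measure" ..
  let ?f = "\<lambda>x. (hproj u x, x \<bullet> u)"
  have [measurable]: "?f \<in> borel \<rightarrow>\<^sub>M (perp_measure u \<Otimes>\<^sub>M lborel)" by measurable
  have eq: "perp_measure u \<Otimes>\<^sub>M lborel = distr lborel (perp_measure u \<Otimes>\<^sub>M lborel) ?f"
  proof (rule pair_measure_eqI)
    fix P I assume [measurable]: "P \<in> sets (perp_measure u)" "I \<in> sets (lborel::real measure)"
    have "emeasure (distr lborel (perp_measure u \<Otimes>\<^sub>M lborel) ?f) (P \<times> I) = emeasure lborel (?f -` (P \<times> I) \<inter> space lborel)"
    proof (rule emeasure_distr)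
      show "P \<times> I \<in> sets (perp_measure u \<Otimes>\<^sub>M lborel)" by (rule pair_measureI) fact+
    qed measurable
    also have "?f -` (P \<times> I) \<inter> space lborel = {x. x \<bullet> u \<in> I \<and> hproj u x \<in> P}" by auto
    also have "emeasure lborel \<dots> = emeasure lborel I * emeasure (perp_measure u) P"
      by (rule emeasure_slab[OF u]) (use \<open>P \<in> _\<close> \<open>I \<in> _\<close> in auto)
    finally show "emeasure (perp_measure u) P * emeasure lborel I
        = emeasure (distr lborel (perp_measure u \<Otimes>\<^sub>M lborel) ?f) (P \<times> I)" by (simp add: mult.commute)
  qed (auto intro: sigma_finite_lborel P.sigma_finite_measure_axioms)
  let ?X = "{(w, r). w + r *\<^sub>R u \<in> A}"
  have X[measurable]: "?X \<in> sets (perp_measure u \<Otimes>\<^sub>M lborel)"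
  proof -
    have "(\<lambda>(w, r). w + r *\<^sub>R u) -` A \<inter> space (perp_measure u \<Otimes>\<^sub>M lborel) \<in> sets (perp_measure u \<Otimes>\<^sub>M lborel)"
      by (rule measurable_sets[of _ _ borel]) auto
    moreover have "(\<lambda>(w, r). w + r *\<^sub>R u) -` A \<inter> space (perp_measure u \<Otimes>\<^sub>M lborel) = ?X"
      by (auto simp: space_pair_measure)
    ultimately show ?thesis by simp
  qed
  have "emeasure lborel A = emeasure lborel (?f -` ?X \<inter> space lborel)"
    by (rule arg_cong[of _ _ "emeasure lborel"]) (auto simp: hproj_def)
  also have "\<dots> = emeasure (distr lborel (perp_measure u \<Otimes>\<^sub>M lborel) ?f) ?X"
    by (rule emeasure_distr[OF _ X, symmetric]) measurable
  also have "\<dots> = emeasure (perp_measure u \<Otimes>\<^sub>M lborel) ?X" using eq by simp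
  also have "\<dots> = (\<integral>\<^sup>+r. emeasure (perp_measure u) ((\<lambda>w. (w, r)) -` ?X) \<partial>lborel)"
    by (rule PP.emeasure_pair_measure_alt2[OF X])
  also have "\<dots> = (\<integral>\<^sup>+r. emeasure (perp_measure u) {w. w + r *\<^sub>R u \<in> A} \<partial>lborel)"
    by (simp add: vimage_def)
  finally show ?thesis .
qed

text \<open>Consists of the points whose direction is within distance \<open>\<theta>\<close> of
  \<open>u\<close>. Multiplying by \<open>norm x\<close> includes the origin and makes the set
  closed.\<close>

definition round_cone :: "real \<Rightarrow> 'a::euclidean_space \<Rightarrow> 'a set" where
  "round_cone \<theta> u = {x. norm (x - norm x *\<^sub>R u) \<le> \<theta> * norm x}"

lemma closed_round_cone: "closed (round_cone \<theta> u)"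
  unfolding round_cone_def by (intro closed_Collect_le continuous_intros)

text \<open>In the cone the norm and the height \<open>x \<bullet> u\<close> differ by a function
  with Lipschitz constant \<open>\<theta>\<close>. Writing the difference of the squared norms as
  \<open>(x - y) \<bullet> (x + y)\<close> reduces this to the closeness of \<open>x + y\<close> to
  \<open>(norm x + norm y) *\<^sub>R u\<close>.\<close>

lemma round_cone_norm_diff:
  assumes xy: "x \<in> round_cone \<theta> u" "y \<in> round_cone \<theta> u"
  shows "\<bar>(norm x - norm y) - (x - y) \<bullet> u\<bar> \<le> \<theta> * norm (x - y)"
proof (cases "norm x + norm y = 0")
  case True
  then show ?thesis using norm_ge_zero[of x] norm_ge_zero[of y]
    by (simp add: add_nonneg_eq_0_iff)
next
  case False
  let ?s = "norm x + norm y"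
  have s: "?s > 0" using False norm_ge_zero[of x] norm_ge_zero[of y] by linarith
  have "(norm x - norm y) * ?s = x \<bullet> x - y \<bullet> y"
    by (simp add: algebra_simps dot_square_norm power2_eq_square)
  also have "\<dots> = (x - y) \<bullet> (x + y)" by (simp add: algebra_simps inner_commute)
  finally have "((norm x - norm y) - (x - y) \<bullet> u) * ?s = (x - y) \<bullet> (x + y - ?s *\<^sub>R u)"
    by (simp add: inner_diff_right left_diff_distrib algebra_simps)
  then have "\<bar>(norm x - norm y) - (x - y) \<bullet> u\<bar> * ?s = \<bar>(x - y) \<bullet> (x + y - ?s *\<^sub>R u)\<bar>"
    using s by (metis abs_mult abs_of_pos)
  also have "\<dots> \<le> norm (x - y) * norm (x + y - ?s *\<^sub>R u)" by (rule Cauchy_Schwarz_ineq2)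
  also have "x + y - ?s *\<^sub>R u = (x - norm x *\<^sub>R u) + (y - norm y *\<^sub>R u)" by (simp add: algebra_simps)
  also have "norm (x - y) * norm \<dots> \<le> norm (x - y) * (\<theta> * ?s)"
    using xy norm_triangle_ineq[of "x - norm x *\<^sub>R u" "y - norm y *\<^sub>R u"]
    by (intro mult_left_mono) (auto simp: round_cone_def algebra_simps)
  finally have "\<bar>(norm x - norm y) - (x - y) \<bullet> u\<bar> * ?s \<le> \<theta> * norm (x - y) * ?s"
    by (simp add: algebra_simps)
  then show ?thesis using s by (rule mult_right_le_imp_le)
qed

text \<open>Equal norms leave a height difference of at most \<open>\<theta> * norm (x - y)\<close>,
  so on a spherical piece in the cone the projection has an inverse with Lipschitz constant
  \<open>1 / (1 - \<theta>)\<close>.\<close>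

lemma round_cone_sphere_le:
  assumes u: "norm u = 1" and \<theta>: "0 < \<theta>" "\<theta> < 1" and A: "A \<subseteq> round_cone \<theta> u \<inter> sphere 0 r"
  shows "hausdorff_outer s A \<le> ennreal ((1 / (1 - \<theta>)) ^ s) * hausdorff_outer s (hproj u ` A)"
proof -
  have lip: "dist x y \<le> 1 / (1 - \<theta>) * dist (hproj u x) (hproj u y)" if "x \<in> A" "y \<in> A" for x y
  proof -
    have xy: "x \<in> round_cone \<theta> u" "y \<in> round_cone \<theta> u" "norm x = norm y"
      using subsetD[OF A that(1)] subsetD[OF A that(2)] by auto
    have "\<bar>(x - y) \<bullet> u\<bar> \<le> \<theta> * norm (x - y)" using round_cone_norm_diff[OF xy(1,2)] xy(3) by simp
    moreover have "norm (x - y) \<le> norm (hproj u (x - y)) + norm (((x - y) \<bullet> u) *\<^sub>R u)"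
      using norm_triangle_ineq[of "hproj u (x - y)" "((x - y) \<bullet> u) *\<^sub>R u"] by (simp flip: hproj_decomp)
    moreover have "norm (((x - y) \<bullet> u) *\<^sub>R u) = \<bar>(x - y) \<bullet> u\<bar>" using u by simp
    ultimately have "norm (x - y) \<le> norm (hproj u (x - y)) + \<theta> * norm (x - y)" by linarith
    then have "(1 - \<theta>) * norm (x - y) \<le> norm (hproj u (x - y))" by (simp add: left_diff_distrib)
    then show ?thesis using \<theta> by (simp add: dist_norm hproj_diff field_simps)
  qed
  have inj: "inj_on (hproj u) A"
  proof (rule inj_onI)
    fix x y assume "x \<in> A" "y \<in> A" "hproj u x = hproj u y"
    then show "x = y" using lip[of x y] by simp
  qed
  have "hausdorff_outer s (inv_into A (hproj u) ` (hproj u ` A))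
      \<le> ennreal ((1 / (1 - \<theta>)) ^ s) * hausdorff_outer s (hproj u ` A)"
  proof (rule hausdorff_outer_Lipschitz_image)
    fix a b assume "a \<in> hproj u ` A" "b \<in> hproj u ` A"
    then show "dist (inv_into A (hproj u) a) (inv_into A (hproj u) b) \<le> 1 / (1 - \<theta>) * dist a b"
      using lip inj by auto
  qed (use \<theta> in simp)
  moreover have "inv_into A (hproj u) ` (hproj u ` A) = A" using inj by (rule inv_into_image_cancel) simp
  ultimately show ?thesis by simp
qed

context
  fixes c :: real
  assumes n2: "DIM('a::euclidean_space) \<ge> 2"
    and c: "c > 0" "\<And>v A::'a set. norm v = 1 \<Longrightarrow> A \<in> sets borel \<Longrightarrow>
        hausdorff_outer (DIM('a) - 1) (A \<inter> {x. x \<bullet> v = 0}) = ennreal c * emeasure (perp_measure v) A"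
begin

text \<open>The map \<open>T\<close> replaces the height by the norm and so flattens concentric
  spheres to parallel hyperplanes, where slicing is Fubini's theorem. The first factor is the area
  distortion of the projection, the second the volume distortion of \<open>T\<close>, whose
  Lipschitz constant is \<open>1 + \<theta>\<close>. Compactness of \<open>K\<close> makes its image
  under \<open>T\<close> a Borel set.\<close>

lemma cone_spheres_integral_le:
  fixes K :: "'a set"
  assumes u: "norm u = 1" and \<theta>: "0 < \<theta>" "\<theta> < 1" and K: "compact K" "K \<subseteq> round_cone \<theta> u"
  shows "(\<integral>\<^sup>+r. indicator {0<..<R} r * hausdorff_outer (DIM('a) - 1) (K \<inter> sphere 0 r) \<partial>lborel)
    \<le> ennreal ((1 / (1 - \<theta>)) ^ (DIM('a) - 1) * (1 + \<theta>) ^ DIM('a)) * (ennreal c * emeasure lborel K)"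
proof -
  let ?s = "DIM('a) - 1"
  let ?H = "hausdorff_outer ?s :: 'a set \<Rightarrow> ennreal"
  let ?\<Lambda> = "ennreal ((1 / (1 - \<theta>)) ^ ?s)"
  define T where "T x = hproj u x + norm x *\<^sub>R u" for x
  have contT: "continuous_on UNIV T" unfolding T_def hproj_def by (intro continuous_intros)
  have Tc: "compact (T ` K)" using K(1) contT by (intro compact_continuous_image continuous_on_subset[OF contT]) auto
  have Tm: "T ` K \<in> sets borel" "K \<in> sets borel" using Tc K(1) by (auto intro: borel_compact)
  have slice: "?H (K \<inter> sphere 0 r) \<le> ?\<Lambda> * (ennreal c * emeasure (perp_measure u) {w. w + r *\<^sub>R u \<in> T ` K})" for r
  proof -
    have "?H (K \<inter> sphere 0 r) \<le> ?\<Lambda> * ?H (hproj u ` (K \<inter> sphere 0 r))"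
      using u \<theta> K(2) by (intro round_cone_sphere_le) auto
    also have "?H (hproj u ` (K \<inter> sphere 0 r)) \<le> ?H ({w. w + r *\<^sub>R u \<in> T ` K} \<inter> {x. x \<bullet> u = 0})"
      using u by (intro hausdorff_outer_mono) (auto simp: hproj_inner T_def)
    also have "\<dots> = ennreal c * emeasure (perp_measure u) {w. w + r *\<^sub>R u \<in> T ` K}"
      using measurable_sets[of "\<lambda>w. w + r *\<^sub>R u" borel borel "T ` K"] Tm
      by (intro c(2)[OF u]) (auto simp: vimage_def)
    finally show ?thesis by (simp add: mult_left_mono)
  qed
  have Tlip: "dist (T x) (T y) \<le> (1 + \<theta>) * dist x y" if "x \<in> K" "y \<in> K" for x y
  proof -
    have "T x - T y = (x - y) + ((norm x - norm y) - (x - y) \<bullet> u) *\<^sub>R u"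
      by (simp add: T_def hproj_def algebra_simps)
    then have "norm (T x - T y) \<le> norm (x - y) + \<bar>(norm x - norm y) - (x - y) \<bullet> u\<bar>"
      using norm_triangle_ineq[of "x - y" "((norm x - norm y) - (x - y) \<bullet> u) *\<^sub>R u"] u by simp
    also have "\<dots> \<le> norm (x - y) + \<theta> * norm (x - y)"
      using round_cone_norm_diff[of x \<theta> u y] that K(2) by auto
    finally show ?thesis by (simp add: dist_norm algebra_simps)
  qed
  have "(\<integral>\<^sup>+r. indicator {0<..<R} r * ?H (K \<inter> sphere 0 r) \<partial>lborel)
      \<le> (\<integral>\<^sup>+r. ?\<Lambda> * (ennreal c * emeasure (perp_measure u) {w. w + r *\<^sub>R u \<in> T ` K}) \<partial>lborel)"
    using slice by (intro nn_integral_mono) (auto simp: indicator_def)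
  also have "\<dots> = ?\<Lambda> * (ennreal c * emeasure lborel (T ` K))"
  proof -
    interpret P: sigma_finite_measure "perp_measure u" by (rule sigma_finite_perp_measure[OF u])
    have [measurable]: "(\<lambda>r. emeasure (perp_measure u) {w. w + r *\<^sub>R u \<in> T ` K}) \<in> borel_measurable lborel"
    proof -
      have "{(r::real, w). w + r *\<^sub>R u \<in> T ` K} = (\<lambda>(r, w). w + r *\<^sub>R u) -` (T ` K) \<inter> space (lborel \<Otimes>\<^sub>M perp_measure u)"
        by (auto simp: space_pair_measure)
      also have "\<dots> \<in> sets (lborel \<Otimes>\<^sub>M perp_measure u)"
        using Tm by (intro measurable_sets[of _ _ borel]) auto
      finally have "(\<lambda>r. emeasure (perp_measure u) (Pair r -` {(r::real, w). w + r *\<^sub>R u \<in> T ` K})) \<in> borel_measurable lborel"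
        by (rule P.measurable_emeasure_Pair)
      then show ?thesis by (simp add: vimage_def)
    qed
    show ?thesis by (simp add: nn_integral_cmult emeasure_lborel_hyperplane_slices[OF u Tm(1)])
  qed
  also have "\<dots> \<le> ?\<Lambda> * (ennreal c * (ennreal ((1 + \<theta>) ^ DIM('a)) * emeasure lborel K))"
    using \<theta> Tm Tlip by (intro mult_left_mono emeasure_lborel_Lipschitz_image) auto
  also have "\<dots> = ennreal ((1 / (1 - \<theta>)) ^ ?s * (1 + \<theta>) ^ DIM('a)) * (ennreal c * emeasure lborel K)"
    using \<theta> by (simp add: ennreal_mult' mult.assoc mult.left_commute)
  finally show ?thesis .
qed

lemma round_cone_cover:
  fixes \<theta> :: real assumes \<theta>: "\<theta> > 0"
  obtains u :: "nat \<Rightarrow> 'a" and m :: nat where "\<And>k. norm (u k) = 1" "(\<Union>k<m. round_cone \<theta> (u k)) = UNIV"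
proof -
  have "sphere (0::'a) 1 \<subseteq> (\<Union>v\<in>sphere 0 1. ball v \<theta>)" using \<theta> by force
  from compactE_image[OF compact_sphere _ this]
  obtain F where F: "F \<subseteq> sphere (0::'a) 1" "finite F" "sphere 0 1 \<subseteq> (\<Union>v\<in>F. ball v \<theta>)"
    by (metis open_ball)
  obtain b :: 'a where "b \<in> Basis" by fastforce
  then have "b \<in> sphere 0 1" by simp
  then have Fne: "F \<noteq> {}" using F(3) by auto
  have cov: "\<exists>v\<in>F. x \<in> round_cone \<theta> v" for x
  proof (cases "x = 0")
    case True then show ?thesis using Fne by (auto simp: round_cone_def)
  next
    case False
    then have "(1 / norm x) *\<^sub>R x \<in> sphere 0 1" by simp
    then obtain v where v: "v \<in> F" "dist v ((1 / norm x) *\<^sub>R x) < \<theta>" using F(3) by fastforce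
    have "x - norm x *\<^sub>R v = norm x *\<^sub>R ((1 / norm x) *\<^sub>R x - v)" using False by (simp add: scaleR_diff_right)
    then have "norm (x - norm x *\<^sub>R v) = norm x * dist v ((1 / norm x) *\<^sub>R x)"
      by (simp only: norm_scaleR dist_norm norm_minus_commute abs_norm_cancel)
    also have "\<dots> \<le> norm x * \<theta>" using v(2) by (intro mult_left_mono) auto
    finally show ?thesis using v(1) by (auto simp: round_cone_def mult.commute)
  qed
  obtain e where e: "bij_betw e {..<card F} F"
    using F(2) by (metis atLeast0LessThan ex_bij_betw_nat_finite)
  define u where "u k = (if k < card F then e k else b)" for k
  have "norm (u k) = 1" for k
  proof -
    have "e k \<in> F" if "k < card F" using e that unfolding bij_betw_def by blast
    then have "u k \<in> sphere 0 1" using F(1) \<open>b \<in> sphere 0 1\<close> unfolding u_def by (metis subsetD)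
    then show ?thesis by simp
  qed
  moreover have "(\<Union>k<card F. round_cone \<theta> (u k)) = UNIV"
  proof safe
    fix x :: 'a
    obtain v where v: "v \<in> F" "x \<in> round_cone \<theta> v" using cov by blast
    then have "v \<in> e ` {..<card F}" using e by (simp add: bij_betw_def)
    then obtain k where "k < card F" "e k = v" by auto
    then show "x \<in> (\<Union>k<card F. round_cone \<theta> (u k))" using v by (auto simp: u_def intro!: exI[of _ k])
  qed auto
  ultimately show thesis by (rule that)
qed

text \<open>Finitely many cones with \<open>\<theta> = 1/2\<close> cover the sphere, and in each the
  sphere is a Lipschitz image of a subset of a hyperplane disc.\<close>

lemma hausdorff_unit_sphere_finite: "hausdorff_outer (DIM('a) - 1) (sphere (0::'a) 1) < top"
proof -
  let ?s = "DIM('a) - 1"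
  let ?H = "hausdorff_outer ?s :: 'a set \<Rightarrow> ennreal"
  have s1: "?s \<ge> 1" using n2 by simp
  obtain u :: "nat \<Rightarrow> 'a" and m where u: "\<And>k. norm (u k) = 1" "(\<Union>k<m. round_cone (1/2) (u k)) = UNIV"
    by (rule round_cone_cover[of "1/2"]) (simp, rule that)
  let ?A = "\<lambda>k. sphere 0 1 \<inter> round_cone (1/2) (u k)"
  have Am: "?A k \<in> sets borel" for k by (intro borel_closed closed_Int closed_sphere closed_round_cone)
  have "?H (sphere 0 1) = emeasure (hausdorff_measure ?s) (\<Union>k<m. ?A k)"
  proof -
    have "(\<Union>k<m. ?A k) = sphere 0 1" using u(2) by blast
    then show ?thesis using s1 by (simp add: emeasure_hausdorff_measure)
  qed
  also have "\<dots> \<le> (\<Sum>k<m. emeasure (hausdorff_measure ?s) (?A k))"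
    using Am by (intro emeasure_subadditive_finite) auto
  also have "\<dots> < top"
  proof -
    have "emeasure (hausdorff_measure ?s) (?A k) < top" for k
    proof -
      have "emeasure (hausdorff_measure ?s) (?A k) = ?H (?A k)" using s1 Am by (intro emeasure_hausdorff_measure)
      also have "\<dots> \<le> ennreal ((1 / (1 - 1/2)) ^ ?s) * ?H (hproj (u k) ` ?A k)"
        by (intro round_cone_sphere_le[of _ _ _ 1] u) auto
      also have "\<dots> \<le> ennreal ((1 / (1 - 1/2)) ^ ?s) * ?H (cball 0 1 \<inter> {x. x \<bullet> u k = 0})"
      proof -
        have "norm (hproj (u k) x) \<le> 1" if "norm x = 1" for x
          using norm_hproj_le[OF u(1)[of k], of x] that by simp
        then show ?thesis
          using u(1)[of k] by (intro mult_left_mono hausdorff_outer_mono) (auto simp: hproj_inner)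
      qed
      also have "\<dots> = ennreal ((1 / (1 - 1/2)) ^ ?s) * (ennreal c * emeasure (perp_measure (u k)) (cball 0 1))"
        by (subst c(2)[OF u(1)]) auto
      also have "\<dots> < top"
      proof -
        have "emeasure (perp_measure (u k)) (cball 0 1) < top"
          using perp_measure_cball_le[OF u(1)[of k], of 0 1] by (auto intro: order_le_less_trans)
        then show ?thesis by (simp add: ennreal_mult_less_top)
      qed
      finally show ?thesis .
    qed
    then show ?thesis by (induction m) (simp_all add: less_top)
  qed
  finally show ?thesis .
qed

section \<open>The inequality for polar coordinates\<close>

definition sphere_measure :: "'a measure" where
  "sphere_measure = density (hausdorff_measure (DIM('a) - 1)) (indicator (sphere 0 1))"

lemma sets_sphere_measure [simp, measurable_cong]: "sets sphere_measure = sets borel"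
  by (simp add: sphere_measure_def)

lemma emeasure_sphere_measure:
  assumes [measurable]: "A \<in> sets borel"
  shows "emeasure sphere_measure A = hausdorff_outer (DIM('a) - 1) (A \<inter> sphere 0 1)"
proof -
  have [measurable]: "sphere (0::'a) 1 \<in> sets borel" by (intro borel_closed closed_sphere)
  have "emeasure sphere_measure A = (\<integral>\<^sup>+x. indicator (sphere 0 1) x * indicator A x \<partial>hausdorff_measure (DIM('a) - 1))"
    unfolding sphere_measure_def by (rule emeasure_density) auto
  also have "\<dots> = (\<integral>\<^sup>+x. indicator (A \<inter> sphere 0 1) x \<partial>hausdorff_measure (DIM('a) - 1))"
    by (intro nn_integral_cong) (auto simp: indicator_def)
  also have "\<dots> = hausdorff_outer (DIM('a) - 1) (A \<inter> sphere 0 1)"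
    using n2 by (simp add: emeasure_hausdorff_measure)
  finally show ?thesis .
qed

lemma finite_sphere_measure: "finite_measure sphere_measure"
proof
  show "emeasure sphere_measure (space sphere_measure) \<noteq> \<infinity>"
    using emeasure_sphere_measure[of UNIV] hausdorff_unit_sphere_finite
    by (simp add: sphere_measure_def less_top)
qed

text \<open>Refers all spheres to one finite measure on the unit sphere, so that measurability in
  the radius and Fubini's theorem become available.\<close>

lemma sphere_integral_scale:
  fixes F :: "'a \<Rightarrow> ennreal"
  assumes r: "r > 0" and [measurable]: "F \<in> borel_measurable borel"
  shows "(\<integral>\<^sup>+x. F x * indicator (sphere x0 r) x \<partial>hausdorff_measure (DIM('a) - 1))
    = ennreal (r ^ (DIM('a) - 1)) * (\<integral>\<^sup>+y. F (x0 + r *\<^sub>R y) \<partial>sphere_measure)"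
proof -
  let ?s = "DIM('a) - 1"
  let ?g = "\<lambda>y::'a. x0 + r *\<^sub>R y"
  have [measurable]: "sphere x0 r \<in> sets borel" by (intro borel_closed closed_sphere)
  have eq: "density (hausdorff_measure ?s) (indicator (sphere x0 r))
      = density (distr sphere_measure borel ?g) (\<lambda>_. ennreal (r ^ ?s))"
  proof (rule measure_eqI)
    fix A assume "A \<in> sets (density (hausdorff_measure ?s :: 'a measure) (indicator (sphere x0 r)))"
    then have A[measurable]: "A \<in> sets borel" by simp
    have gA[measurable]: "?g -` A \<in> sets borel" using measurable_sets[of ?g borel borel A] by simp
    have "emeasure (density (hausdorff_measure ?s) (indicator (sphere x0 r))) A
        = (\<integral>\<^sup>+x. indicator (sphere x0 r) x * indicator A x \<partial>hausdorff_measure ?s)"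
      by (rule emeasure_density) auto
    also have "\<dots> = (\<integral>\<^sup>+x. indicator (A \<inter> sphere x0 r) x \<partial>hausdorff_measure ?s)"
      by (intro nn_integral_cong) (auto simp: indicator_def)
    also have "\<dots> = hausdorff_outer ?s (A \<inter> sphere x0 r)"
      using n2 by (simp add: emeasure_hausdorff_measure)
    also have "A \<inter> sphere x0 r = (+) x0 ` ((\<lambda>y. r *\<^sub>R y) ` (?g -` A \<inter> sphere 0 1))"
    proof safe
      fix x assume x: "x \<in> A" "x \<in> sphere x0 r"
      then have "x = x0 + r *\<^sub>R ((1 / r) *\<^sub>R (x - x0))" "norm ((1 / r) *\<^sub>R (x - x0)) = 1"
        using r by (auto simp: dist_norm norm_minus_commute)
      then show "x \<in> (+) x0 ` ((\<lambda>y. r *\<^sub>R y) ` (?g -` A \<inter> sphere 0 1))"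
        using x(1) by (intro image_eqI[of _ _ "r *\<^sub>R ((1 / r) *\<^sub>R (x - x0))"] image_eqI[of _ _ "(1 / r) *\<^sub>R (x - x0)"]) auto
    qed (use r in \<open>auto simp: dist_norm\<close>)
    also have "hausdorff_outer ?s \<dots> = ennreal (r ^ ?s) * hausdorff_outer ?s (?g -` A \<inter> sphere 0 1)"
      by (simp add: hausdorff_outer_isometry_image hausdorff_outer_scaleR[OF r])
    also have "\<dots> = ennreal (r ^ ?s) * emeasure sphere_measure (?g -` A)" by (simp add: emeasure_sphere_measure)
    also have "\<dots> = emeasure (density (distr sphere_measure borel ?g) (\<lambda>_. ennreal (r ^ ?s))) A"
      by (simp add: emeasure_density nn_integral_cmult_indicator emeasure_distr sphere_measure_def)
    finally show "emeasure (density (hausdorff_measure ?s) (indicator (sphere x0 r))) A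
      = emeasure (density (distr sphere_measure borel ?g) (\<lambda>_. ennreal (r ^ ?s))) A" .
  qed simp
  have "(\<integral>\<^sup>+x. F x * indicator (sphere x0 r) x \<partial>hausdorff_measure ?s)
      = (\<integral>\<^sup>+x. F x \<partial>density (hausdorff_measure ?s) (indicator (sphere x0 r)))"
    by (subst nn_integral_density) (auto simp: mult.commute)
  also have "\<dots> = ennreal (r ^ ?s) * (\<integral>\<^sup>+y. F (?g y) \<partial>sphere_measure)"
    unfolding eq by (simp add: nn_integral_density nn_integral_cmult nn_integral_distr)
  finally show ?thesis .
qed

lemma borel_measurable_sphere_integral:
  fixes F :: "'a \<Rightarrow> ennreal"
  assumes [measurable]: "F \<in> borel_measurable borel" and R: "0 \<le> a"
  shows "(\<lambda>r. indicator {a<..<R} r * (\<integral>\<^sup>+x. F x * indicator (sphere x0 r) x \<partial>hausdorff_measure (DIM('a) - 1)))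
    \<in> borel_measurable borel"
proof -
  interpret finite_measure sphere_measure by (rule finite_sphere_measure)
  have "(\<lambda>r. indicator {a<..<R} r * (\<integral>\<^sup>+x. F x * indicator (sphere x0 r) x \<partial>hausdorff_measure (DIM('a) - 1)))
    = (\<lambda>r. indicator {a<..<R} r * (ennreal (r ^ (DIM('a) - 1)) * (\<integral>\<^sup>+y. F (x0 + r *\<^sub>R y) \<partial>sphere_measure)))"
    using R by (intro ext indicator_times_cong sphere_integral_scale) auto
  also have "\<dots> \<in> borel_measurable borel" by measurable
  finally show ?thesis .
qed

lemma spheres_integral_le_origin:
  fixes F :: "'a \<Rightarrow> ennreal"
  assumes F[measurable]: "F \<in> borel_measurable borel"
  shows "(\<integral>\<^sup>+r. indicator {0<..<R} r * (\<integral>\<^sup>+x. F x * indicator (sphere 0 r) x \<partial>hausdorff_measure (DIM('a) - 1)) \<partial>lborel)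
    \<le> ennreal c * (\<integral>\<^sup>+x. F x \<partial>lborel)"
proof -
  let ?s = "DIM('a) - 1"
  let ?H = "hausdorff_outer ?s :: 'a set \<Rightarrow> ennreal"
  interpret \<nu>: finite_measure sphere_measure by (rule finite_sphere_measure)
  define M where "M = density lborel (\<lambda>r. indicator {0<..<R} r * ennreal (r ^ ?s))"
  have setsM [measurable_cong, simp]: "sets M = sets borel" by (simp add: M_def)
  \<comment> \<open>\<open>N\<close> gives a set the area of its spherical sections, integrated over
    the radii below \<open>R\<close>; the claim is that it is at most \<open>c\<close> times
    Lebesgue measure. The bound on the radii makes \<open>N\<close> finite, as inner regularity
    requires.\<close>
  define N where "N = distr (M \<Otimes>\<^sub>M sphere_measure) borel (\<lambda>(r, y). r *\<^sub>R y)"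
  have setsN [measurable_cong, simp]: "sets N = sets borel" by (simp add: N_def)
  have intN: "(\<integral>\<^sup>+x. G x \<partial>N)
      = (\<integral>\<^sup>+r. indicator {0<..<R} r * (\<integral>\<^sup>+x. G x * indicator (sphere 0 r) x \<partial>hausdorff_measure ?s) \<partial>lborel)"
    if [measurable]: "G \<in> borel_measurable borel" for G :: "'a \<Rightarrow> ennreal"
  proof -
    have "(\<integral>\<^sup>+x. G x \<partial>N) = (\<integral>\<^sup>+(r, y). G (r *\<^sub>R y) \<partial>(M \<Otimes>\<^sub>M sphere_measure))"
      unfolding N_def by (subst nn_integral_distr) (auto simp: case_prod_unfold)
    also have "\<dots> = (\<integral>\<^sup>+r. \<integral>\<^sup>+y. G (r *\<^sub>R y) \<partial>sphere_measure \<partial>M)"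
      by (subst \<nu>.nn_integral_fst[symmetric]) auto
    also have "\<dots> = (\<integral>\<^sup>+r. indicator {0<..<R} r * ennreal (r ^ ?s) * (\<integral>\<^sup>+y. G (r *\<^sub>R y) \<partial>sphere_measure) \<partial>lborel)"
      unfolding M_def by (rule nn_integral_density) auto
    also have "\<dots> = (\<integral>\<^sup>+r. indicator {0<..<R} r * (\<integral>\<^sup>+x. G x * indicator (sphere 0 r) x \<partial>hausdorff_measure ?s) \<partial>lborel)"
      by (intro nn_integral_cong, unfold mult.assoc, intro indicator_times_cong)
        (auto simp: sphere_integral_scale[of _ _ 0] simp del: One_nat_def)
    finally show ?thesis .
  qed
  have emN: "emeasure N A = (\<integral>\<^sup>+r. indicator {0<..<R} r * ?H (A \<inter> sphere 0 r) \<partial>lborel)"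
    if [measurable]: "A \<in> sets borel" for A
  proof -
    have "emeasure N A = (\<integral>\<^sup>+x. indicator A x \<partial>N)" by simp
    also have "\<dots> = (\<integral>\<^sup>+r. indicator {0<..<R} r * (\<integral>\<^sup>+x. indicator A x * indicator (sphere 0 r) x \<partial>hausdorff_measure ?s) \<partial>lborel)"
      by (rule intN) auto
    also have "\<dots> = (\<integral>\<^sup>+r. indicator {0<..<R} r * ?H (A \<inter> sphere 0 r) \<partial>lborel)"
    proof (intro nn_integral_cong arg_cong2[of _ _ _ _ "(*)"] refl)
      fix r
      have "(\<integral>\<^sup>+x. indicator A x * indicator (sphere 0 r) x \<partial>hausdorff_measure ?s)
          = (\<integral>\<^sup>+x. indicator (A \<inter> sphere 0 r) x \<partial>hausdorff_measure ?s)"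
        by (intro nn_integral_cong) (auto simp: indicator_def)
      also have "\<dots> = ?H (A \<inter> sphere 0 r)" using n2 by (simp add: emeasure_hausdorff_measure)
      finally show "(\<integral>\<^sup>+x. indicator A x * indicator (sphere 0 r) x \<partial>hausdorff_measure ?s) = ?H (A \<inter> sphere 0 r)" .
    qed
    finally show ?thesis .
  qed
  have Nfin: "emeasure N (space N) \<noteq> \<infinity>"
  proof -
    have "emeasure M UNIV = (\<integral>\<^sup>+r. indicator {0<..<R} r * ennreal (r ^ ?s) \<partial>lborel)"
      unfolding M_def by (subst emeasure_density) auto
    also have "\<dots> \<le> (\<integral>\<^sup>+r. ennreal (R ^ ?s) * indicator {0<..<R} r \<partial>lborel)"
      by (intro nn_integral_mono) (auto simp: indicator_def intro!: ennreal_leI power_mono)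
    also have "\<dots> = ennreal (R ^ ?s) * emeasure lborel {0<..<R}" by (intro nn_integral_cmult_indicator) simp
    also have "\<dots> < top" by (cases "0 \<le> R") (auto simp: ennreal_mult_less_top)
    finally have Mfin: "emeasure M UNIV < top" .
    have "emeasure N (space N) = (\<integral>\<^sup>+x. 1 \<partial>N)" by simp
    also have "\<dots> = (\<integral>\<^sup>+(r, y). 1 \<partial>(M \<Otimes>\<^sub>M sphere_measure))"
      unfolding N_def by (subst nn_integral_distr) (auto simp: case_prod_unfold)
    also have "\<dots> = (\<integral>\<^sup>+r. emeasure sphere_measure UNIV \<partial>M)"
      by (subst \<nu>.nn_integral_fst[symmetric]) (auto simp: sphere_measure_def)
    also have "\<dots> = emeasure sphere_measure UNIV * emeasure M UNIV" by (simp add: M_def)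
    also have "\<dots> < top"
      using hausdorff_unit_sphere_finite emeasure_sphere_measure[of UNIV] Mfin
      by (simp add: ennreal_mult_less_top)
    finally show ?thesis by simp
  qed
  have cone: "emeasure N A \<le> ennreal ((1 / (1 - \<theta>)) ^ ?s * (1 + \<theta>) ^ DIM('a)) * (ennreal c * emeasure lborel A)"
    if \<theta>: "0 < \<theta>" "\<theta> < 1" and u: "norm u = 1" and A: "A \<in> sets borel" "A \<subseteq> round_cone \<theta> u" for \<theta> u A
  proof -
    have "emeasure N A = (SUP K \<in> {K. K \<subseteq> A \<and> compact K}. emeasure N K)"
      by (rule inner_regular) (use Nfin A in auto)
    also have "\<dots> \<le> ennreal ((1 / (1 - \<theta>)) ^ ?s * (1 + \<theta>) ^ DIM('a)) * (ennreal c * emeasure lborel A)"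
    proof (rule SUP_least)
      fix K assume K: "K \<in> {K. K \<subseteq> A \<and> compact K}"
      then have Kb: "K \<in> sets borel" by (auto intro: borel_compact)
      have "emeasure N K \<le> ennreal ((1 / (1 - \<theta>)) ^ ?s * (1 + \<theta>) ^ DIM('a)) * (ennreal c * emeasure lborel K)"
        unfolding emN[OF Kb] using K A \<theta> u by (intro cone_spheres_integral_le) auto
      also have "\<dots> \<le> ennreal ((1 / (1 - \<theta>)) ^ ?s * (1 + \<theta>) ^ DIM('a)) * (ennreal c * emeasure lborel A)"
        using K A by (intro mult_left_mono emeasure_mono) auto
      finally show "emeasure N K \<le> \<dots>" .
    qed
    finally show ?thesis .
  qed
  have all: "emeasure N A \<le> ennreal ((1 / (1 - \<theta>)) ^ ?s * (1 + \<theta>) ^ DIM('a)) * (ennreal c * emeasure lborel A)"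
    if \<theta>: "0 < \<theta>" "\<theta> < 1" and A: "A \<in> sets borel" for \<theta> A
  proof -
    obtain u :: "nat \<Rightarrow> 'a" and m where u: "\<And>k. norm (u k) = 1" "(\<Union>k<m. round_cone \<theta> (u k)) = UNIV"
      by (rule round_cone_cover[OF \<theta>(1)]) (rule that)
    \<comment> \<open>The cones overlap. Made disjoint they are no longer closed, which is why the
      estimate in a cone was first extended from compact to Borel sets.\<close>
    let ?D = "disjointed (\<lambda>k. round_cone \<theta> (u k))"
    have Dm: "?D k \<in> sets borel" for k
      unfolding disjointed_def by (intro sets.Diff sets.finite_UN borel_closed closed_round_cone) auto
    have D: "(\<Union>k. A \<inter> ?D k) = A"
    proof -
      have "UNIV \<subseteq> (\<Union>k. round_cone \<theta> (u k))" unfolding u(2)[symmetric] by (rule UN_mono) auto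
      then have "(\<Union>k. ?D k) = UNIV" unfolding UN_disjointed_eq by auto
      then show ?thesis by (simp only: Int_UN_distrib[symmetric] Int_UNIV_right)
    qed
    have Dd: "disjoint_family (\<lambda>k. A \<inter> ?D k)"
      using disjoint_family_disjointed[of "\<lambda>k. round_cone \<theta> (u k)"] by (auto simp: disjoint_family_on_def)
    let ?C = "ennreal ((1 / (1 - \<theta>)) ^ ?s * (1 + \<theta>) ^ DIM('a))"
    have "emeasure N A = (\<Sum>k. emeasure N (A \<inter> ?D k))"
      using A Dm Dd D by (subst suminf_emeasure) auto
    also have "\<dots> \<le> (\<Sum>k. ?C * (ennreal c * emeasure lborel (A \<inter> ?D k)))"
    proof (rule suminf_le)
      fix k
      show "emeasure N (A \<inter> ?D k) \<le> ?C * (ennreal c * emeasure lborel (A \<inter> ?D k))"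
        using \<theta> u(1)[of k] A Dm disjointed_subset[of "\<lambda>k. round_cone \<theta> (u k)" k] by (intro cone[where u = "u k"]) auto
    qed auto
    also have "\<dots> = ?C * (ennreal c * emeasure lborel A)"
    proof -
      have "(\<Sum>k. emeasure lborel (A \<inter> ?D k)) = emeasure lborel A"
        using A Dm Dd D by (subst suminf_emeasure) auto
      then show ?thesis by simp
    qed
    finally show ?thesis .
  qed
  have le: "emeasure N A \<le> ennreal c * emeasure lborel A" if A: "A \<in> sets borel" for A
  proof (cases "emeasure lborel A = top")
    case False
    then obtain l where l: "l \<ge> 0" "emeasure lborel A = ennreal l" by (cases "emeasure lborel A") auto
    \<comment> \<open>Both distortion factors tend to 1 as the cones get narrower.\<close>
    have "((\<lambda>\<theta>. ennreal ((1 / (1 - \<theta>)) ^ ?s * (1 + \<theta>) ^ DIM('a) * (c * l))) \<longlongrightarrow>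
        ennreal ((1 / (1 - 0)) ^ ?s * (1 + 0) ^ DIM('a) * (c * l))) (at_right 0)"
      by (intro tendsto_ennrealI tendsto_intros) auto
    moreover have "\<forall>\<^sub>F \<theta> in at_right 0. emeasure N A \<le> ennreal ((1 / (1 - \<theta>)) ^ ?s * (1 + \<theta>) ^ DIM('a) * (c * l))"
    proof (rule eventually_mono[OF eventually_at_right_real[of 0 1]])
      fix \<theta> :: real assume "\<theta> \<in> {0<..<1}"
      then show "emeasure N A \<le> ennreal ((1 / (1 - \<theta>)) ^ ?s * (1 + \<theta>) ^ DIM('a) * (c * l))"
        using all[of \<theta> A] A l c(1) by (simp add: ennreal_mult')
    qed simp
    ultimately have "emeasure N A \<le> ennreal ((1 / (1 - 0)) ^ ?s * (1 + 0) ^ DIM('a) * (c * l))"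
      by (rule tendsto_lowerbound) simp
    then show ?thesis using l c(1) by (simp add: ennreal_mult')
  qed (use c(1) in \<open>simp add: ennreal_mult_top\<close>)
  have "(\<integral>\<^sup>+x. F x \<partial>N) \<le> (\<integral>\<^sup>+x. F x \<partial>density lborel (\<lambda>_. ennreal c))"
  proof (rule nn_integral_mono_measure)
    show "N \<le> density lborel (\<lambda>_. ennreal c)"
      using le by (auto simp: le_measure emeasure_density nn_integral_cmult_indicator)
  qed auto
  also have "\<dots> = ennreal c * (\<integral>\<^sup>+x. F x \<partial>lborel)" by (simp add: nn_integral_density nn_integral_cmult)
  finally show ?thesis using intN[OF F] by simp
qed

lemma spheres_integral_le:
  fixes F :: "'a \<Rightarrow> ennreal"
  assumes F[measurable]: "F \<in> borel_measurable borel"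
  shows "(\<integral>\<^sup>+r. indicator {0<..<R} r * (\<integral>\<^sup>+x. F x * indicator (sphere x0 r) x \<partial>hausdorff_measure (DIM('a) - 1)) \<partial>lborel)
    \<le> ennreal c * (\<integral>\<^sup>+x. F x \<partial>lborel)"
proof -
  let ?s = "DIM('a) - 1"
  have "(\<integral>\<^sup>+r. indicator {0<..<R} r * (\<integral>\<^sup>+x. F x * indicator (sphere x0 r) x \<partial>hausdorff_measure ?s) \<partial>lborel)
    = (\<integral>\<^sup>+r. indicator {0<..<R} r * (\<integral>\<^sup>+x. F (x0 + x) * indicator (sphere 0 r) x \<partial>hausdorff_measure ?s) \<partial>lborel)"
    by (rule nn_integral_cong, rule indicator_times_cong) (auto simp: sphere_integral_scale simp del: One_nat_def)
  also have "\<dots> \<le> ennreal c * (\<integral>\<^sup>+x. F (x0 + x) \<partial>lborel)"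
    by (rule spheres_integral_le_origin) simp
  also have "(\<integral>\<^sup>+x. F (x0 + x) \<partial>lborel) = (\<integral>\<^sup>+x. F x \<partial>distr lborel borel ((+) x0))"
    by (subst nn_integral_distr) auto
  also have "\<dots> = (\<integral>\<^sup>+x. F x \<partial>lborel)" by (simp add: lborel_distr_plus)
  finally show ?thesis .
qed

end

subsection \<open>Powers and Hoelder's inequality\<close>

lemma epowr_ennreal [simp]: "0 \<le> a \<Longrightarrow> epowr (ennreal a) q = ennreal (a powr q)"
  by (simp add: epowr_def)

lemma epowr_top [simp]: "epowr top q = top"
  by (simp add: epowr_def)

lemma epowr_0 [simp]: "epowr 0 q = 0"
  by (simp add: epowr_def)

lemma epowr_1 [simp]: "epowr 1 q = 1"
  using epowr_ennreal[of 1 q] by simp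

lemma epowr_mono:
  assumes "0 \<le> q" "x \<le> y" shows "epowr x q \<le> epowr y q"
proof (cases y)
  case (real b)
  then obtain a where "0 \<le> a" "x = ennreal a" using assms(2) by (cases x) (auto simp: top_unique)
  then show ?thesis using real assms by (auto intro!: ennreal_leI powr_mono2)
qed simp

lemma borel_measurable_epowr [measurable (raw)]:
  assumes [measurable]: "f \<in> borel_measurable M"
  shows "(\<lambda>x. epowr (f x) q) \<in> borel_measurable M"
  unfolding epowr_def by measurable

lemma epowr_eq_0_iff [simp]: "epowr x q = 0 \<longleftrightarrow> x = 0"
  by (cases x) (auto simp: ennreal_eq_0_iff)

lemma epowr_eq_top_iff [simp]: "epowr x q = top \<longleftrightarrow> x = top"
  by (cases x) auto

lemma epowr_mult: "epowr (x * y) q = epowr x q * epowr y q"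
proof (cases "x = top \<or> y = top")
  case True
  then show ?thesis by (auto simp: ennreal_mult_eq_top_iff ennreal_mult_top ennreal_top_mult)
next
  case False
  then obtain a b where "0 \<le> a" "x = ennreal a" "0 \<le> b" "y = ennreal b" by (metis ennreal_cases)
  then show ?thesis by (simp add: powr_mult ennreal_mult'[symmetric])
qed

lemma epowr_epowr: "epowr (epowr x p) q = epowr x (p * q)"
  by (cases x) (auto simp: powr_powr)

lemma epowr_one [simp]: "epowr x 1 = x"
  by (cases x) auto

lemma epowr_power:
  assumes "n \<ge> 1" shows "epowr x (real n) = x ^ n"
proof (cases x)
  case top
  have "top ^ Suc m = (top :: ennreal)" for m by (induction m) auto
  then have "top ^ n = (top :: ennreal)" using assms by (cases n) auto
  then show ?thesis using top by simp
qed (use assms in \<open>auto simp: powr_realpow' ennreal_power\<close>)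

text \<open>Young's inequality for \<open>x / A powr (1 / p)\<close> and
  \<open>y / B powr (1 / q)\<close>; with \<open>A\<close> and \<open>B\<close> the two integrals it
  integrates to Hoelder's inequality.\<close>

lemma Youngs_inequality_epowr:
  assumes pq: "p > 1" "q > 1" "1 / p + 1 / q = 1" and AB: "A > 0" "B > 0"
  shows "x * y \<le> ennreal (A powr (1 / p) * B powr (1 / q)) * (ennreal (1 / (p * A)) * epowr x p + ennreal (1 / (q * B)) * epowr y q)"
proof (cases "x = top \<or> y = top")
  case True
  then show ?thesis using pq AB by (auto simp: ennreal_mult_eq_top_iff ennreal_mult_top distrib_left)
next
  case False
  then obtain a b where ab: "0 \<le> a" "x = ennreal a" "0 \<le> b" "y = ennreal b" by (metis ennreal_cases)
  let ?a = "A powr (1 / p)" and ?b = "B powr (1 / q)"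
  have pos: "?a > 0" "?b > 0" using AB by auto
  have "(a / ?a) * (b / ?b) \<le> (a / ?a) powr p / p + (b / ?b) powr q / q"
    using pq ab pos by (intro Youngs_inequality) auto
  also have "(a / ?a) powr p = a powr p / A" using ab AB pq by (simp add: powr_divide powr_powr)
  also have "(b / ?b) powr q = b powr q / B" using ab AB pq by (simp add: powr_divide powr_powr)
  finally have "?a * ?b * ((a / ?a) * (b / ?b)) \<le> ?a * ?b * (1 / (p * A) * a powr p + 1 / (q * B) * b powr q)"
    using pos by (intro mult_left_mono) (auto simp: mult.commute)
  moreover have "?a * ?b * ((a / ?a) * (b / ?b)) = a * b" using pos by simp
  ultimately have "a * b \<le> ?a * ?b * (1 / (p * A) * a powr p + 1 / (q * B) * b powr q)" by simp
  from ennreal_leI[OF this] have "ennreal a * ennreal b \<le> ennreal (?a * ?b * (1 / (p * A) * a powr p + 1 / (q * B) * b powr q))"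
    using ab by (simp add: ennreal_mult)
  also have "\<dots> = ennreal (?a * ?b) * (ennreal (1 / (p * A)) * ennreal (a powr p) + ennreal (1 / (q * B)) * ennreal (b powr q))"
  proof -
    have star: "ennreal (k * (s * X + t * Y)) = ennreal k * (ennreal s * ennreal X + ennreal t * ennreal Y)"
      if "0 \<le> k" "0 \<le> s" "0 \<le> t" "0 \<le> X" "0 \<le> Y" for k s t X Y
      using that by (simp add: ennreal_mult)
    show ?thesis using pq AB pos by (intro star) auto
  qed
  finally show ?thesis using ab by simp
qed

lemma Hoelder_inequality_nn:
  fixes f g :: "'a \<Rightarrow> ennreal"
  assumes pq: "p > 1" "q > 1" "1 / p + 1 / q = 1"
    and [measurable]: "f \<in> borel_measurable M" "g \<in> borel_measurable M"
  shows "(\<integral>\<^sup>+x. f x * g x \<partial>M) \<le> epowr (\<integral>\<^sup>+x. epowr (f x) p \<partial>M) (1 / p) * epowr (\<integral>\<^sup>+x. epowr (g x) q \<partial>M) (1 / q)"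
    (is "?I \<le> epowr ?A _ * epowr ?B _")
proof -
  consider "?A = 0 \<or> ?B = 0" | "?A \<noteq> 0" "?B \<noteq> 0" "?A = top \<or> ?B = top" | "?A \<noteq> 0" "?B \<noteq> 0" "?A < top" "?B < top"
    using less_top[of ?A] less_top[of ?B] by blast
  then show ?thesis
  proof cases
    \<comment> \<open>If one integral vanishes, so does the product of the functions almost
      everywhere, which also settles 0 times infinity.\<close>
    case 1
    then have "AE x in M. f x * g x = 0"
    proof
      assume "?A = 0"
      then have "AE x in M. epowr (f x) p = 0" by (subst (asm) nn_integral_0_iff_AE) auto
      then show ?thesis by eventually_elim simp
    next
      assume "?B = 0"
      then have "AE x in M. epowr (g x) q = 0" by (subst (asm) nn_integral_0_iff_AE) auto
      then show ?thesis by eventually_elim simp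
    qed
    then have "?I = 0" by (subst nn_integral_0_iff_AE) auto
    then show ?thesis by simp
  next
    case 2
    then have "epowr ?A (1 / p) * epowr ?B (1 / q) = top"
      by (auto simp: ennreal_mult_eq_top_iff)
    then show ?thesis by simp
  next
    case 3
    then obtain a b where ab: "a > 0" "?A = ennreal a" "b > 0" "?B = ennreal b"
      by (cases ?A; cases ?B) (auto simp: zero_less_iff_neq_zero[symmetric])
    let ?c = "ennreal (a powr (1 / p) * b powr (1 / q))"
    have "?I \<le> (\<integral>\<^sup>+x. ?c * (ennreal (1 / (p * a)) * epowr (f x) p + ennreal (1 / (q * b)) * epowr (g x) q) \<partial>M)"
      by (intro nn_integral_mono Youngs_inequality_epowr pq ab)
    also have "\<dots> = ?c * (ennreal (1 / (p * a)) * ennreal a + ennreal (1 / (q * b)) * ennreal b)"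
      by (simp add: nn_integral_cmult nn_integral_add ab)
    also have "ennreal (1 / (p * a)) * ennreal a + ennreal (1 / (q * b)) * ennreal b = ennreal (1 / p + 1 / q)"
      using ab pq by (simp add: ennreal_mult'[symmetric] ennreal_plus[symmetric] del: ennreal_plus)
    also have "?c * ennreal (1 / p + 1 / q) = epowr ?A (1 / p) * epowr ?B (1 / q)"
      using ab pq by (simp add: ennreal_mult)
    finally show ?thesis .
  qed
qed

subsection \<open>The lower bound for extensively admissible densities\<close>

context
  fixes c p :: real and x0 :: "'a::euclidean_space" and D :: "'a set" and \<epsilon> R :: real
  assumes n2: "DIM('a) \<ge> 2"
    and c: "c > 0" "\<And>v A::'a set. norm v = 1 \<Longrightarrow> A \<in> sets borel \<Longrightarrow>
        hausdorff_outer (DIM('a) - 1) (A \<inter> {x. x \<bullet> v = 0}) = ennreal c * emeasure (perp_measure v) A"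
    and p: "real DIM('a) - 1 < p"
    and D [measurable]: "D \<in> sets borel"
    and \<epsilon>R: "0 < \<epsilon>" "\<epsilon> < R"
begin

lemma borel_annulus [measurable]: "annulus x0 \<epsilon> R \<in> sets borel"
  unfolding annulus_def by measurable

lemma surf_integral_sphere_eq:
  "surf_integral \<rho> (sphere x0 r \<inter> D)
    = (\<integral>\<^sup>+x. (\<rho> x ^ (DIM('a) - 1) * indicator D x) * indicator (sphere x0 r) x \<partial>hausdorff_measure (DIM('a) - 1))"
  unfolding surf_integral_def by (intro nn_integral_cong) (auto simp: indicator_def)

text \<open>The weight is constant on each sphere and can be moved into the integrand of the
  inequality for polar coordinates; the annulus indicator removes the radii up to
  \<open>\<epsilon>\<close>.\<close>

lemma weighted_surf_integral_le:
  fixes \<rho> :: "'a \<Rightarrow> ennreal" and \<eta> :: "real \<Rightarrow> ennreal"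
  assumes [measurable]: "\<rho> \<in> borel_measurable borel" "\<eta> \<in> borel_measurable borel"
  shows "(\<integral>\<^sup>+r. \<eta> r * (indicator {\<epsilon><..<R} r * surf_integral \<rho> (sphere x0 r \<inter> D)) \<partial>lborel)
    \<le> ennreal c * (\<integral>\<^sup>+x. \<rho> x ^ (DIM('a) - 1) * \<eta> (dist x x0) * indicator (D \<inter> annulus x0 \<epsilon> R) x \<partial>lborel)"
proof -
  let ?H = "hausdorff_measure (DIM('a) - 1) :: 'a measure"
  let ?F = "\<lambda>x. \<rho> x ^ (DIM('a) - 1) * \<eta> (dist x x0) * indicator (D \<inter> annulus x0 \<epsilon> R) x"
  have eq: "\<eta> r * (indicator {\<epsilon><..<R} r * surf_integral \<rho> (sphere x0 r \<inter> D))
      = indicator {0<..<R} r * (\<integral>\<^sup>+x. ?F x * indicator (sphere x0 r) x \<partial>?H)" for r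
  proof (cases "r \<in> {\<epsilon><..<R}")
    case True
    have [measurable]: "sphere x0 r \<in> sets borel" by (intro borel_closed closed_sphere)
    have "(\<integral>\<^sup>+x. ?F x * indicator (sphere x0 r) x \<partial>?H)
       = (\<integral>\<^sup>+x. \<eta> r * ((\<rho> x ^ (DIM('a) - 1) * indicator D x) * indicator (sphere x0 r) x) \<partial>?H)"
      using True by (intro nn_integral_cong) (auto simp: indicator_def annulus_def dist_commute mult.commute)
    also have "\<dots> = \<eta> r * surf_integral \<rho> (sphere x0 r \<inter> D)"
      unfolding surf_integral_sphere_eq by (rule nn_integral_cmult) measurable
    finally show ?thesis using True \<epsilon>R by simp
  next
    case False
    have z: "?F x * indicator (sphere x0 r) x = 0" if "r < R" for x
      using False that by (auto simp: indicator_def annulus_def dist_commute)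
    have "(\<integral>\<^sup>+x. ?F x * indicator (sphere x0 r) x \<partial>?H) = (\<integral>\<^sup>+x. 0 \<partial>?H)" if "r < R"
      by (simp only: z[OF that])
    then show ?thesis using False by (cases "r < R") auto
  qed
  have "?F \<in> borel_measurable borel" by measurable
  from spheres_integral_le[OF n2 c this] show ?thesis unfolding eq .
qed

text \<open>With \<open>q = p / (n - 1)\<close> the factor \<open>Q x powr (1 / q)\<close> is
  inserted and compensated. Hoelder's inequality with \<open>q\<close> and its conjugate
  \<open>\<alpha>\<close> then turns it into \<open>Q\<close> to the power
  \<open>\<alpha> / q = (n - 1) / (p - n + 1)\<close>.\<close>

lemma annulus_Hoelder:
  fixes \<rho> :: "'a \<Rightarrow> ennreal" and \<eta> :: "real \<Rightarrow> ennreal" and Q :: "'a \<Rightarrow> real"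
  assumes [measurable]: "\<rho> \<in> borel_measurable borel" "\<eta> \<in> borel_measurable borel" "Q \<in> borel_measurable lebesgue"
    and Q: "\<And>x. Q x > 0"
  shows "(\<integral>\<^sup>+x. \<rho> x ^ (DIM('a) - 1) * \<eta> (dist x x0) * indicator (D \<inter> annulus x0 \<epsilon> R) x \<partial>lborel)
    \<le> epowr (\<integral>\<^sup>+x. epowr (\<rho> x) p / ennreal (Q x) * indicator (D \<inter> annulus x0 \<epsilon> R) x \<partial>lebesgue) ((real DIM('a) - 1) / p)
      * epowr (\<integral>\<^sup>+x. ennreal (Q x powr ((real DIM('a) - 1) / (p - real DIM('a) + 1)))
           * epowr (\<eta> (dist x x0)) (p / (p - real DIM('a) + 1)) * indicator (annulus x0 \<epsilon> R) x \<partial>lebesgue)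
         ((p - real DIM('a) + 1) / p)"
proof -
  let ?n = "real DIM('a) - 1"
  let ?q = "p / ?n" and ?\<alpha> = "p / (p - real DIM('a) + 1)"
  have n: "?n \<ge> 1" "real (DIM('a) - 1) = ?n" using n2 by (auto simp: of_nat_diff)
  have pos: "p > 0" "p - real DIM('a) + 1 > 0" using p n by auto
  have qa: "?q > 1" "?\<alpha> > 1" "1 / ?q + 1 / ?\<alpha> = 1"
  proof -
    have "?n / p + (p - real DIM('a) + 1) / p = 1" unfolding add_divide_distrib[symmetric] using pos by simp
    then show "1 / ?q + 1 / ?\<alpha> = 1" by simp
  qed (use p n pos in auto)
  let ?f = "\<lambda>x. epowr (epowr (\<rho> x) p / ennreal (Q x)) (1 / ?q) * indicator (D \<inter> annulus x0 \<epsilon> R) x"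
  let ?g = "\<lambda>x. ennreal (Q x powr (1 / ?q)) * \<eta> (dist x x0) * indicator (annulus x0 \<epsilon> R) x"
  have fpow: "epowr (?f x) ?q = epowr (\<rho> x) p / ennreal (Q x) * indicator (D \<inter> annulus x0 \<epsilon> R) x" for x
    using qa by (cases "x \<in> D \<inter> annulus x0 \<epsilon> R") (auto simp: epowr_epowr simp del: times_divide_eq_right divide_divide_eq_right)
  have gpow: "epowr (?g x) ?\<alpha> = ennreal (Q x powr (?n / (p - real DIM('a) + 1))) * epowr (\<eta> (dist x x0)) ?\<alpha> * indicator (annulus x0 \<epsilon> R) x" for x
  proof -
    have "1 / (p / a) * (p / b) = a / b" for a b :: real using pos by simp
    then have "1 / ?q * ?\<alpha> = ?n / (p - real DIM('a) + 1)" .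
    then show ?thesis
      by (cases "x \<in> annulus x0 \<epsilon> R") (auto simp: epowr_mult powr_powr simp del: times_divide_eq_right divide_divide_eq_right)
  qed
  have fg: "?f x * ?g x = \<rho> x ^ (DIM('a) - 1) * \<eta> (dist x x0) * indicator (D \<inter> annulus x0 \<epsilon> R) x" for x
  proof (cases "x \<in> D \<inter> annulus x0 \<epsilon> R")
    case True
    have "epowr (epowr (\<rho> x) p / ennreal (Q x)) (1 / ?q) = epowr (epowr (\<rho> x) p) (1 / ?q) * epowr (ennreal (1 / Q x)) (1 / ?q)"
      using Q[of x] by (simp add: divide_ennreal_def epowr_mult inverse_ennreal inverse_eq_divide del: epowr_ennreal)
    also have "epowr (epowr (\<rho> x) p) (1 / ?q) = \<rho> x ^ (DIM('a) - 1)"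
    proof -
      have "epowr (epowr (\<rho> x) p) (1 / ?q) = epowr (\<rho> x) (real (DIM('a) - 1))"
        using pos n by (simp add: epowr_epowr)
      also have "\<dots> = \<rho> x ^ (DIM('a) - 1)" using n2 by (intro epowr_power) simp
      finally show ?thesis .
    qed
    finally have "?f x * ?g x = \<rho> x ^ (DIM('a) - 1) * \<eta> (dist x x0) * (epowr (ennreal (1 / Q x)) (1 / ?q) * ennreal (Q x powr (1 / ?q)))"
      using True by (simp add: mult_ac)
    also have "epowr (ennreal (1 / Q x)) (1 / ?q) * ennreal (Q x powr (1 / ?q)) = 1"
      using Q[of x] by (simp add: ennreal_mult'[symmetric] powr_divide)
    finally show ?thesis using True by simp
  qed auto
  have m[measurable]: "(\<lambda>x. dist x x0) \<in> borel_measurable lebesgue" "\<rho> \<in> borel_measurable lebesgue"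
    "D \<in> sets lebesgue" "annulus x0 \<epsilon> R \<in> sets lebesgue"
    using D by (auto intro!: measurable_completion)
  have fm: "?f \<in> borel_measurable lebesgue" by measurable
  have gm: "?g \<in> borel_measurable lebesgue" by measurable
  have "(\<integral>\<^sup>+x. \<rho> x ^ (DIM('a) - 1) * \<eta> (dist x x0) * indicator (D \<inter> annulus x0 \<epsilon> R) x \<partial>lborel)
     = (\<integral>\<^sup>+x. \<rho> x ^ (DIM('a) - 1) * \<eta> (dist x x0) * indicator (D \<inter> annulus x0 \<epsilon> R) x \<partial>lebesgue)"
    by (rule nn_integral_completion[symmetric]) measurable
  also have "\<dots> = (\<integral>\<^sup>+x. ?f x * ?g x \<partial>lebesgue)" by (simp only: fg)
  also have "\<dots> \<le> epowr (\<integral>\<^sup>+x. epowr (?f x) ?q \<partial>lebesgue) (1 / ?q) * epowr (\<integral>\<^sup>+x. epowr (?g x) ?\<alpha> \<partial>lebesgue) (1 / ?\<alpha>)"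
    by (rule Hoelder_inequality_nn[OF qa fm gm])
  finally show ?thesis unfolding fpow gpow by simp
qed

text \<open>The preceding inequalities with \<open>Q\<close> and \<open>\<eta>\<close> equal to 1
  bound the length of the set of exceptional radii by a power of the energy of any density
  admissible for \<open>\<Sigma>0\<close>, and this energy can be arbitrarily small.\<close>

lemma exceptional_radii_null:
  assumes \<Sigma>0: "surf_modulus p \<Sigma>0 = 0"
  shows "\<exists>N\<in>null_sets lborel. \<forall>r\<in>{\<epsilon><..<R}. sphere x0 r \<inter> D \<in> \<Sigma>0 \<longrightarrow> r \<in> N"
proof -
  let ?n = "real DIM('a) - 1"
  have n: "?n \<ge> 1" using n2 by auto
  have pos: "p > 0" "p - real DIM('a) + 1 > 0" using p n by auto
  have "(\<integral>\<^sup>+x. ennreal (1 powr (?n / (p - real DIM('a) + 1))) * epowr 1 (p / (p - real DIM('a) + 1)) * indicator (annulus x0 \<epsilon> R) x \<partial>lebesgue)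
    = emeasure lborel (annulus x0 \<epsilon> R)" by simp
  moreover have "emeasure lborel (annulus x0 \<epsilon> R) < top"
  proof -
    have "bounded (annulus x0 \<epsilon> R)"
      by (rule bounded_subset[OF bounded_ball[of x0 R]]) (auto simp: annulus_def dist_commute)
    from emeasure_bounded_finite[OF this] show ?thesis by simp
  qed
  ultimately have "epowr (\<integral>\<^sup>+x. ennreal (1 powr (?n / (p - real DIM('a) + 1))) * epowr 1 (p / (p - real DIM('a) + 1)) * indicator (annulus x0 \<epsilon> R) x \<partial>lebesgue)
     ((p - real DIM('a) + 1) / p) < top" (is "?X < top") by (simp add: less_top[symmetric])
  then obtain V where V: "V \<ge> 0" "?X = ennreal V" by (cases ?X) auto
  have ex: "\<exists>B\<in>sets borel. (\<forall>r\<in>{\<epsilon><..<R}. sphere x0 r \<inter> D \<in> \<Sigma>0 \<longrightarrow> r \<in> B) \<and> emeasure lborel B \<le> ennreal e"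
    if e: "e > 0" for e
  proof -
    \<comment> \<open>Solves \<open>c * d powr (?n / p) * (V + 1) = e\<close>, where
      \<open>V\<close> is the Hoelder factor of the annulus; the added 1 excludes division by
      zero.\<close>
    define d where "d = (e / (c * (V + 1))) powr (p / ?n)"
    have d: "d > 0" unfolding d_def using e V c(1) by simp
    have dp: "d powr (?n / p) = e / (c * (V + 1))"
      unfolding d_def using e V c(1) n pos by (simp add: powr_powr)
    have "surf_modulus p \<Sigma>0 < ennreal d" using \<Sigma>0 d by simp
    then obtain \<rho> where \<rho>: "\<rho> \<in> surf_adm \<Sigma>0" "(\<integral>\<^sup>+x. epowr (\<rho> x) p \<partial>lebesgue) < ennreal d"
      unfolding surf_modulus_def INF_less_iff by blast
    have [measurable]: "\<rho> \<in> borel_measurable borel" using \<rho>(1) by (simp add: surf_adm_def)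
    let ?h = "\<lambda>r. indicator {\<epsilon><..<R} r * surf_integral \<rho> (sphere x0 r \<inter> D)"
    have hm [measurable]: "?h \<in> borel_measurable borel"
      unfolding surf_integral_sphere_eq using \<epsilon>R by (intro borel_measurable_sphere_integral[OF n2 c]) auto
    \<comment> \<open>A Borel set containing the exceptional radii, which need not be measurable
      themselves; Chebyshev's inequality bounds its length.\<close>
    define B where "B = {r. 1 \<le> ?h r}"
    have B[measurable]: "B \<in> sets borel" unfolding B_def by measurable
    have "emeasure lborel B = (\<integral>\<^sup>+r. indicator B r \<partial>lborel)" by simp
    also have "\<dots> \<le> (\<integral>\<^sup>+r. 1 * ?h r \<partial>lborel)"
      by (intro nn_integral_mono) (auto simp: B_def indicator_def)
    also have "\<dots> \<le> ennreal c * (\<integral>\<^sup>+x. \<rho> x ^ (DIM('a) - 1) * 1 * indicator (D \<inter> annulus x0 \<epsilon> R) x \<partial>lborel)"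
      by (rule weighted_surf_integral_le) auto
    also have "\<dots> \<le> ennreal c * (epowr (\<integral>\<^sup>+x. epowr (\<rho> x) p / ennreal 1 * indicator (D \<inter> annulus x0 \<epsilon> R) x \<partial>lebesgue) (?n / p) * ennreal V)"
      unfolding V(2)[symmetric] by (intro mult_left_mono annulus_Hoelder) auto
    also have "\<dots> \<le> ennreal c * (epowr (ennreal d) (?n / p) * ennreal V)"
    proof (intro mult_left_mono mult_right_mono epowr_mono)
      have "(\<integral>\<^sup>+x. epowr (\<rho> x) p / ennreal 1 * indicator (D \<inter> annulus x0 \<epsilon> R) x \<partial>lebesgue) \<le> (\<integral>\<^sup>+x. epowr (\<rho> x) p \<partial>lebesgue)"
      proof (rule nn_integral_mono)
        have "z / ennreal 1 = z" for z using mult_divide_eq_ennreal[of 1 z] by simp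
        then show "epowr (\<rho> x) p / ennreal 1 * indicator (D \<inter> annulus x0 \<epsilon> R) x \<le> epowr (\<rho> x) p" for x
          by (auto simp: indicator_def)
      qed
      then show "(\<integral>\<^sup>+x. epowr (\<rho> x) p / ennreal 1 * indicator (D \<inter> annulus x0 \<epsilon> R) x \<partial>lebesgue) \<le> ennreal d"
        using \<rho>(2) by (meson less_imp_le order_trans)
    qed (use n pos in auto)
    also have "\<dots> = ennreal (c * (e / (c * (V + 1)) * V))"
    proof -
      have "ennreal c * (ennreal a * ennreal V) = ennreal (c * (a * V))" if "a \<ge> 0" for a
        using that V c(1) by (simp add: ennreal_mult)
      moreover have "epowr (ennreal d) (?n / p) = ennreal (e / (c * (V + 1)))" using d dp by simp
      moreover have "e / (c * (V + 1)) \<ge> 0" using e V c(1) by simp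
      ultimately show ?thesis by presburger
    qed
    also have "\<dots> \<le> ennreal e"
    proof (rule ennreal_leI)
      have "c * (e / (c * (V + 1)) * V) = e * (V / (V + 1))" using c(1) by simp
      also have "\<dots> \<le> e * 1" using e V(1) by (intro mult_left_mono) auto
      finally show "c * (e / (c * (V + 1)) * V) \<le> e" by simp
    qed
    finally have "emeasure lborel B \<le> ennreal e" .
    moreover have "r \<in> B" if "r \<in> {\<epsilon><..<R}" "sphere x0 r \<inter> D \<in> \<Sigma>0" for r
      using that \<rho>(1) by (simp add: B_def surf_adm_def)
    ultimately show ?thesis using B by blast
  qed
  have "\<exists>B. B \<in> sets borel \<and> (\<forall>r\<in>{\<epsilon><..<R}. sphere x0 r \<inter> D \<in> \<Sigma>0 \<longrightarrow> r \<in> B) \<and> emeasure lborel B \<le> ennreal (1 / (real k + 1))" for k :: nat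
    using ex[of "1 / (real k + 1)"] by auto
  then obtain B where B: "\<And>k::nat. B k \<in> sets borel" "\<And>k r. r \<in> {\<epsilon><..<R} \<Longrightarrow> sphere x0 r \<inter> D \<in> \<Sigma>0 \<Longrightarrow> r \<in> B k"
    "\<And>k. emeasure lborel (B k) \<le> ennreal (1 / (real k + 1))" by metis
  have Bm: "(\<Inter>k. B k) \<in> sets borel" using B(1) by auto
  have "emeasure lborel (\<Inter>k. B k) \<le> 0"
  proof (rule ennreal_le_epsilon)
    fix e :: real assume "e > 0"
    then obtain k :: nat where k: "1 / (real k + 1) < e"
      using reals_Archimedean[of e] by (auto simp: inverse_eq_divide add.commute)
    have "emeasure lborel (\<Inter>k. B k) \<le> emeasure lborel (B k)" using B(1) by (intro emeasure_mono) auto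
    also have "\<dots> \<le> ennreal (1 / (real k + 1))" by (rule B(3))
    also have "\<dots> \<le> ennreal e" using k by (intro ennreal_leI) auto
    finally show "emeasure lborel (\<Inter>k. B k) \<le> 0 + ennreal e" by simp
  qed
  then have "(\<Inter>k. B k) \<in> null_sets lborel" using Bm by (auto simp: null_sets_def)
  then show ?thesis using B(2) by blast
qed

text \<open>For almost every radius the surface integral of \<open>\<rho>\<close> is at least 1, so
  it can be inserted next to \<open>\<eta>\<close> before the polar and Hoelder inequalities are
  applied.\<close>

lemma ext_adm_lower_bound:
  fixes \<rho> :: "'a \<Rightarrow> ennreal" and \<eta> :: "real \<Rightarrow> ennreal" and Q :: "'a \<Rightarrow> real"
  assumes \<rho>: "\<rho> \<in> ext_adm p {sphere x0 r \<inter> D | r. \<epsilon> < r \<and> r < R}"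
    and \<eta> [measurable]: "\<eta> \<in> borel_measurable borel" and Qm: "Q \<in> borel_measurable lebesgue"
    and Q: "\<And>x. Q x > 0"
  shows "(\<integral>\<^sup>+r. \<eta> r * indicator {\<epsilon><..<R} r \<partial>lborel)
    \<le> ennreal c * (epowr (\<integral>\<^sup>+x. epowr (\<rho> x) p / ennreal (Q x) * indicator (D \<inter> annulus x0 \<epsilon> R) x \<partial>lebesgue) ((real DIM('a) - 1) / p)
      * epowr (\<integral>\<^sup>+x. ennreal (Q x powr ((real DIM('a) - 1) / (p - real DIM('a) + 1)))
           * epowr (\<eta> (dist x x0)) (p / (p - real DIM('a) + 1)) * indicator (annulus x0 \<epsilon> R) x \<partial>lebesgue)
         ((p - real DIM('a) + 1) / p))"
proof -
  define \<Sigma> where "\<Sigma> = {sphere x0 r \<inter> D | r. \<epsilon> < r \<and> r < R}"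
  have "\<rho> \<in> ext_adm p \<Sigma>" using \<rho> by (simp add: \<Sigma>_def)
  then have [measurable]: "\<rho> \<in> borel_measurable borel"
    and "\<exists>\<Sigma>0\<subseteq>\<Sigma>. surf_modulus p \<Sigma>0 = 0 \<and> (\<forall>S\<in>\<Sigma> - \<Sigma>0. surf_integral \<rho> S \<ge> 1)"
    by (simp_all add: ext_adm_def)
  then obtain \<Sigma>0 where \<Sigma>0: "surf_modulus p \<Sigma>0 = 0" "\<And>S. S \<in> \<Sigma> - \<Sigma>0 \<Longrightarrow> surf_integral \<rho> S \<ge> 1"
    by blast
  obtain N where N: "N \<in> null_sets lborel" "\<And>r. r \<in> {\<epsilon><..<R} \<Longrightarrow> sphere x0 r \<inter> D \<in> \<Sigma>0 \<Longrightarrow> r \<in> N"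
    using exceptional_radii_null[OF \<Sigma>0(1)] by blast
  have "(\<integral>\<^sup>+r. \<eta> r * indicator {\<epsilon><..<R} r \<partial>lborel)
      \<le> (\<integral>\<^sup>+r. \<eta> r * (indicator {\<epsilon><..<R} r * surf_integral \<rho> (sphere x0 r \<inter> D)) \<partial>lborel)"
  proof (rule nn_integral_mono_AE)
    show "AE r in lborel. \<eta> r * indicator {\<epsilon><..<R} r \<le> \<eta> r * (indicator {\<epsilon><..<R} r * surf_integral \<rho> (sphere x0 r \<inter> D))"
      using AE_not_in[OF N(1)]
    proof eventually_elim
      case (elim r)
      show ?case
      proof (cases "r \<in> {\<epsilon><..<R}")
        case True
        then have "sphere x0 r \<inter> D \<in> \<Sigma> - \<Sigma>0" using N(2)[OF True] elim unfolding \<Sigma>_def by auto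
        from \<Sigma>0(2)[OF this] have "\<eta> r * 1 \<le> \<eta> r * surf_integral \<rho> (sphere x0 r \<inter> D)" by (rule mult_left_mono) simp
        then show ?thesis using True by simp
      qed simp
    qed
  qed
  also have "\<dots> \<le> ennreal c * (\<integral>\<^sup>+x. \<rho> x ^ (DIM('a) - 1) * \<eta> (dist x x0) * indicator (D \<inter> annulus x0 \<epsilon> R) x \<partial>lborel)"
    by (rule weighted_surf_integral_le) auto
  also have "\<dots> \<le> ennreal c * (epowr (\<integral>\<^sup>+x. epowr (\<rho> x) p / ennreal (Q x) * indicator (D \<inter> annulus x0 \<epsilon> R) x \<partial>lebesgue) ((real DIM('a) - 1) / p)
      * epowr (\<integral>\<^sup>+x. ennreal (Q x powr ((real DIM('a) - 1) / (p - real DIM('a) + 1)))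
           * epowr (\<eta> (dist x x0)) (p / (p - real DIM('a) + 1)) * indicator (annulus x0 \<epsilon> R) x \<partial>lebesgue)
         ((p - real DIM('a) + 1) / p))"
    by (intro mult_left_mono annulus_Hoelder Qm Q) auto
  finally show ?thesis .
qed

end

subsection \<open>The modulus of an increasing union of path families\<close>

text \<open>The tangent of \<open>z powr r\<close> at 1, read off from Young's inequality for
  \<open>z * 1\<close>; the source of the convexity estimates below.\<close>

lemma Bernoulli_inequality_powr:
  fixes z r :: real
  assumes "z \<ge> 0" "r \<ge> 1"
  shows "1 + r * (z - 1) \<le> z powr r"
proof (cases "r = 1")
  case False
  then have r: "r > 1" using assms by simp
  have "z * 1 \<le> z powr r / r + 1 powr (r / (r - 1)) / (r / (r - 1))"
    using r assms by (intro Youngs_inequality) (auto simp: field_simps)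
  then have "r * z \<le> r * (z powr r / r + (r - 1) / r)" using r by (intro mult_left_mono) auto
  also have "\<dots> = z powr r + (r - 1)" using r by (simp add: distrib_left)
  finally show ?thesis by (simp add: algebra_simps)
qed (use assms in auto)

text \<open>In the tangent inequalities at \<open>x / m\<close> and \<open>y / m\<close>, with
  \<open>m\<close> the mean, the linear terms cancel.\<close>

lemma powr_midpoint_le:
  fixes x y r :: real
  assumes "x \<ge> 0" "y \<ge> 0" "r \<ge> 1"
  shows "((x + y) / 2) powr r \<le> (x powr r + y powr r) / 2"
proof (cases "x + y = 0")
  case False
  define m where "m = (x + y) / 2"
  have m: "m > 0" using False assms by (simp add: m_def)
  have "1 + r * (x / m - 1) \<le> (x / m) powr r" "1 + r * (y / m - 1) \<le> (y / m) powr r"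
    using assms m by (auto intro!: Bernoulli_inequality_powr)
  note * = this
  have s: "x + y = 2 * m" by (simp add: m_def)
  have "x / m + y / m = 2" unfolding add_divide_distrib[symmetric] s using m by simp
  moreover have "r * (x / m - 1) + r * (y / m - 1) = r * (x / m + y / m - 2)"
    by (simp add: right_diff_distrib distrib_left)
  ultimately have "r * (x / m - 1) + r * (y / m - 1) = 0" by simp
  with * have "2 \<le> (x / m) powr r + (y / m) powr r" by linarith
  also have "\<dots> = (x powr r + y powr r) / m powr r" using assms m by (simp add: powr_divide add_divide_distrib)
  finally have "2 * m powr r \<le> x powr r + y powr r" using m by (simp add: pos_le_divide_eq)
  then show ?thesis by (simp add: m_def)
qed (use assms in auto)

lemma powr_sum_le:
  fixes x y r :: real
  assumes "x \<ge> 0" "y \<ge> 0" "r \<ge> 1"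
  shows "x powr r + y powr r \<le> (x + y) powr r"
proof (cases "x + y = 0")
  case False
  define S where "S = x + y"
  have S: "S > 0" using False assms by (simp add: S_def)
  have le: "(z / S) powr r \<le> z / S" if "0 \<le> z" "z \<le> S" for z
    using powr_mono'[of 1 r "z / S"] that assms S by (cases "z = 0") auto
  have "(x powr r + y powr r) / S powr r = (x / S) powr r + (y / S) powr r"
    using assms S by (simp add: powr_divide add_divide_distrib)
  also have "\<dots> \<le> x / S + y / S" using assms by (intro add_mono le) (auto simp: S_def)
  also have "\<dots> = 1" using S by (simp add: S_def flip: add_divide_distrib)
  finally show ?thesis using S by (simp add: S_def)
qed (use assms in \<open>auto simp: add_nonneg_eq_0_iff\<close>)

text \<open>With the exponent \<open>r / 2 \<ge> 1\<close> applied to squares: superadditivity of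
  the power, the parallelogram identity and convexity of the power, in this order.\<close>

lemma Clarkson_inequality_powr:
  fixes a b r :: real
  assumes ab: "0 \<le> a" "0 \<le> b" and r: "r \<ge> 2"
  shows "(\<bar>b - a\<bar> / 2) powr r + ((a + b) / 2) powr r \<le> (a powr r + b powr r) / 2"
proof -
  have sq: "x powr r = (x\<^sup>2) powr (r / 2)" if "0 \<le> x" for x :: real
    using that by (simp add: powr_powr flip: powr_numeral)
  have "(\<bar>b - a\<bar> / 2) powr r + ((a + b) / 2) powr r = ((\<bar>b - a\<bar> / 2)\<^sup>2) powr (r / 2) + (((a + b) / 2)\<^sup>2) powr (r / 2)"
    using ab by (simp add: sq)
  also have "\<dots> \<le> ((\<bar>b - a\<bar> / 2)\<^sup>2 + ((a + b) / 2)\<^sup>2) powr (r / 2)" using r by (intro powr_sum_le) auto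
  also have "(\<bar>b - a\<bar> / 2)\<^sup>2 + ((a + b) / 2)\<^sup>2 = (a\<^sup>2 + b\<^sup>2) / 2"
    by (simp add: power_divide power2_eq_square field_simps)
  also have "((a\<^sup>2 + b\<^sup>2) / 2) powr (r / 2) \<le> ((a\<^sup>2) powr (r / 2) + (b\<^sup>2) powr (r / 2)) / 2"
    using r by (intro powr_midpoint_le) auto
  also have "\<dots> = (a powr r + b powr r) / 2" using ab by (simp add: sq)
  finally show ?thesis .
qed

lemma ennreal_midpoint:
  assumes "0 \<le> a" "0 \<le> b"
  shows "ennreal (1/2) * ennreal a + ennreal (1/2) * ennreal b = ennreal ((a + b) / 2)"
proof -
  have "ennreal (1/2) * ennreal a + ennreal (1/2) * ennreal b = ennreal (1/2 * a) + ennreal (1/2 * b)"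
    by (intro arg_cong2[of _ _ _ _ "(+)"] ennreal_mult'[symmetric]) auto
  also have "\<dots> = ennreal (1/2 * a + 1/2 * b)" using assms by (intro ennreal_plus[symmetric]) auto
  also have "1/2 * a + 1/2 * b = (a + b) / 2" by (simp add: add_divide_distrib)
  finally show ?thesis .
qed

text \<open>Subtraction is truncated, so \<open>y - x\<close> is the positive part; it is this part
  that controls the growth of a sequence of densities.\<close>

lemma Clarkson_inequality_epowr:
  assumes r: "r \<ge> 2"
  shows "epowr (ennreal (1/2) * (y - x)) r + epowr (ennreal (1/2) * x + ennreal (1/2) * y) r
    \<le> ennreal (1/2) * epowr x r + ennreal (1/2) * epowr y r"
proof (cases "x = top \<or> y = top")
  case True
  then show ?thesis by (auto simp: ennreal_mult_top)
next
  case False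
  then obtain a b where ab: "0 \<le> a" "x = ennreal a" "0 \<le> b" "y = ennreal b" by (metis ennreal_cases)
  have "epowr (ennreal (1/2) * (y - x)) r \<le> ennreal ((\<bar>b - a\<bar> / 2) powr r)"
  proof -
    have "ennreal (1/2) * (y - x) = ennreal ((1/2) * (b - a))"
      using ab by (simp only: ennreal_minus) (rule ennreal_mult'[symmetric], simp)
    also have "\<dots> \<le> ennreal (\<bar>b - a\<bar> / 2)" using abs_ge_self[of "b - a"] by (intro ennreal_leI) simp
    finally have "epowr (ennreal (1/2) * (y - x)) r \<le> epowr (ennreal (\<bar>b - a\<bar> / 2)) r"
      using r by (intro epowr_mono) auto
    then show ?thesis by simp
  qed
  moreover have "epowr (ennreal (1/2) * x + ennreal (1/2) * y) r = ennreal (((a + b) / 2) powr r)"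
  proof -
    have "ennreal (1/2) * x + ennreal (1/2) * y = ennreal ((a + b) / 2)"
      using ab by (simp only: ennreal_midpoint)
    then show ?thesis using ab by simp
  qed
  ultimately have "epowr (ennreal (1/2) * (y - x)) r + epowr (ennreal (1/2) * x + ennreal (1/2) * y) r
      \<le> ennreal ((\<bar>b - a\<bar> / 2) powr r) + ennreal (((a + b) / 2) powr r)" by (simp add: add_mono)
  also have "\<dots> = ennreal ((\<bar>b - a\<bar> / 2) powr r + ((a + b) / 2) powr r)" by simp
  also have "\<dots> \<le> ennreal ((a powr r + b powr r) / 2)"
    using Clarkson_inequality_powr[OF ab(1,3) r] by (rule ennreal_leI)
  also have "\<dots> = ennreal (1/2) * epowr x r + ennreal (1/2) * epowr y r"
    using ab by (simp only: ennreal_midpoint epowr_ennreal powr_ge_zero)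
  finally show ?thesis .
qed

text \<open>One summand dominates, depending on whether \<open>b \<le> \<zeta> * a\<close>. A small
  perturbation \<open>b\<close> is thus absorbed at the price of a factor close to 1 on
  \<open>a\<close>.\<close>

lemma epowr_add_le:
  assumes q: "q \<ge> 0" and \<zeta>: "\<zeta> > 0"
  shows "epowr (a + b) q \<le> ennreal ((1 + \<zeta>) powr q) * epowr a q + ennreal ((1 + 1 / \<zeta>) powr q) * epowr b q"
proof -
  have *: "epowr (a + b) q \<le> ennreal ((1 + t) powr q) * epowr a q" if "b \<le> ennreal t * a" "t > 0" for a b t
  proof -
    have "a + b \<le> ennreal (1 + t) * a" using that by (simp add: distrib_right add_left_mono)
    then have "epowr (a + b) q \<le> epowr (ennreal (1 + t) * a) q" using q by (intro epowr_mono)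
    also have "\<dots> = ennreal ((1 + t) powr q) * epowr a q" using that by (simp add: epowr_mult del: ennreal_plus)
    finally show ?thesis .
  qed
  show ?thesis
  proof (cases "b \<le> ennreal \<zeta> * a")
    case True
    from *[OF this \<zeta>] show ?thesis by (rule order_trans) simp
  next
    case False
    then have "ennreal (1 / \<zeta>) * (ennreal \<zeta> * a) \<le> ennreal (1 / \<zeta>) * b"
      by (intro mult_left_mono) auto
    then have "a \<le> ennreal (1 / \<zeta>) * b" using \<zeta> by (subst (asm) ennreal_mult_cancel_inverse) auto
    from *[OF this] \<zeta> have "epowr (b + a) q \<le> ennreal ((1 + 1 / \<zeta>) powr q) * epowr b q" by simp
    then show ?thesis by (subst add.commute) (rule order_trans, auto)
  qed
qed

lemma path_adm_convex:
  assumes "\<rho> \<in> path_adm \<Gamma>" "\<sigma> \<in> path_adm \<Gamma>" "0 \<le> a" "0 \<le> b" "a + b = 1"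
  shows "(\<lambda>x. ennreal a * \<rho> x + ennreal b * \<sigma> x) \<in> path_adm \<Gamma>"
proof -
  have [measurable]: "\<rho> \<in> borel_measurable borel" "\<sigma> \<in> borel_measurable borel"
    using assms by (auto simp: path_adm_def)
  have "1 \<le> line_integral (\<lambda>x. ennreal a * \<rho> x + ennreal b * \<sigma> x) g" if g: "g \<in> \<Gamma>" "rectifiable_path g" for g
  proof -
    have "1 = ennreal a * 1 + ennreal b * 1" using assms by (simp flip: ennreal_plus)
    also have "\<dots> \<le> ennreal a * line_integral \<rho> g + ennreal b * line_integral \<sigma> g"
      using assms g by (intro add_mono mult_left_mono) (auto simp: path_adm_def)
    also have "\<dots> = line_integral (\<lambda>x. ennreal a * \<rho> x + ennreal b * \<sigma> x) g"
      using g by (intro line_integral_linear[symmetric]) (auto simp: rectifiable_path_def)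
    finally show ?thesis .
  qed
  then show ?thesis by (auto simp: path_adm_def)
qed

lemma path_adm_subset: "\<Gamma> \<subseteq> \<Gamma>' \<Longrightarrow> path_adm \<Gamma>' \<subseteq> path_adm \<Gamma>"
  by (auto simp: path_adm_def)

lemma path_modulus_le: "\<rho> \<in> path_adm \<Gamma> \<Longrightarrow> path_modulus \<alpha> \<Gamma> \<le> (\<integral>\<^sup>+x. epowr (\<rho> x) \<alpha> \<partial>lebesgue)"
  unfolding path_modulus_def by (rule INF_lower)

lemma path_modulus_mono: "\<Gamma> \<subseteq> \<Gamma>' \<Longrightarrow> path_modulus \<alpha> \<Gamma> \<le> path_modulus \<alpha> \<Gamma>'"
  unfolding path_modulus_def by (rule INF_superset_mono) (auto dest: path_adm_subset)

text \<open>By uniform convexity nearly extremal densities of the families \<open>\<Gamma> k\<close> are close to each other,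
  so that their pointwise supremum is hardly larger than any of them.\<close>

lemma path_modulus_UN_le:
  fixes \<Gamma> :: "nat \<Rightarrow> (real \<Rightarrow> 'a::euclidean_space) set"
  assumes \<alpha>: "\<alpha> \<ge> 2" and inc: "incseq \<Gamma>" and bound: "\<And>k. path_modulus \<alpha> (\<Gamma> k) \<le> ennreal B"
  shows "path_modulus \<alpha> (\<Union>k. \<Gamma> k) \<le> ennreal B"
proof -
  let ?m = "\<lambda>k. path_modulus \<alpha> (\<Gamma> k)"
  define L where "L = (SUP k. ?m k)"
  have LB: "L \<le> ennreal B" unfolding L_def using bound by (rule SUP_least)
  have Lfin: "L < top" using LB by (rule order_le_less_trans) simp
  have "path_modulus \<alpha> (\<Union>k. \<Gamma> k) \<le> ennreal ((1 + \<zeta>) powr \<alpha>) * (L + ennreal \<zeta>) + ennreal \<zeta>"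
    if \<zeta>: "0 < \<zeta>" for \<zeta> :: real
  proof -
    \<comment> \<open>The energy allowed for the correction \<open>\<tau>\<close>; the second factor
      of \<open>epowr_add_le\<close> turns it into exactly \<open>\<zeta>\<close>.\<close>
    define \<beta> where "\<beta> = \<zeta> / (1 + 1 / \<zeta>) powr \<alpha>"
    have "1 + 1 / \<zeta> > 0" using \<zeta> by (simp add: add_pos_pos)
    then have \<zeta>pos: "(1 + 1 / \<zeta>) powr \<alpha> > 0" unfolding powr_gt_zero by linarith
    have \<beta>: "\<beta> > 0" unfolding \<beta>_def using \<zeta> \<zeta>pos by (rule divide_pos_pos)
    \<comment> \<open>Tolerance for the \<open>j\<close>-th density. The increment will have energy
      at most \<open>2 powr \<alpha> * (2 * d j)\<close>, and the weight \<open>2 ^ Suc j\<close> in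
      \<open>\<tau>\<close> multiplies this by \<open>(2 ^ Suc j) powr \<alpha>\<close>; what
      remains is at most \<open>\<beta> * (1/2) ^ Suc j\<close>, which sums to
      \<open>\<beta>\<close>. The minimum with \<open>\<zeta>\<close> controls the energy of
      \<open>\<rho> 0\<close>.\<close>
    define d where "d j = min \<zeta> (\<beta> * (1/2) ^ Suc j / (2 * 2 powr (real (j + 2) * \<alpha>)))" for j :: nat
    have d: "d j > 0" "d j \<le> \<zeta>" for j using \<beta> \<zeta> by (auto simp: d_def)
    have dmono: "d (Suc j) \<le> d j" for j
    proof -
      have "2 powr (real (j + 2) * \<alpha>) \<le> 2 powr (real (Suc j + 2) * \<alpha>)" using \<alpha> by (intro powr_mono mult_right_mono) auto
      then have "\<beta> * (1/2) ^ Suc (Suc j) / (2 * 2 powr (real (Suc j + 2) * \<alpha>)) \<le> \<beta> * (1/2) ^ Suc j / (2 * 2 powr (real (j + 2) * \<alpha>))"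
        using \<beta> by (intro frac_le) auto
      then show ?thesis unfolding d_def by (intro min.mono order_refl)
    qed
    have "\<exists>k. L \<le> ?m k + ennreal (d j)" for j
    proof (cases "L = 0")
      case False
      then have "L - ennreal (d j) < L" using d[of j] Lfin by (auto intro!: ennreal_between simp: zero_less_iff_neq_zero)
      then obtain k where "L - ennreal (d j) < ?m k" unfolding L_def less_SUP_iff by blast
      then have "L - ennreal (d j) \<le> ?m k" by (rule less_imp_le)
      then have "L \<le> ?m k + ennreal (d j)" using Lfin by (simp add: ennreal_minus_le_iff add.commute)
      then show ?thesis by blast
    qed auto
    then obtain K where K: "\<And>j. L \<le> ?m (K j) + ennreal (d j)" by metis
    \<comment> \<open>Summing makes the indices increasing, and the added \<open>j\<close> makes the
      families \<open>\<Gamma> (k j)\<close> exhaust the union.\<close>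
    define k where "k j = (\<Sum>i\<le>j. K i) + j" for j
    have kK: "K j \<le> k j" "j \<le> k j" "k j \<le> k (Suc j)" for j
      unfolding k_def by (auto intro: trans_le_add1 member_le_sum)
    have mk: "L \<le> ?m (k j) + ennreal (d j)" for j
    proof -
      have "?m (K j) \<le> ?m (k j)" using kK(1)[of j] inc by (intro path_modulus_mono) (auto simp: incseq_def)
      then show ?thesis using K[of j] by (meson add_right_mono order_trans)
    qed
    have mL: "?m i \<le> L" for i unfolding L_def by (rule SUP_upper) simp
    have "\<exists>\<rho>. \<rho> \<in> path_adm (\<Gamma> (k j)) \<and> (\<integral>\<^sup>+x. epowr (\<rho> x) \<alpha> \<partial>lebesgue) \<le> L + ennreal (d j)" for j
    proof -
      have "?m (k j) < L + ennreal (d j)"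
      proof (rule order_le_less_trans[OF mL])
        show "L < L + ennreal (d j)" using Lfin d[of j] by (simp add: less_top[symmetric])
      qed
      then show ?thesis unfolding path_modulus_def INF_less_iff by (meson less_imp_le)
    qed
    then obtain \<rho> where \<rho>: "\<And>j. \<rho> j \<in> path_adm (\<Gamma> (k j))"
        "\<And>j. (\<integral>\<^sup>+x. epowr (\<rho> j x) \<alpha> \<partial>lebesgue) \<le> L + ennreal (d j)" by metis
    have \<rho>m [measurable]: "\<rho> j \<in> borel_measurable borel" for j using \<rho>(1)[of j] by (simp add: path_adm_def)
    have \<rho>l [measurable]: "\<rho> j \<in> borel_measurable lebesgue" for j by (rule measurable_completion) simp
    have diff: "(\<integral>\<^sup>+x. epowr (\<rho> (Suc j) x - \<rho> j x) \<alpha> \<partial>lebesgue) \<le> ennreal (2 powr \<alpha> * (2 * d j))" for j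
    proof -
      let ?D = "\<integral>\<^sup>+x. epowr (ennreal (1/2) * (\<rho> (Suc j) x - \<rho> j x)) \<alpha> \<partial>lebesgue"
      let ?S = "\<integral>\<^sup>+x. epowr (ennreal (1/2) * \<rho> j x + ennreal (1/2) * \<rho> (Suc j) x) \<alpha> \<partial>lebesgue"
      have "\<Gamma> (k j) \<subseteq> \<Gamma> (k (Suc j))" using kK(3)[of j] inc by (auto simp: incseq_def)
      then have "\<rho> (Suc j) \<in> path_adm (\<Gamma> (k j))" using \<rho>(1)[of "Suc j"] path_adm_subset by blast
      \<comment> \<open>Both densities are admissible for the smaller family, hence so is their
        mean, whose energy is at least the modulus. Clarkson's inequality then leaves only the
        tolerances for the difference.\<close>
      then have mS: "?m (k j) \<le> ?S" using \<rho>(1)[of j] by (intro path_modulus_le path_adm_convex) auto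
      have "?D + ?S = (\<integral>\<^sup>+x. epowr (ennreal (1/2) * (\<rho> (Suc j) x - \<rho> j x)) \<alpha>
            + epowr (ennreal (1/2) * \<rho> j x + ennreal (1/2) * \<rho> (Suc j) x) \<alpha> \<partial>lebesgue)"
        by (rule nn_integral_add[symmetric]) measurable
      also have "\<dots> \<le> (\<integral>\<^sup>+x. ennreal (1/2) * epowr (\<rho> j x) \<alpha> + ennreal (1/2) * epowr (\<rho> (Suc j) x) \<alpha> \<partial>lebesgue)"
        by (intro nn_integral_mono Clarkson_inequality_epowr \<alpha>)
      also have "\<dots> = ennreal (1/2) * (\<integral>\<^sup>+x. epowr (\<rho> j x) \<alpha> \<partial>lebesgue) + ennreal (1/2) * (\<integral>\<^sup>+x. epowr (\<rho> (Suc j) x) \<alpha> \<partial>lebesgue)"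
        by (simp add: nn_integral_add nn_integral_cmult)
      also have "\<dots> \<le> ennreal (1/2) * (L + ennreal (d j)) + ennreal (1/2) * (L + ennreal (d j))"
      proof (intro add_mono mult_left_mono \<rho>(2))
        show "(\<integral>\<^sup>+x. epowr (\<rho> (Suc j) x) \<alpha> \<partial>lebesgue) \<le> L + ennreal (d j)"
          using \<rho>(2)[of "Suc j"] dmono[of j] by (meson add_left_mono ennreal_leI order_trans)
      qed auto
      also have "\<dots> = L + ennreal (d j)"
      proof -
        have h: "ennreal (1/2) + ennreal (1/2) = 1" by (subst ennreal_plus[symmetric]) auto
        show ?thesis unfolding distrib_right[symmetric] h by simp
      qed
      also have "\<dots> \<le> (?m (k j) + ennreal (d j)) + ennreal (d j)" by (intro add_right_mono mk)
      also have "\<dots> = ?m (k j) + ennreal (2 * d j)" using d[of j] by (simp add: add.assoc flip: ennreal_plus)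
      finally have "?D + ?S \<le> ?m (k j) + ennreal (2 * d j)" .
      moreover have "?m (k j) + ?D \<le> ?D + ?S" using add_right_mono[OF mS, of ?D] by (simp only: add.commute)
      ultimately have "?m (k j) + ?D \<le> ?m (k j) + ennreal (2 * d j)" by (rule order_trans[rotated])
      moreover have "?m (k j) < top" using mL Lfin by (rule order_le_less_trans)
      ultimately have D: "?D \<le> ennreal (2 * d j)" by (auto simp only: ennreal_add_left_cancel_le infinity_ennreal_def less_irrefl)
      have "(\<integral>\<^sup>+x. epowr (\<rho> (Suc j) x - \<rho> j x) \<alpha> \<partial>lebesgue)
          = (\<integral>\<^sup>+x. ennreal (2 powr \<alpha>) * epowr (ennreal (1/2) * (\<rho> (Suc j) x - \<rho> j x)) \<alpha> \<partial>lebesgue)"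
      proof (rule nn_integral_cong)
        fix x
        have "\<rho> (Suc j) x - \<rho> j x = ennreal 2 * (ennreal (1/2) * (\<rho> (Suc j) x - \<rho> j x))"
          by (rule ennreal_mult_cancel_inverse[symmetric]) auto
        then have "epowr (\<rho> (Suc j) x - \<rho> j x) \<alpha> = epowr (ennreal 2 * (ennreal (1/2) * (\<rho> (Suc j) x - \<rho> j x))) \<alpha>" by (rule arg_cong)
        also have "\<dots> = ennreal (2 powr \<alpha>) * epowr (ennreal (1/2) * (\<rho> (Suc j) x - \<rho> j x)) \<alpha>"
          by (subst epowr_mult) (simp del: ennreal_numeral)
        finally show "epowr (\<rho> (Suc j) x - \<rho> j x) \<alpha> = ennreal (2 powr \<alpha>) * epowr (ennreal (1/2) * (\<rho> (Suc j) x - \<rho> j x)) \<alpha>" .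
      qed
      also have "\<dots> = ennreal (2 powr \<alpha>) * ?D" by (rule nn_integral_cmult) measurable
      also have "\<dots> \<le> ennreal (2 powr \<alpha>) * ennreal (2 * d j)" by (intro mult_left_mono D) simp
      finally show ?thesis using d[of j] by (simp add: ennreal_mult)
    qed
    \<comment> \<open>One function dominating all increments with geometric weights: the
      \<open>j\<close>-th increment is at most \<open>(1/2) ^ Suc j\<close> times
      \<open>\<tau>\<close>, so \<open>\<rho> 0 + \<tau>\<close> dominates every
      \<open>\<rho> j\<close> and is admissible for all families.\<close>
    define \<tau> where "\<tau> x = (SUP j. ennreal (2 ^ Suc j) * (\<rho> (Suc j) x - \<rho> j x))" for x
    have \<tau>m [measurable]: "\<tau> \<in> borel_measurable borel" unfolding \<tau>_def by measurable
    have step: "\<rho> j x \<le> \<rho> 0 x + ennreal (1 - (1/2) ^ j) * \<tau> x" for j x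
    proof (induction j)
      case (Suc j)
      have "ennreal (2 ^ Suc j) * (\<rho> (Suc j) x - \<rho> j x) \<le> \<tau> x" unfolding \<tau>_def by (rule SUP_upper) simp
      then have "ennreal ((1/2) ^ Suc j) * (ennreal (2 ^ Suc j) * (\<rho> (Suc j) x - \<rho> j x)) \<le> ennreal ((1/2) ^ Suc j) * \<tau> x"
        by (rule mult_left_mono) simp
      moreover have "ennreal ((1/2) ^ Suc j) * (ennreal (2 ^ Suc j) * (\<rho> (Suc j) x - \<rho> j x)) = \<rho> (Suc j) x - \<rho> j x"
        by (rule ennreal_mult_cancel_inverse) (auto simp flip: power_mult_distrib)
      ultimately have 1: "\<rho> (Suc j) x - \<rho> j x \<le> ennreal ((1/2) ^ Suc j) * \<tau> x" by simp
      have "\<rho> (Suc j) x \<le> \<rho> j x + (\<rho> (Suc j) x - \<rho> j x)"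
        using ennreal_minus_le_iff[of "\<rho> (Suc j) x" "\<rho> j x" "\<rho> (Suc j) x - \<rho> j x"] by simp
      also have "\<dots> \<le> (\<rho> 0 x + ennreal (1 - (1/2) ^ j) * \<tau> x) + ennreal ((1/2) ^ Suc j) * \<tau> x"
        by (intro add_mono Suc 1)
      also have "\<dots> = \<rho> 0 x + (ennreal (1 - (1/2) ^ j) + ennreal ((1/2) ^ Suc j)) * \<tau> x"
        by (simp add: distrib_right add.assoc)
      also have "ennreal (1 - (1/2) ^ j) + ennreal ((1/2) ^ Suc j) = ennreal (1 - (1/2) ^ Suc j)"
        by (subst ennreal_plus[symmetric]) (auto simp: power_le_one)
      finally show ?case .
    qed simp
    have le: "\<rho> j x \<le> \<rho> 0 x + \<tau> x" for j x
    proof -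
      have "ennreal (1 - (1/2) ^ j) * \<tau> x \<le> 1 * \<tau> x" by (intro mult_right_mono) (auto simp: ennreal_le_1)
      then show ?thesis using step[of j x] by (simp, meson add_left_mono order_trans)
    qed
    have adm: "(\<lambda>x. \<rho> 0 x + \<tau> x) \<in> path_adm (\<Union>k. \<Gamma> k)"
    proof -
      have "1 \<le> line_integral (\<lambda>x. \<rho> 0 x + \<tau> x) g" if g: "g \<in> \<Gamma> j" "rectifiable_path g" for g j
      proof -
        have "g \<in> \<Gamma> (k j)" using g(1) kK(2)[of j] inc by (auto simp: incseq_def)
        then have "1 \<le> line_integral (\<rho> j) g" using \<rho>(1)[of j] g(2) by (auto simp: path_adm_def)
        also have "\<dots> \<le> line_integral (\<lambda>x. \<rho> 0 x + \<tau> x) g" using le by (rule line_integral_mono)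
        finally show ?thesis .
      qed
      then show ?thesis by (auto simp: path_adm_def)
    qed
    have \<tau>int: "(\<integral>\<^sup>+x. epowr (\<tau> x) \<alpha> \<partial>lebesgue) \<le> ennreal \<beta>"
    proof -
      have "epowr (\<tau> x) \<alpha> \<le> (\<Sum>j. epowr (ennreal (2 ^ Suc j) * (\<rho> (Suc j) x - \<rho> j x)) \<alpha>)" (is "_ \<le> ?s") for x
      proof -
        have "\<tau> x \<le> epowr ?s (1 / \<alpha>)"
          unfolding \<tau>_def
        proof (rule SUP_least)
          fix j
          have "epowr (ennreal (2 ^ Suc j) * (\<rho> (Suc j) x - \<rho> j x)) \<alpha> \<le> ?s"
            by (rule ennreal_suminf_bound_add[of _ 0, simplified] sum_le_suminf[of _ "{j}", simplified]) auto
          then have "epowr (epowr (ennreal (2 ^ Suc j) * (\<rho> (Suc j) x - \<rho> j x)) \<alpha>) (1 / \<alpha>) \<le> epowr ?s (1 / \<alpha>)"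
            using \<alpha> by (intro epowr_mono) auto
          then show "ennreal (2 ^ Suc j) * (\<rho> (Suc j) x - \<rho> j x) \<le> epowr ?s (1 / \<alpha>)"
            using \<alpha> by (simp add: epowr_epowr)
        qed
        then have "epowr (\<tau> x) \<alpha> \<le> epowr (epowr ?s (1 / \<alpha>)) \<alpha>" using \<alpha> by (intro epowr_mono) auto
        then show ?thesis using \<alpha> by (simp add: epowr_epowr)
      qed
      then have "(\<integral>\<^sup>+x. epowr (\<tau> x) \<alpha> \<partial>lebesgue)
          \<le> (\<integral>\<^sup>+x. (\<Sum>j. epowr (ennreal (2 ^ Suc j) * (\<rho> (Suc j) x - \<rho> j x)) \<alpha>) \<partial>lebesgue)"
        by (rule nn_integral_mono)
      also have "\<dots> = (\<Sum>j. \<integral>\<^sup>+x. epowr (ennreal (2 ^ Suc j) * (\<rho> (Suc j) x - \<rho> j x)) \<alpha> \<partial>lebesgue)"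
        by (rule nn_integral_suminf) measurable
      also have "\<dots> \<le> (\<Sum>j. ennreal (\<beta> * (1/2) ^ Suc j))"
      proof (rule suminf_le)
        fix j
        have "(\<integral>\<^sup>+x. epowr (ennreal (2 ^ Suc j) * (\<rho> (Suc j) x - \<rho> j x)) \<alpha> \<partial>lebesgue)
            = (\<integral>\<^sup>+x. ennreal ((2 ^ Suc j) powr \<alpha>) * epowr (\<rho> (Suc j) x - \<rho> j x) \<alpha> \<partial>lebesgue)"
          by (simp only: epowr_mult epowr_ennreal zero_le_power zero_le_numeral)
        also have "\<dots> = ennreal ((2 ^ Suc j) powr \<alpha>) * (\<integral>\<^sup>+x. epowr (\<rho> (Suc j) x - \<rho> j x) \<alpha> \<partial>lebesgue)"
          by (rule nn_integral_cmult) measurable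
        also have "\<dots> \<le> ennreal ((2 ^ Suc j) powr \<alpha>) * ennreal (2 powr \<alpha> * (2 * d j))"
          by (intro mult_left_mono diff) simp
        also have "\<dots> = ennreal (2 powr (real (j + 2) * \<alpha>) * (2 * d j))"
        proof -
          have "(2 ^ Suc j) powr \<alpha> * 2 powr \<alpha> = 2 powr (real (j + 2) * \<alpha>)"
          proof -
            have "(2::real) ^ Suc j = 2 powr real (Suc j)" by (rule powr_realpow[symmetric]) simp
            then have "((2::real) ^ Suc j) powr \<alpha> * 2 powr \<alpha> = 2 powr (real (Suc j) * \<alpha> + \<alpha>)"
              by (simp only: powr_powr powr_add)
            also have "real (Suc j) * \<alpha> + \<alpha> = real (j + 2) * \<alpha>" by (simp add: algebra_simps)
            finally show ?thesis .
          qed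
          then show ?thesis using d[of j] by (simp add: ennreal_mult'[symmetric] mult.assoc[symmetric])
        qed
        also have "\<dots> \<le> ennreal (2 powr (real (j + 2) * \<alpha>) * (2 * (\<beta> * (1/2) ^ Suc j / (2 * 2 powr (real (j + 2) * \<alpha>)))))"
          unfolding d_def by (intro ennreal_leI mult_left_mono) auto
        also have "2 powr (real (j + 2) * \<alpha>) * (2 * (\<beta> * (1/2) ^ Suc j / (2 * 2 powr (real (j + 2) * \<alpha>)))) = \<beta> * (1/2) ^ Suc j"
          by simp
        finally show "(\<integral>\<^sup>+x. epowr (ennreal (2 ^ Suc j) * (\<rho> (Suc j) x - \<rho> j x)) \<alpha> \<partial>lebesgue) \<le> ennreal (\<beta> * (1/2) ^ Suc j)" .
      qed auto
      also have "\<dots> = ennreal \<beta>"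
        using \<beta> sums_mult[OF power_half_series, of \<beta>] by (intro suminf_ennreal_eq) auto
      finally show ?thesis .
    qed
    have "path_modulus \<alpha> (\<Union>k. \<Gamma> k) \<le> (\<integral>\<^sup>+x. epowr (\<rho> 0 x + \<tau> x) \<alpha> \<partial>lebesgue)" by (rule path_modulus_le[OF adm])
    also have "\<dots> \<le> (\<integral>\<^sup>+x. ennreal ((1 + \<zeta>) powr \<alpha>) * epowr (\<rho> 0 x) \<alpha> + ennreal ((1 + 1 / \<zeta>) powr \<alpha>) * epowr (\<tau> x) \<alpha> \<partial>lebesgue)"
      using \<alpha> \<zeta> by (intro nn_integral_mono epowr_add_le) auto
    also have "\<dots> = ennreal ((1 + \<zeta>) powr \<alpha>) * (\<integral>\<^sup>+x. epowr (\<rho> 0 x) \<alpha> \<partial>lebesgue) + ennreal ((1 + 1 / \<zeta>) powr \<alpha>) * (\<integral>\<^sup>+x. epowr (\<tau> x) \<alpha> \<partial>lebesgue)"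
    proof -
      have "\<tau> \<in> borel_measurable lebesgue" using \<tau>m by (simp add: measurable_completion)
      then show ?thesis by (simp add: nn_integral_add nn_integral_cmult)
    qed
    also have "\<dots> \<le> ennreal ((1 + \<zeta>) powr \<alpha>) * (L + ennreal \<zeta>) + ennreal ((1 + 1 / \<zeta>) powr \<alpha>) * ennreal \<beta>"
    proof (intro add_mono mult_left_mono \<tau>int)
      show "(\<integral>\<^sup>+x. epowr (\<rho> 0 x) \<alpha> \<partial>lebesgue) \<le> L + ennreal \<zeta>"
        using \<rho>(2)[of 0] d(2)[of 0] by (meson add_left_mono ennreal_leI order_trans)
    qed auto
    also have "ennreal ((1 + 1 / \<zeta>) powr \<alpha>) * ennreal \<beta> = ennreal \<zeta>"
    proof -
      have "ennreal z * ennreal (\<zeta> / z) = ennreal \<zeta>" if "z > 0" for z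
        using that by (simp add: ennreal_mult'[symmetric])
      then show ?thesis unfolding \<beta>_def using \<zeta>pos by blast
    qed
    finally show ?thesis .
  qed
  then have *: "path_modulus \<alpha> (\<Union>k. \<Gamma> k) \<le> ennreal ((1 + \<zeta>) powr \<alpha> * (enn2real L + \<zeta>) + \<zeta>)" if "0 < \<zeta>" for \<zeta>
    using that Lfin by (force simp: ennreal_mult ennreal_plus)
  have "((\<lambda>\<zeta>. ennreal ((1 + \<zeta>) powr \<alpha> * (enn2real L + \<zeta>) + \<zeta>)) \<longlongrightarrow> ennreal ((1 + 0) powr \<alpha> * (enn2real L + 0) + 0)) (at_right 0)"
    by (intro tendsto_ennrealI tendsto_intros) auto
  moreover have "\<forall>\<^sub>F \<zeta> in at_right 0. path_modulus \<alpha> (\<Union>k. \<Gamma> k) \<le> ennreal ((1 + \<zeta>) powr \<alpha> * (enn2real L + \<zeta>) + \<zeta>)"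
    by (rule eventually_mono[OF eventually_at_right_real[of 0 1]]) (simp_all add: * del: ennreal_plus)
  ultimately have "path_modulus \<alpha> (\<Union>k. \<Gamma> k) \<le> ennreal ((1 + 0) powr \<alpha> * (enn2real L + 0) + 0)"
    by (rule tendsto_lowerbound) simp
  also have "\<dots> = L" using Lfin by simp
  finally show ?thesis using LB by (rule order_trans)
qed

subsection \<open>Duality between path and surface moduli\<close>

text \<open>First order expansion in \<open>t\<close> with a uniform error. Cases are split by
  comparing \<open>sqrt t * b\<close> with \<open>a\<close>: this threshold makes the factor of the
  linear term tend to 1 and that of the remainder tend to 0 at the same time.\<close>

lemma powr_add_scaled_le:
  fixes a b t \<alpha> :: real
  assumes ab: "a \<ge> 0" "b \<ge> 0" and t: "t > 0" and \<alpha>: "\<alpha> \<ge> 2"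
  shows "(a + t * b) powr \<alpha> \<le> a powr \<alpha>
    + t * \<alpha> * ((1 + sqrt t) powr (\<alpha> - 1) * (a powr (\<alpha> - 1) * b) + (sqrt t + t) powr (\<alpha> - 1) * b powr \<alpha>)"
proof (cases "a + t * b = 0")
  case True
  then have "a = 0" "b = 0" using ab t by (auto simp: add_nonneg_eq_0_iff)
  then show ?thesis by simp
next
  case False
  define y where "y = a + t * b"
  have y: "y > 0" using False ab t unfolding y_def by (metis add_nonneg_nonneg less_eq_real_def mult_nonneg_nonneg)
  have s: "sqrt t > 0" "sqrt t * sqrt t = t" using t by auto
  \<comment> \<open>Convexity with the tangent at the endpoint \<open>y\<close>:
    \<open>y powr \<alpha> - a powr \<alpha>\<close> is at most
    \<open>\<alpha> * y powr (\<alpha> - 1) * (y - a)\<close>.\<close>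
  have "1 + \<alpha> * (a / y - 1) \<le> (a / y) powr \<alpha>" using ab y \<alpha> by (intro Bernoulli_inequality_powr) auto
  then have "y powr \<alpha> * (1 + \<alpha> * (a / y - 1)) \<le> y powr \<alpha> * (a / y) powr \<alpha>" by (intro mult_left_mono) auto
  also have "y powr \<alpha> * (a / y) powr \<alpha> = a powr \<alpha>" using ab y by (simp add: powr_divide)
  also have "y powr \<alpha> * (1 + \<alpha> * (a / y - 1)) = y powr \<alpha> - \<alpha> * (y powr \<alpha> / y) * (y - a)"
    using y by (simp add: field_simps)
  also have "y powr \<alpha> / y = y powr (\<alpha> - 1)" using y by (simp add: powr_diff)
  also have "y - a = t * b" by (simp add: y_def)
  finally have 1: "y powr \<alpha> \<le> a powr \<alpha> + t * \<alpha> * (y powr (\<alpha> - 1) * b)" by (simp add: algebra_simps)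
  have "y powr (\<alpha> - 1) * b \<le> (1 + sqrt t) powr (\<alpha> - 1) * (a powr (\<alpha> - 1) * b) + (sqrt t + t) powr (\<alpha> - 1) * b powr \<alpha>"
  proof (cases "sqrt t * b \<le> a")
    case True
    have "t * b = sqrt t * (sqrt t * b)" using s(2) by (simp add: mult.assoc[symmetric])
    also have "\<dots> \<le> sqrt t * a" using True s by (intro mult_left_mono) auto
    finally have "y \<le> (1 + sqrt t) * a" by (simp add: y_def algebra_simps)
    then have "y powr (\<alpha> - 1) \<le> ((1 + sqrt t) * a) powr (\<alpha> - 1)" using y \<alpha> by (intro powr_mono2) auto
    also have "\<dots> = (1 + sqrt t) powr (\<alpha> - 1) * a powr (\<alpha> - 1)" by (rule powr_mult)
    finally have "y powr (\<alpha> - 1) * b \<le> (1 + sqrt t) powr (\<alpha> - 1) * a powr (\<alpha> - 1) * b" using ab by (intro mult_right_mono)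
    moreover have "0 \<le> (sqrt t + t) powr (\<alpha> - 1) * b powr \<alpha>" by simp
    ultimately show ?thesis unfolding mult.assoc by linarith
  next
    case False
    then have "y \<le> (sqrt t + t) * b" by (simp add: y_def algebra_simps)
    then have "y powr (\<alpha> - 1) \<le> ((sqrt t + t) * b) powr (\<alpha> - 1)" using y \<alpha> by (intro powr_mono2) auto
    also have "\<dots> = (sqrt t + t) powr (\<alpha> - 1) * b powr (\<alpha> - 1)" by (rule powr_mult)
    finally have "y powr (\<alpha> - 1) * b \<le> (sqrt t + t) powr (\<alpha> - 1) * b powr (\<alpha> - 1) * b" using ab by (intro mult_right_mono)
    also have "b powr (\<alpha> - 1) * b = b powr \<alpha>"
      using ab by (cases "b = 0") (auto simp: powr_diff)
    then have "(sqrt t + t) powr (\<alpha> - 1) * b powr (\<alpha> - 1) * b = (sqrt t + t) powr (\<alpha> - 1) * b powr \<alpha>" by (simp add: mult.assoc)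
    finally show ?thesis using ab by (simp add: add_increasing)
  qed
  then have "t * \<alpha> * (y powr (\<alpha> - 1) * b)
     \<le> t * \<alpha> * ((1 + sqrt t) powr (\<alpha> - 1) * (a powr (\<alpha> - 1) * b) + (sqrt t + t) powr (\<alpha> - 1) * b powr \<alpha>)"
    using t \<alpha> by (intro mult_left_mono) auto
  then show ?thesis using 1 unfolding y_def by linarith
qed

lemma epowr_add_scaled_le:
  assumes b: "y < top" and t: "t > 0" and \<alpha>: "\<alpha> \<ge> 2"
  shows "epowr (x + ennreal t * y) \<alpha> \<le> epowr x \<alpha>
    + ennreal (t * \<alpha>) * (ennreal ((1 + sqrt t) powr (\<alpha> - 1)) * (epowr x (\<alpha> - 1) * y) + ennreal ((sqrt t + t) powr (\<alpha> - 1)) * epowr y \<alpha>)"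
proof (cases "x = top")
  case False
  then obtain a b where ab: "0 \<le> a" "x = ennreal a" "0 \<le> b" "y = ennreal b" using b by (metis ennreal_cases less_irrefl)
  have star: "ennreal (A + B * (C * (E * F) + G * I)) = ennreal A + ennreal B * (ennreal C * (ennreal E * ennreal F) + ennreal G * ennreal I)"
    if "0 \<le> A" "0 \<le> B" "0 \<le> C" "0 \<le> E" "0 \<le> F" "0 \<le> G" "0 \<le> I" for A B C E F G I
    using that by (simp add: ennreal_mult)
  have "epowr (x + ennreal t * y) \<alpha> = ennreal ((a + t * b) powr \<alpha>)"
  proof -
    have "x + ennreal t * y = ennreal (a + t * b)" using ab t by (simp add: ennreal_mult)
    then show ?thesis using ab t by (simp del: ennreal_plus)
  qed
  also have "\<dots> \<le> ennreal (a powr \<alpha>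
    + t * \<alpha> * ((1 + sqrt t) powr (\<alpha> - 1) * (a powr (\<alpha> - 1) * b) + (sqrt t + t) powr (\<alpha> - 1) * b powr \<alpha>))"
    using ab t \<alpha> by (intro ennreal_leI powr_add_scaled_le)
  also have "\<dots> = ennreal (a powr \<alpha>) + ennreal (t * \<alpha>) * (ennreal ((1 + sqrt t) powr (\<alpha> - 1)) * (ennreal (a powr (\<alpha> - 1)) * ennreal b)
      + ennreal ((sqrt t + t) powr (\<alpha> - 1)) * ennreal (b powr \<alpha>))"
    using ab t \<alpha> by (intro star) auto
  finally show ?thesis using ab by simp
qed simp

text \<open>Hoelder's inequality on each ball gives the pointwise Jensen bound; Fubini's theorem and
  the symmetry of \<open>dist x y < \<delta>\<close> then show that averaging does not raise the
  energy.\<close>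

lemma ball_average_powr_le:
  fixes h :: "'a::euclidean_space \<Rightarrow> ennreal"
  assumes q: "q > 1" and w: "w > 0" "\<And>x::'a. emeasure lborel (ball x \<delta>) = ennreal w"
    and h[measurable]: "h \<in> borel_measurable borel"
  shows "(\<integral>\<^sup>+x. epowr (ennreal (1 / w) * (\<integral>\<^sup>+y. h y * indicator (ball x \<delta>) y \<partial>lborel)) q \<partial>lborel) \<le> (\<integral>\<^sup>+y. epowr (h y) q \<partial>lborel)"
proof -
  define \<alpha> where "\<alpha> = q / (q - 1)"
  have qa: "q > 1" "\<alpha> > 1" "1 / q + 1 / \<alpha> = 1" using q by (auto simp: \<alpha>_def field_simps)
  have bm [measurable]: "ball x \<delta> \<in> sets borel" for x :: 'a by simp
  have ind [measurable]: "(\<lambda>(x::'a, y). indicator (ball x \<delta>) y :: ennreal) \<in> borel_measurable (borel \<Otimes>\<^sub>M borel)"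
  proof -
    have "(\<lambda>(x::'a, y). indicator (ball x \<delta>) y :: ennreal) = (\<lambda>(x, y). indicator {r. r < \<delta>} (dist x y))"
      by (auto simp: indicator_def fun_eq_iff)
    then show ?thesis by simp
  qed
  have pt: "epowr (ennreal (1 / w) * (\<integral>\<^sup>+y. h y * indicator (ball x \<delta>) y \<partial>lborel)) q
      \<le> ennreal (1 / w) * (\<integral>\<^sup>+y. epowr (h y) q * indicator (ball x \<delta>) y \<partial>lborel)" for x
  proof -
    let ?B = "indicator (ball x \<delta>) :: 'a \<Rightarrow> ennreal"
    have "(\<integral>\<^sup>+y. h y * ?B y \<partial>lborel) = (\<integral>\<^sup>+y. (h y * ?B y) * ?B y \<partial>lborel)"
      by (intro nn_integral_cong) (auto simp: indicator_def)
    also have "\<dots> \<le> epowr (\<integral>\<^sup>+y. epowr (h y * ?B y) q \<partial>lborel) (1 / q) * epowr (\<integral>\<^sup>+y. epowr (?B y) \<alpha> \<partial>lborel) (1 / \<alpha>)"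
      by (intro Hoelder_inequality_nn qa) measurable
    also have "(\<integral>\<^sup>+y. epowr (h y * ?B y) q \<partial>lborel) = (\<integral>\<^sup>+y. epowr (h y) q * ?B y \<partial>lborel)"
      by (intro nn_integral_cong) (auto simp: indicator_def)
    also have "(\<integral>\<^sup>+y. epowr (?B y) \<alpha> \<partial>lborel) = (\<integral>\<^sup>+y. ?B y \<partial>lborel)"
      by (intro nn_integral_cong) (auto simp: indicator_def)
    also have "\<dots> = ennreal w" using w(2) by simp
    finally have "epowr (ennreal (1 / w) * (\<integral>\<^sup>+y. h y * ?B y \<partial>lborel)) q
        \<le> epowr (ennreal (1 / w) * (epowr (\<integral>\<^sup>+y. epowr (h y) q * ?B y \<partial>lborel) (1 / q) * epowr (ennreal w) (1 / \<alpha>))) q"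
      using q by (intro epowr_mono mult_left_mono) auto
    also have "\<dots> = epowr (ennreal (1 / w)) q * ((\<integral>\<^sup>+y. epowr (h y) q * ?B y \<partial>lborel) * epowr (ennreal w) (1 / \<alpha> * q))"
      using q by (simp only: epowr_mult epowr_epowr) simp
    also have "\<dots> = (epowr (ennreal (1 / w)) q * epowr (ennreal w) (1 / \<alpha> * q)) * (\<integral>\<^sup>+y. epowr (h y) q * ?B y \<partial>lborel)"
      by (simp only: mult_ac)
    also have "epowr (ennreal (1 / w)) q * epowr (ennreal w) (1 / \<alpha> * q) = ennreal (1 / w)"
    proof -
      have "1 / \<alpha> * q = q - 1" using q by (simp add: \<alpha>_def)
      then have "(1 / w) powr q * w powr (1 / \<alpha> * q) = 1 / w"
        using w(1) by (simp add: powr_divide powr_diff)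
      then show ?thesis using w(1) by (simp add: ennreal_mult'[symmetric])
    qed
    finally show ?thesis .
  qed
  have "(\<integral>\<^sup>+x. epowr (ennreal (1 / w) * (\<integral>\<^sup>+y. h y * indicator (ball x \<delta>) y \<partial>lborel)) q \<partial>lborel)
    \<le> (\<integral>\<^sup>+x. ennreal (1 / w) * (\<integral>\<^sup>+y. epowr (h y) q * indicator (ball x \<delta>) y \<partial>lborel) \<partial>lborel)"
    by (intro nn_integral_mono pt)
  also have "\<dots> = ennreal (1 / w) * (\<integral>\<^sup>+x. \<integral>\<^sup>+y. epowr (h y) q * indicator (ball x \<delta>) y \<partial>lborel \<partial>lborel)"
    by (intro nn_integral_cmult) measurable
  also have "(\<integral>\<^sup>+x. \<integral>\<^sup>+y. epowr (h y) q * indicator (ball x \<delta>) y \<partial>lborel \<partial>lborel)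
      = (\<integral>\<^sup>+y. \<integral>\<^sup>+x. epowr (h y) q * indicator (ball x \<delta>) y \<partial>lborel \<partial>lborel)"
    by (rule lborel_pair.Fubini'[symmetric]) measurable
  also have "\<dots> = (\<integral>\<^sup>+y. epowr (h y) q * ennreal w \<partial>lborel)"
  proof (intro nn_integral_cong)
    fix y
    have "(\<integral>\<^sup>+x. epowr (h y) q * indicator (ball x \<delta>) y \<partial>lborel) = (\<integral>\<^sup>+x. epowr (h y) q * indicator (ball y \<delta>) x \<partial>lborel)"
      by (intro nn_integral_cong) (auto simp: indicator_def dist_commute)
    also have "\<dots> = epowr (h y) q * ennreal w" by (simp add: nn_integral_cmult_indicator w(2))
    finally show "(\<integral>\<^sup>+x. epowr (h y) q * indicator (ball x \<delta>) y \<partial>lborel) = epowr (h y) q * ennreal w" .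
  qed
  also have "\<dots> = (\<integral>\<^sup>+y. epowr (h y) q \<partial>lborel) * ennreal w" by (rule nn_integral_multc) measurable
  also have "ennreal (1 / w) * ((\<integral>\<^sup>+y. epowr (h y) q \<partial>lborel) * ennreal w) = (\<integral>\<^sup>+y. epowr (h y) q \<partial>lborel)"
    using w(1) by (subst mult.commute[of _ "ennreal w"]) (simp add: ennreal_mult_cancel_inverse)
  finally show ?thesis .
qed

text \<open>The mean of \<open>\<rho>\<close> and \<open>\<sigma>\<close> with weights
  \<open>1 / (1 + t)\<close> and \<open>t / (1 + t)\<close> is admissible, so its energy is at least
  \<open>M\<close>. For nearly extremal \<open>\<rho>\<close>, expansion to first order in
  \<open>t\<close> gives the lower bound for the derivative in the direction of
  \<open>\<sigma>\<close>. The common bound \<open>K\<close> lets one \<open>\<rho>\<close> serve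
  all \<open>\<sigma>\<close>.\<close>

lemma near_optimal_variation:
  assumes \<alpha>: "\<alpha> \<ge> 2" and M: "M > 0" "path_modulus \<alpha> \<Gamma> = ennreal M" and \<zeta>: "0 < \<zeta>" "\<zeta> < 1" and K: "K \<ge> 0"
  shows "\<exists>\<rho> \<in> path_adm \<Gamma>. (\<integral>\<^sup>+x. epowr (\<rho> x) \<alpha> \<partial>lborel) \<le> ennreal (M + \<zeta>) \<and>
    (\<forall>\<sigma> \<in> path_adm \<Gamma>. (\<forall>x. \<sigma> x < top) \<and> (\<integral>\<^sup>+x. epowr (\<sigma> x) \<alpha> \<partial>lborel) \<le> ennreal K \<longrightarrow>
       ennreal ((1 - \<zeta>) * M) \<le> (\<integral>\<^sup>+x. epowr (\<rho> x) (\<alpha> - 1) * \<sigma> x \<partial>lborel))"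
proof -
  have "((\<lambda>t. (sqrt t + t) powr (\<alpha> - 1) * K) \<longlongrightarrow> (sqrt 0 + 0) powr (\<alpha> - 1) * K) (at_right 0)"
    using \<alpha> by (intro tendsto_intros tendsto_powr') (auto simp: eventually_at_right_less intro!: eventually_mono[OF eventually_at_right_less])
  then have "\<forall>\<^sub>F t in at_right 0. (sqrt t + t) powr (\<alpha> - 1) * K < \<zeta> * M / 4"
    by (rule order_tendstoD(2)) (use \<zeta> M \<alpha> in auto)
  moreover have "((\<lambda>t. (1 - \<zeta>) * (1 + sqrt t) powr (\<alpha> - 1)) \<longlongrightarrow> (1 - \<zeta>) * (1 + sqrt 0) powr (\<alpha> - 1)) (at_right 0)"
    by (intro tendsto_intros) auto
  then have "\<forall>\<^sub>F t in at_right 0. (1 - \<zeta>) * (1 + sqrt t) powr (\<alpha> - 1) < 1 - \<zeta> / 2"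
    by (rule order_tendstoD(2)) (use \<zeta> in auto)
  moreover have "\<forall>\<^sub>F t in at_right 0. (0::real) < t" by (rule eventually_at_right_less)
  ultimately have "\<forall>\<^sub>F t in at_right 0. (sqrt t + t) powr (\<alpha> - 1) * K < \<zeta> * M / 4 \<and> (1 - \<zeta>) * (1 + sqrt t) powr (\<alpha> - 1) < 1 - \<zeta> / 2 \<and> 0 < t"
    by eventually_elim auto
  \<comment> \<open>Fixed before the densities are chosen: the remainder term stays below
    \<open>\<zeta> * M / 4\<close>, and the factor of the linear term is so close to 1 that a loss
    of \<open>\<zeta> / 2\<close> becomes at most a loss of \<open>\<zeta>\<close>.\<close>
  then obtain t where t: "(sqrt t + t) powr (\<alpha> - 1) * K < \<zeta> * M / 4" "(1 - \<zeta>) * (1 + sqrt t) powr (\<alpha> - 1) < 1 - \<zeta> / 2" "0 < t"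
    using eventually_happens[of _ "at_right (0::real)"] by (auto simp: trivial_limit_at_right_real)
  \<comment> \<open>The excess energy of \<open>\<rho>\<close> must be small compared with the step
    \<open>t\<close>, because the final inequality is divided by \<open>t * \<alpha>\<close>; it
    takes a quarter of \<open>\<zeta> * M\<close>, and the remainder another quarter.\<close>
  define \<kappa> where "\<kappa> = min \<zeta> (t * \<alpha> * (\<zeta> * M / 4))"
  have \<kappa>: "\<kappa> > 0" "\<kappa> \<le> \<zeta>" "\<kappa> \<le> t * \<alpha> * (\<zeta> * M / 4)" using \<zeta> t \<alpha> M by (auto simp: \<kappa>_def)
  have "path_modulus \<alpha> \<Gamma> < ennreal (M + \<kappa>)" using M \<kappa> by (simp add: ennreal_less_iff del: ennreal_plus)
  then obtain \<rho> where \<rho>: "\<rho> \<in> path_adm \<Gamma>" "(\<integral>\<^sup>+x. epowr (\<rho> x) \<alpha> \<partial>lebesgue) < ennreal (M + \<kappa>)"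
    unfolding path_modulus_def INF_less_iff by blast
  have [measurable]: "\<rho> \<in> borel_measurable borel" using \<rho>(1) by (simp add: path_adm_def)
  have leb: "(\<integral>\<^sup>+x. epowr (\<sigma> x) \<alpha> \<partial>lebesgue) = (\<integral>\<^sup>+x. epowr (\<sigma> x) \<alpha> \<partial>lborel)" if [measurable]: "\<sigma> \<in> borel_measurable borel" for \<sigma> :: "'a \<Rightarrow> ennreal"
    by (rule nn_integral_completion) measurable
  have \<rho>2: "(\<integral>\<^sup>+x. epowr (\<rho> x) \<alpha> \<partial>lborel) \<le> ennreal (M + \<kappa>)" using \<rho>(2) by (simp add: leb less_imp_le)
  have "ennreal ((1 - \<zeta>) * M) \<le> (\<integral>\<^sup>+x. epowr (\<rho> x) (\<alpha> - 1) * \<sigma> x \<partial>lborel)"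
    if \<sigma>: "\<sigma> \<in> path_adm \<Gamma>" "\<And>x. \<sigma> x < top" "(\<integral>\<^sup>+x. epowr (\<sigma> x) \<alpha> \<partial>lborel) \<le> ennreal K" for \<sigma>
  proof (cases "(\<integral>\<^sup>+x. epowr (\<rho> x) (\<alpha> - 1) * \<sigma> x \<partial>lborel) = top")
    case False
    then obtain I where I: "I \<ge> 0" "(\<integral>\<^sup>+x. epowr (\<rho> x) (\<alpha> - 1) * \<sigma> x \<partial>lborel) = ennreal I"
      by (cases "\<integral>\<^sup>+x. epowr (\<rho> x) (\<alpha> - 1) * \<sigma> x \<partial>lborel") auto
    have [measurable]: "\<sigma> \<in> borel_measurable borel" using \<sigma>(1) by (simp add: path_adm_def)
    let ?c1 = "(1 + sqrt t) powr (\<alpha> - 1)" and ?c2 = "(sqrt t + t) powr (\<alpha> - 1)"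
    have "(\<lambda>x. ennreal (1 / (1 + t)) * \<rho> x + ennreal (t / (1 + t)) * \<sigma> x) \<in> path_adm \<Gamma>"
      using t(3) by (intro path_adm_convex \<rho> \<sigma>) (auto simp flip: add_divide_distrib)
    from path_modulus_le[OF this, of \<alpha>]
    have "ennreal M \<le> (\<integral>\<^sup>+x. epowr (ennreal (1 / (1 + t)) * \<rho> x + ennreal (t / (1 + t)) * \<sigma> x) \<alpha> \<partial>lborel)"
      using M by (simp add: leb)
    also have "\<dots> = (\<integral>\<^sup>+x. ennreal ((1 / (1 + t)) powr \<alpha>) * epowr (\<rho> x + ennreal t * \<sigma> x) \<alpha> \<partial>lborel)"
    proof (intro nn_integral_cong)
      fix x
      have "ennreal (t / (1 + t)) = ennreal (1 / (1 + t)) * ennreal t" using t(3) by (simp add: ennreal_mult'[symmetric])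
      then have "ennreal (1 / (1 + t)) * \<rho> x + ennreal (t / (1 + t)) * \<sigma> x = ennreal (1 / (1 + t)) * (\<rho> x + ennreal t * \<sigma> x)"
        by (simp only: distrib_left mult.assoc)
      then show "epowr (ennreal (1 / (1 + t)) * \<rho> x + ennreal (t / (1 + t)) * \<sigma> x) \<alpha>
          = ennreal ((1 / (1 + t)) powr \<alpha>) * epowr (\<rho> x + ennreal t * \<sigma> x) \<alpha>"
        using t(3) by (simp only: epowr_mult) simp
    qed
    also have "\<dots> = ennreal ((1 / (1 + t)) powr \<alpha>) * (\<integral>\<^sup>+x. epowr (\<rho> x + ennreal t * \<sigma> x) \<alpha> \<partial>lborel)"
      by (rule nn_integral_cmult) measurable
    also have "(\<integral>\<^sup>+x. epowr (\<rho> x + ennreal t * \<sigma> x) \<alpha> \<partial>lborel) \<le>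
       (\<integral>\<^sup>+x. epowr (\<rho> x) \<alpha> + ennreal (t * \<alpha>) * (ennreal ?c1 * (epowr (\<rho> x) (\<alpha> - 1) * \<sigma> x) + ennreal ?c2 * epowr (\<sigma> x) \<alpha>) \<partial>lborel)"
      by (intro nn_integral_mono epowr_add_scaled_le \<sigma>(2) t(3) \<alpha>)
    also have "\<dots> = (\<integral>\<^sup>+x. epowr (\<rho> x) \<alpha> \<partial>lborel) + ennreal (t * \<alpha>) * (ennreal ?c1 * ennreal I + ennreal ?c2 * (\<integral>\<^sup>+x. epowr (\<sigma> x) \<alpha> \<partial>lborel))"
      by (simp add: nn_integral_add nn_integral_cmult I(2))
    also have "\<dots> \<le> ennreal (M + \<kappa>) + ennreal (t * \<alpha>) * (ennreal ?c1 * ennreal I + ennreal ?c2 * ennreal K)"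
      by (intro add_mono mult_left_mono \<sigma>(3) \<rho>2 order_refl) auto
    also have "\<dots> = ennreal (M + \<kappa> + t * \<alpha> * (?c1 * I + ?c2 * K))"
    proof -
      have star: "ennreal A + ennreal B * (ennreal C * ennreal E + ennreal F * ennreal G) = ennreal (A + B * (C * E + F * G))"
        if "0 \<le> A" "0 \<le> B" "0 \<le> C" "0 \<le> E" "0 \<le> F" "0 \<le> G" for A B C E F G using that by (simp add: ennreal_mult)
      show ?thesis using M \<kappa> t \<alpha> I K by (intro star) auto
    qed
    finally have "ennreal M \<le> ennreal ((1 / (1 + t)) powr \<alpha>) * ennreal (M + \<kappa> + t * \<alpha> * (?c1 * I + ?c2 * K))"
      by (simp add: mult_left_mono)
    also have "\<dots> = ennreal ((1 / (1 + t)) powr \<alpha> * (M + \<kappa> + t * \<alpha> * (?c1 * I + ?c2 * K)))"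
      by (rule ennreal_mult'[symmetric]) simp
    finally have "M \<le> (1 / (1 + t)) powr \<alpha> * (M + \<kappa> + t * \<alpha> * (?c1 * I + ?c2 * K))"
      using M \<kappa> t \<alpha> I K by (subst (asm) ennreal_le_iff) auto
    then have "(1 + t) powr \<alpha> * M \<le> (1 + t) powr \<alpha> * ((1 / (1 + t)) powr \<alpha> * (M + \<kappa> + t * \<alpha> * (?c1 * I + ?c2 * K)))"
      by (intro mult_left_mono) auto
    also have "\<dots> = M + \<kappa> + t * \<alpha> * (?c1 * I + ?c2 * K)"
      using t(3) by (simp add: powr_divide mult.assoc[symmetric])
    finally have 1: "(1 + t) powr \<alpha> * M \<le> M + \<kappa> + t * \<alpha> * (?c1 * I + ?c2 * K)" .
    have "(1 + \<alpha> * (1 + t - 1)) * M \<le> (1 + t) powr \<alpha> * M"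
      using t(3) \<alpha> M by (intro mult_right_mono Bernoulli_inequality_powr) auto
    with 1 have "t * \<alpha> * M \<le> \<kappa> + t * \<alpha> * (?c1 * I + ?c2 * K)" by (simp add: algebra_simps)
    also have "\<dots> \<le> t * \<alpha> * (\<zeta> * M / 4) + t * \<alpha> * (?c1 * I + \<zeta> * M / 4)"
      using t \<alpha> \<kappa>(3) by (intro add_mono mult_left_mono) auto
    also have "\<dots> = t * \<alpha> * (?c1 * I + \<zeta> * M / 2)" by (simp add: algebra_simps)
    finally have "M \<le> ?c1 * I + \<zeta> * M / 2" using t(3) \<alpha> by simp
    then have "(1 - \<zeta> / 2) * M \<le> ?c1 * I" by (simp add: algebra_simps)
    moreover have "((1 - \<zeta>) * ?c1) * M \<le> (1 - \<zeta> / 2) * M" using t(2) M by (intro mult_right_mono) auto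
    ultimately have "?c1 * ((1 - \<zeta>) * M) \<le> ?c1 * I" by (simp add: mult_ac)
    moreover have "1 + sqrt t > 0" using t(3) by (simp add: add_pos_nonneg)
    then have "?c1 > 0" unfolding powr_gt_zero by linarith
    ultimately have "(1 - \<zeta>) * M \<le> I" by (rule mult_left_le_imp_le)
    then show ?thesis unfolding I(2) by (rule ennreal_leI)
  qed simp
  moreover have "(\<integral>\<^sup>+x. epowr (\<rho> x) \<alpha> \<partial>lborel) \<le> ennreal (M + \<zeta>)"
    using \<rho>2 \<kappa>(2) by (meson add_left_mono ennreal_leI order_trans)
  ultimately show ?thesis using \<rho>(1) by blast
qed

text \<open>The competitor has \<open>(n - 1)\<close>-th power \<open>F\<close>, the sum of an
  averaged power of a nearly extremal curve density and a small constant \<open>\<kappa>\<close> on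
  \<open>G\<close>. Surfaces of area above \<open>1 / \<kappa>\<close> are served by the constant.
  For the others \<open>\<sigma> S\<close> is bounded uniformly, so the variational inequality
  applies with one \<open>\<rho>\<close> for all of them.\<close>

lemma surf_modulus_le_of_crossing:
  fixes G :: "'a::euclidean_space set" and c p :: real
  assumes n2: "DIM('a) \<ge> 2"
    and c: "c > 0"
    and p: "real DIM('a) - 1 < p" "p \<le> real DIM('a)"
    and G: "bounded G" "G \<in> sets borel"
    and \<Sigma>: "\<And>S. S \<in> \<Sigma> \<Longrightarrow> S \<in> sets borel" "\<And>S. S \<in> \<Sigma> \<Longrightarrow> S \<subseteq> G"
    and \<delta>: "\<delta> > 0"
    and cross: "\<And>S g. S \<in> \<Sigma> \<Longrightarrow> hausdorff_outer (DIM('a) - 1) S < top \<Longrightarrow> g \<in> \<Gamma> \<Longrightarrow> rectifiable_path g \<Longrightarrow>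
        ennreal c * emeasure lborel (ball (0::'a) \<delta>) \<le> line_integral (\<lambda>y. hausdorff_outer (DIM('a) - 1) (S \<inter> ball y \<delta>)) g"
    and M: "M > 0" "path_modulus (p / (p - real DIM('a) + 1)) \<Gamma> = ennreal M"
  shows "surf_modulus p \<Sigma> \<le> ennreal (c powr (- (p / (real DIM('a) - 1))) * M powr (1 - p / (real DIM('a) - 1)))"
proof -
  let ?s = "DIM('a) - 1"
  let ?H = "hausdorff_outer ?s :: 'a set \<Rightarrow> ennreal"
  define N where "N = real DIM('a) - 1"
  define \<alpha> where "\<alpha> = p / (p - real DIM('a) + 1)"
  define q where "q = p / N"
  have s1: "?s \<ge> 1" and N: "N \<ge> 1" "real ?s = N" using n2 by (auto simp: N_def of_nat_diff)
  have pN: "p > N" "p - real DIM('a) + 1 = p - N" using p by (auto simp: N_def)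
  have q1: "q > 1" using pN N by (simp add: q_def)
  have \<alpha>2: "\<alpha> \<ge> 2"
  proof -
    have "2 * (p - N) \<le> p" using p N n2 by (simp add: N_def)
    then show ?thesis using pN by (simp add: \<alpha>_def pos_le_divide_eq)
  qed
  \<comment> \<open>This identity makes the \<open>q\<close>-energy of
    \<open>\<rho> powr (\<alpha> - 1)\<close> the \<open>\<alpha>\<close>-energy of
    \<open>\<rho>\<close>.\<close>
  have \<alpha>q: "(\<alpha> - 1) * q = \<alpha>"
  proof -
    have "\<alpha> - 1 = N / (p - N)" unfolding \<alpha>_def pN(2) using pN(1) by (simp add: field_simps)
    then show ?thesis unfolding q_def \<alpha>_def pN(2) using pN(1) N(1) by simp
  qed
  define w where "w = unit_ball_vol (real DIM('a)) * \<delta> ^ DIM('a)"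
  have w: "w > 0" "\<And>x::'a. emeasure lborel (ball x \<delta>) = ennreal w" using \<delta> by (auto simp: w_def emeasure_ball)
  obtain R where R: "R > 0" "G \<subseteq> ball 0 R" using bounded_subset_ballD[OF G(1), of 0] by blast
  obtain l where l: "l \<ge> 0" "emeasure lborel G = ennreal l"
    using emeasure_bounded_finite[OF G(1)] by (cases "emeasure lborel G") auto
  obtain V where V: "V \<ge> 0" "emeasure lborel (ball (0::'a) (R + \<delta>)) = ennreal V"
    using emeasure_bounded_finite[OF bounded_ball[of "0::'a" "R + \<delta>"]] by (cases "emeasure lborel (ball (0::'a) (R + \<delta>))") auto
  have Gm [measurable]: "G \<in> sets borel" by fact
  have bm [measurable]: "ball x \<delta> \<in> sets borel" for x :: 'a by simp
  have ind [measurable]: "(\<lambda>(x::'a, y). indicator (ball x \<delta>) y :: ennreal) \<in> borel_measurable (borel \<Otimes>\<^sub>M borel)"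
  proof -
    have "(\<lambda>(x::'a, y). indicator (ball x \<delta>) y :: ennreal) = (\<lambda>(x, y). indicator {r. r < \<delta>} (dist x y))"
      by (auto simp: indicator_def fun_eq_iff)
    then show ?thesis by simp
  qed
  define \<mu> where "\<mu> S = density (hausdorff_measure ?s :: 'a measure) (indicator S)" for S
  have sets\<mu> [measurable_cong, simp]: "sets (\<mu> S) = sets borel" for S by (simp add: \<mu>_def)
  have em\<mu>: "emeasure (\<mu> S) A = ?H (S \<inter> A)" if [measurable]: "S \<in> sets borel" "A \<in> sets borel" for S A
  proof -
    have "emeasure (\<mu> S) A = (\<integral>\<^sup>+x. indicator S x * indicator A x \<partial>hausdorff_measure ?s)"
      unfolding \<mu>_def by (rule emeasure_density) auto
    also have "\<dots> = (\<integral>\<^sup>+x. indicator (S \<inter> A) x \<partial>hausdorff_measure ?s)"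
      by (intro nn_integral_cong) (auto simp: indicator_def)
    also have "\<dots> = ?H (S \<inter> A)" using s1 by (simp add: emeasure_hausdorff_measure)
    finally show ?thesis .
  qed
  have fin\<mu>: "finite_measure (\<mu> S)" if "S \<in> sets borel" "?H S < top" for S
  proof
    have "space (\<mu> S) = UNIV" by (simp add: \<mu>_def)
    then show "emeasure (\<mu> S) (space (\<mu> S)) \<noteq> \<infinity>" using em\<mu>[OF that(1), of UNIV] that(2) by (simp add: less_top)
  qed
  \<comment> \<open>Normalized by the lower bound in \<open>cross\<close>, so that the line
    integrals over the curves are at least 1.\<close>
  define \<sigma> where "\<sigma> S y = ennreal (1 / (c * w)) * ?H (S \<inter> ball y \<delta>)" for S y
  have \<sigma>eq: "\<sigma> S y = ennreal (1 / (c * w)) * (\<integral>\<^sup>+x. indicator (ball y \<delta>) x \<partial>\<mu> S)" if "S \<in> sets borel" for S y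
    unfolding \<sigma>_def using em\<mu>[OF that, of "ball y \<delta>"] by simp
  have \<sigma>m: "\<sigma> S \<in> borel_measurable borel" if S: "S \<in> sets borel" "?H S < top" for S
  proof -
    interpret finite_measure "\<mu> S" by (rule fin\<mu>[OF S])
    have "(\<lambda>y. \<integral>\<^sup>+x. indicator (ball y \<delta>) x \<partial>\<mu> S) \<in> borel_measurable borel" by measurable
    then show ?thesis using \<sigma>eq[OF S(1)] by (simp add: fun_eq_iff[symmetric, of "\<sigma> S"] cong: measurable_cong)
  qed
  have \<sigma>adm: "\<sigma> S \<in> path_adm \<Gamma>" if S: "S \<in> \<Sigma>" "?H S < top" for S
  proof -
    have "1 \<le> line_integral (\<sigma> S) g" if g: "g \<in> \<Gamma>" "rectifiable_path g" for g
    proof -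
      have Hm: "(\<lambda>y. ?H (S \<inter> ball y \<delta>)) \<in> borel_measurable borel"
      proof -
        have "(\<lambda>y. ?H (S \<inter> ball y \<delta>)) = (\<lambda>y. ennreal (c * w) * \<sigma> S y)"
          unfolding \<sigma>_def using c w(1) by (intro ext ennreal_mult_cancel_inverse[symmetric]) auto
        then show ?thesis using \<sigma>m[OF \<Sigma>(1)[OF S(1)] S(2)] by simp
      qed
      have "1 = ennreal (1 / (c * w)) * (ennreal c * emeasure lborel (ball (0::'a) \<delta>))"
        using c w by (simp add: ennreal_mult'[symmetric])
      also have "\<dots> \<le> ennreal (1 / (c * w)) * line_integral (\<lambda>y. ?H (S \<inter> ball y \<delta>)) g"
        by (intro mult_left_mono cross S g) simp
      also have "\<dots> = line_integral (\<sigma> S) g"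
      proof -
        have "path g" using g(2) by (simp add: rectifiable_path_def)
        from line_integral_linear[OF this Hm Hm, of "ennreal (1 / (c * w))" 0] show ?thesis by (simp add: \<sigma>_def[abs_def])
      qed
      finally show ?thesis .
    qed
    then show ?thesis using \<sigma>m[OF \<Sigma>(1)[OF S(1)] S(2)] by (simp add: path_adm_def)
  qed
  have main: "surf_modulus p \<Sigma> \<le> ennreal ((1 + \<zeta>) powr q * (c powr (- q) * ((M + \<zeta>) / ((1 - \<zeta>) * M) powr q)) + \<zeta>)"
    if \<zeta>: "0 < \<zeta>" "\<zeta> < 1" for \<zeta>
  proof -
    have z1: "1 + 1 / \<zeta> > 0" using \<zeta> by (simp add: add_pos_pos)
    then have z2: "(1 + 1 / \<zeta>) powr q > 0" unfolding powr_gt_zero by linarith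
    \<comment> \<open>Solves \<open>(1 + 1 / \<zeta>) powr q * \<kappa> powr q * (l + 1) =
      \<zeta>\<close>, so that the constant on \<open>G\<close>, a set of volume \<open>l\<close>,
      costs at most \<open>\<zeta>\<close>.\<close>
    define \<kappa> where "\<kappa> = (\<zeta> / ((1 + 1 / \<zeta>) powr q * (l + 1))) powr (1 / q)"
    have \<kappa>0: "\<zeta> / ((1 + 1 / \<zeta>) powr q * (l + 1)) > 0"
      using \<zeta> z2 l(1) by (intro divide_pos_pos mult_pos_pos) auto
    then have \<kappa>: "\<kappa> > 0" unfolding \<kappa>_def powr_gt_zero by linarith
    have \<kappa>q: "\<kappa> powr q = \<zeta> / ((1 + 1 / \<zeta>) powr q * (l + 1))"
    proof -
      have "(z powr (1 / q)) powr q = z" if "z > 0" for z :: real using that q1 by (simp add: powr_powr)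
      then show ?thesis unfolding \<kappa>_def using \<kappa>0 by blast
    qed
    \<comment> \<open>\<open>b\<close> bounds \<open>\<sigma> S\<close> and \<open>K\<close> its
      energy, both independently of the surface; \<open>\<sigma> S\<close> vanishes outside
      \<open>ball 0 (R + \<delta>)\<close>, a set of volume \<open>V\<close>.\<close>
    define b where "b = 1 / \<kappa> / (c * w)"
    have b: "b \<ge> 0" using \<kappa> c w by (simp add: b_def)
    define K where "K = b powr \<alpha> * V"
    have K: "K \<ge> 0" using V(1) by (simp add: K_def)
    have \<sigma>K: "(\<integral>\<^sup>+y. epowr (\<sigma> S y) \<alpha> \<partial>lborel) \<le> ennreal K" and \<sigma>b: "\<sigma> S y \<le> ennreal b"
      if S: "S \<in> \<Sigma>" "?H S \<le> ennreal (1 / \<kappa>)" for S y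
    proof -
      have \<sigma>b: "\<sigma> S y \<le> ennreal b" for y
      proof -
        have "?H (S \<inter> ball y \<delta>) \<le> ?H S" by (rule hausdorff_outer_mono) auto
        also have "\<dots> \<le> ennreal (1 / \<kappa>)" by fact
        finally have "\<sigma> S y \<le> ennreal (1 / (c * w)) * ennreal (1 / \<kappa>)" unfolding \<sigma>_def by (rule mult_left_mono) simp
        also have "\<dots> = ennreal b" using \<kappa> c w(1) by (simp add: b_def ennreal_mult'[symmetric] mult.commute)
        finally show ?thesis .
      qed
      then show "\<sigma> S y \<le> ennreal b" .
      have pt: "epowr (\<sigma> S y) \<alpha> \<le> ennreal (b powr \<alpha>) * indicator (ball 0 (R + \<delta>)) y" for y
      proof (cases "y \<in> ball 0 (R + \<delta>)")
        case True
        have "epowr (\<sigma> S y) \<alpha> \<le> epowr (ennreal b) \<alpha>" using \<alpha>2 \<sigma>b by (intro epowr_mono) auto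
        then show ?thesis using True b by simp
      next
        case False
        have "S \<inter> ball y \<delta> = {}"
        proof (rule ccontr)
          assume "S \<inter> ball y \<delta> \<noteq> {}"
          then obtain z where z: "z \<in> S" "dist y z < \<delta>" by auto
          then have "dist 0 z < R" using \<Sigma>(2)[OF S(1)] R(2) by (auto simp: subset_iff)
          then show False using False z(2) dist_triangle[of 0 y z] by (simp add: dist_commute)
        qed
        then show ?thesis using s1 by (simp add: \<sigma>_def hausdorff_outer_empty)
      qed
      have "(\<integral>\<^sup>+y. epowr (\<sigma> S y) \<alpha> \<partial>lborel) \<le> (\<integral>\<^sup>+y. ennreal (b powr \<alpha>) * indicator (ball (0::'a) (R + \<delta>)) y \<partial>lborel)"
        by (intro nn_integral_mono pt)
      also have "\<dots> = ennreal (b powr \<alpha>) * ennreal V" by (subst nn_integral_cmult_indicator) (auto simp: V(2))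
      also have "\<dots> = ennreal K" using V(1) by (simp add: K_def ennreal_mult)
      finally show "(\<integral>\<^sup>+y. epowr (\<sigma> S y) \<alpha> \<partial>lborel) \<le> ennreal K" .
    qed
    obtain \<rho> where \<rho>: "\<rho> \<in> path_adm \<Gamma>" "(\<integral>\<^sup>+x. epowr (\<rho> x) \<alpha> \<partial>lborel) \<le> ennreal (M + \<zeta>)"
      and var: "\<And>\<sigma>. \<sigma> \<in> path_adm \<Gamma> \<Longrightarrow> (\<forall>x. \<sigma> x < top) \<Longrightarrow> (\<integral>\<^sup>+x. epowr (\<sigma> x) \<alpha> \<partial>lborel) \<le> ennreal K \<Longrightarrow>
         ennreal ((1 - \<zeta>) * M) \<le> (\<integral>\<^sup>+x. epowr (\<rho> x) (\<alpha> - 1) * \<sigma> x \<partial>lborel)"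
      using near_optimal_variation[OF \<alpha>2 M(1) M(2)[folded \<alpha>_def] \<zeta> K] by blast
    have [measurable]: "\<rho> \<in> borel_measurable borel" using \<rho>(1) by (simp add: path_adm_def)
    have m0: "(1 - \<zeta>) * M > 0" using \<zeta> M by simp
    define h where "h y = ennreal (1 / ((1 - \<zeta>) * M)) * epowr (\<rho> y) (\<alpha> - 1)" for y
    have hm [measurable]: "h \<in> borel_measurable borel" unfolding h_def by measurable
    define a where "a x = ennreal (1 / w) * (\<integral>\<^sup>+y. h y * indicator (ball x \<delta>) y \<partial>lborel)" for x
    have am [measurable]: "a \<in> borel_measurable borel" unfolding a_def by measurable
    define F where "F x = ennreal (1 / c) * a x + ennreal \<kappa> * indicator G x" for x
    have Fm [measurable]: "F \<in> borel_measurable borel" unfolding F_def by measurable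
    define r where "r x = epowr (F x) (1 / N)" for x
    have rm: "r \<in> borel_measurable borel" unfolding r_def by measurable
    have rpow: "r x ^ ?s = F x" for x
    proof -
      have "r x ^ ?s = epowr (r x) (real ?s)" using s1 by (rule epowr_power[symmetric])
      also have "\<dots> = epowr (F x) (1 / N * N)" unfolding r_def epowr_epowr N(2) ..
      finally show ?thesis using N(1) by simp
    qed
    have adm: "1 \<le> surf_integral r S" if S: "S \<in> \<Sigma>" for S
    proof -
      have Sm [measurable]: "S \<in> sets borel" by (rule \<Sigma>(1)[OF S])
      have si: "surf_integral r S = (\<integral>\<^sup>+x. F x * indicator S x \<partial>hausdorff_measure ?s)"
        unfolding surf_integral_def rpow ..
      show ?thesis
      proof (cases "?H S \<le> ennreal (1 / \<kappa>)")
        case True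
        then have fin: "?H S < top" by (rule order_le_less_trans) simp
        interpret \<mu>: finite_measure "\<mu> S" by (rule fin\<mu>[OF Sm fin])
        interpret PP: pair_sigma_finite "\<mu> S" "lborel :: 'a measure" ..
        have "ennreal ((1 - \<zeta>) * M) \<le> (\<integral>\<^sup>+x. epowr (\<rho> x) (\<alpha> - 1) * \<sigma> S x \<partial>lborel)"
        proof (intro var \<sigma>adm S fin allI \<sigma>K[OF S True])
          show "\<sigma> S x < top" for x using \<sigma>b[OF S True, of x] by (rule order_le_less_trans) simp
        qed
        then have "ennreal (1 / ((1 - \<zeta>) * M)) * ennreal ((1 - \<zeta>) * M)
            \<le> ennreal (1 / ((1 - \<zeta>) * M)) * (\<integral>\<^sup>+x. epowr (\<rho> x) (\<alpha> - 1) * \<sigma> S x \<partial>lborel)"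
          by (rule mult_left_mono) simp
        moreover have "ennreal (1 / z) * ennreal z = 1" if "z > 0" for z :: real
          using that by (simp add: ennreal_mult'[symmetric])
        ultimately have "1 \<le> ennreal (1 / ((1 - \<zeta>) * M)) * (\<integral>\<^sup>+x. epowr (\<rho> x) (\<alpha> - 1) * \<sigma> S x \<partial>lborel)"
          using m0 by metis
        also have "\<dots> = (\<integral>\<^sup>+y. h y * \<sigma> S y \<partial>lborel)"
          unfolding h_def mult.assoc using \<sigma>m[OF Sm fin] by (intro nn_integral_cmult[symmetric]) measurable
        \<comment> \<open>Fubini's theorem moves the averaging from the surface to \<open>h\<close>:
          the integral of \<open>h\<close> against \<open>\<sigma> S\<close> is the integral over
          \<open>S\<close> of the ball average \<open>a\<close>, divided by
          \<open>c\<close>.\<close>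
        also have "\<dots> = (\<integral>\<^sup>+y. \<integral>\<^sup>+x. ennreal (1 / (c * w)) * (h y * indicator (ball y \<delta>) x) \<partial>\<mu> S \<partial>lborel)"
        proof (rule nn_integral_cong)
          fix y
          have "(\<integral>\<^sup>+x. ennreal (1 / (c * w)) * (h y * indicator (ball y \<delta>) x) \<partial>\<mu> S)
              = ennreal (1 / (c * w)) * (h y * (\<integral>\<^sup>+x. indicator (ball y \<delta>) x \<partial>\<mu> S))"
            by (simp add: nn_integral_cmult)
          then show "h y * \<sigma> S y = (\<integral>\<^sup>+x. ennreal (1 / (c * w)) * (h y * indicator (ball y \<delta>) x) \<partial>\<mu> S)"
            unfolding \<sigma>eq[OF Sm] by (simp only: mult_ac)
        qed
        also have "\<dots> = (\<integral>\<^sup>+x. \<integral>\<^sup>+y. ennreal (1 / (c * w)) * (h y * indicator (ball y \<delta>) x) \<partial>lborel \<partial>\<mu> S)"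
          by (rule PP.Fubini') measurable
        also have "\<dots> = (\<integral>\<^sup>+x. ennreal (1 / c) * a x \<partial>\<mu> S)"
        proof (rule nn_integral_cong)
          fix x
          have "(\<integral>\<^sup>+y. ennreal (1 / (c * w)) * (h y * indicator (ball y \<delta>) x) \<partial>lborel)
              = (\<integral>\<^sup>+y. ennreal (1 / (c * w)) * (h y * indicator (ball x \<delta>) y) \<partial>lborel)"
            by (intro nn_integral_cong) (auto simp: indicator_def dist_commute)
          also have "\<dots> = ennreal (1 / (c * w)) * (\<integral>\<^sup>+y. h y * indicator (ball x \<delta>) y \<partial>lborel)"
            by (rule nn_integral_cmult) measurable
          also have "\<dots> = ennreal (1 / c) * a x"
          proof -
            have "ennreal (1 / (c * w)) = ennreal (1 / c) * ennreal (1 / w)" using c w(1) by (simp add: ennreal_mult'[symmetric])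
            then show ?thesis unfolding a_def by (simp only: mult.assoc)
          qed
          finally show "(\<integral>\<^sup>+y. ennreal (1 / (c * w)) * (h y * indicator (ball y \<delta>) x) \<partial>lborel) = ennreal (1 / c) * a x" .
        qed
        also have "\<dots> = (\<integral>\<^sup>+x. indicator S x * (ennreal (1 / c) * a x) \<partial>hausdorff_measure ?s)"
          unfolding \<mu>_def by (rule nn_integral_density) measurable
        also have "\<dots> \<le> surf_integral r S"
          unfolding si F_def by (intro nn_integral_mono) (auto simp: indicator_def)
        finally show ?thesis .
      next
        case False
        then have "ennreal \<kappa> * ennreal (1 / \<kappa>) \<le> ennreal \<kappa> * ?H S" by (intro mult_left_mono) auto
        then have "1 \<le> ennreal \<kappa> * ?H S" using \<kappa> by (simp add: ennreal_mult'[symmetric])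
        also have "\<dots> = (\<integral>\<^sup>+x. ennreal \<kappa> * indicator S x \<partial>hausdorff_measure ?s)"
          using s1 by (subst nn_integral_cmult_indicator) (auto simp: emeasure_hausdorff_measure)
        also have "\<dots> \<le> surf_integral r S"
          unfolding si F_def using \<Sigma>(2)[OF S] by (intro nn_integral_mono) (auto simp: indicator_def)
        finally show ?thesis .
      qed
    qed
    have "r \<in> surf_adm \<Sigma>" using adm rm by (simp add: surf_adm_def)
    then have "surf_modulus p \<Sigma> \<le> (\<integral>\<^sup>+x. epowr (r x) p \<partial>lebesgue)" unfolding surf_modulus_def by (rule INF_lower)
    also have "\<dots> = (\<integral>\<^sup>+x. epowr (F x) q \<partial>lebesgue)"
      unfolding r_def epowr_epowr q_def by simp
    also have "\<dots> = (\<integral>\<^sup>+x. epowr (F x) q \<partial>lborel)" by (rule nn_integral_completion) measurable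
    also have "\<dots> \<le> (\<integral>\<^sup>+x. ennreal ((1 + \<zeta>) powr q) * epowr (ennreal (1 / c) * a x) q
        + ennreal ((1 + 1 / \<zeta>) powr q) * epowr (ennreal \<kappa> * indicator G x) q \<partial>lborel)"
      unfolding F_def using q1 \<zeta> by (intro nn_integral_mono epowr_add_le) auto
    also have "\<dots> = ennreal ((1 + \<zeta>) powr q) * (\<integral>\<^sup>+x. epowr (ennreal (1 / c) * a x) q \<partial>lborel)
        + ennreal ((1 + 1 / \<zeta>) powr q) * (\<integral>\<^sup>+x. epowr (ennreal \<kappa> * indicator G x) q \<partial>lborel)"
      by (subst nn_integral_add, measurable, subst nn_integral_cmult, measurable, subst nn_integral_cmult, measurable)
    also have "\<dots> \<le> ennreal ((1 + \<zeta>) powr q) * ennreal (c powr (- q) * ((M + \<zeta>) / ((1 - \<zeta>) * M) powr q)) + ennreal \<zeta>"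
    proof (intro add_mono mult_left_mono)
      have "(\<integral>\<^sup>+x. epowr (ennreal (1 / c) * a x) q \<partial>lborel) = (\<integral>\<^sup>+x. ennreal ((1 / c) powr q) * epowr (a x) q \<partial>lborel)"
        using c by (simp add: epowr_mult)
      also have "\<dots> = ennreal ((1 / c) powr q) * (\<integral>\<^sup>+x. epowr (a x) q \<partial>lborel)" by (rule nn_integral_cmult) measurable
      also have "(\<integral>\<^sup>+x. epowr (a x) q \<partial>lborel) \<le> (\<integral>\<^sup>+y. epowr (h y) q \<partial>lborel)"
        unfolding a_def by (rule ball_average_powr_le[OF q1 w hm])
      also have "\<dots> = (\<integral>\<^sup>+y. ennreal ((1 / ((1 - \<zeta>) * M)) powr q) * epowr (\<rho> y) \<alpha> \<partial>lborel)"
        unfolding h_def epowr_mult epowr_epowr \<alpha>q using m0 by (subst epowr_ennreal) auto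
      also have "\<dots> = ennreal ((1 / ((1 - \<zeta>) * M)) powr q) * (\<integral>\<^sup>+y. epowr (\<rho> y) \<alpha> \<partial>lborel)" by (rule nn_integral_cmult) measurable
      also have "\<dots> \<le> ennreal ((1 / ((1 - \<zeta>) * M)) powr q) * ennreal (M + \<zeta>)" by (intro mult_left_mono \<rho>(2)) simp
      finally have "(\<integral>\<^sup>+x. epowr (ennreal (1 / c) * a x) q \<partial>lborel) \<le> ennreal ((1 / c) powr q) * (ennreal ((1 / ((1 - \<zeta>) * M)) powr q) * ennreal (M + \<zeta>))"
        by (simp add: mult_left_mono)
      also have "\<dots> = ennreal ((1 / c) powr q * ((1 / ((1 - \<zeta>) * M)) powr q * (M + \<zeta>)))"
      proof -
        have "ennreal A * (ennreal B * ennreal C) = ennreal (A * (B * C))" if "0 \<le> A" "0 \<le> B" for A B C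
          using that by (simp add: ennreal_mult')
        then show ?thesis by simp
      qed
      also have "(1 / c) powr q * ((1 / ((1 - \<zeta>) * M)) powr q * (M + \<zeta>)) = c powr (- q) * ((M + \<zeta>) / ((1 - \<zeta>) * M) powr q)"
      proof -
        have "(1 / z) powr q = 1 / z powr q" if "z > 0" for z using that by (simp add: powr_divide)
        then have "(1 / c) powr q = 1 / c powr q" "(1 / ((1 - \<zeta>) * M)) powr q = 1 / ((1 - \<zeta>) * M) powr q" using c m0 by blast+
        then show ?thesis by (simp add: powr_minus_divide)
      qed
      finally show "(\<integral>\<^sup>+x. epowr (ennreal (1 / c) * a x) q \<partial>lborel) \<le> ennreal (c powr (- q) * ((M + \<zeta>) / ((1 - \<zeta>) * M) powr q))" .
      have "(\<integral>\<^sup>+x. epowr (ennreal \<kappa> * indicator G x) q \<partial>lborel) = (\<integral>\<^sup>+x. ennreal (\<kappa> powr q) * indicator G x \<partial>lborel)"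
        using \<kappa> by (intro nn_integral_cong) (auto simp: indicator_def)
      also have "\<dots> = ennreal (\<kappa> powr q) * ennreal l" by (subst nn_integral_cmult_indicator) (auto simp: l(2))
      finally have "ennreal ((1 + 1 / \<zeta>) powr q) * (\<integral>\<^sup>+x. epowr (ennreal \<kappa> * indicator G x) q \<partial>lborel)
          = ennreal ((1 + 1 / \<zeta>) powr q) * (ennreal (\<kappa> powr q) * ennreal l)" by simp
      also have "\<dots> = ennreal ((1 + 1 / \<zeta>) powr q * (\<kappa> powr q * l))"
      proof -
        have "ennreal A * (ennreal B * ennreal C) = ennreal (A * (B * C))" if "0 \<le> A" "0 \<le> B" for A B C
          using that by (simp add: ennreal_mult')
        then show ?thesis by simp
      qed
      also have "\<dots> \<le> ennreal \<zeta>"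
      proof (rule ennreal_leI)
        define Z where "Z = (1 + 1 / \<zeta>) powr q"
        have "Z > 0" using z2 by (simp add: Z_def)
        have "Z * (\<zeta> / (Z * (l + 1)) * l) = \<zeta> * (l / (l + 1))" using \<open>Z > 0\<close> by simp
        also have "\<dots> \<le> \<zeta> * 1" using \<zeta> l(1) by (intro mult_left_mono) auto
        finally show "(1 + 1 / \<zeta>) powr q * (\<kappa> powr q * l) \<le> \<zeta>" unfolding \<kappa>q Z_def by simp
      qed
      finally show "ennreal ((1 + 1 / \<zeta>) powr q) * (\<integral>\<^sup>+x. epowr (ennreal \<kappa> * indicator G x) q \<partial>lborel) \<le> ennreal \<zeta>" .
    qed auto
    also have "\<dots> = ennreal ((1 + \<zeta>) powr q * (c powr (- q) * ((M + \<zeta>) / ((1 - \<zeta>) * M) powr q)) + \<zeta>)"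
    proof -
      have "ennreal A * ennreal B + ennreal \<zeta> = ennreal (A * B + \<zeta>)" if "0 \<le> A" "0 \<le> B" for A B
        using that \<zeta> by (simp add: ennreal_mult)
      then show ?thesis using M \<zeta> by simp
    qed
    finally show ?thesis .
  qed
  have "((\<lambda>\<zeta>. ennreal ((1 + \<zeta>) powr q * (c powr (- q) * ((M + \<zeta>) / ((1 - \<zeta>) * M) powr q)) + \<zeta>))
      \<longlongrightarrow> ennreal ((1 + 0) powr q * (c powr (- q) * ((M + 0) / ((1 - 0) * M) powr q)) + 0)) (at_right 0)"
    using M(1) by (intro tendsto_ennrealI tendsto_intros) auto
  moreover have "\<forall>\<^sub>F \<zeta> in at_right 0. surf_modulus p \<Sigma> \<le> ennreal ((1 + \<zeta>) powr q * (c powr (- q) * ((M + \<zeta>) / ((1 - \<zeta>) * M) powr q)) + \<zeta>)"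
  proof (rule eventually_mono[OF eventually_at_right_real[of 0 1]])
    fix \<zeta> :: real assume "\<zeta> \<in> {0<..<1}"
    then show "surf_modulus p \<Sigma> \<le> ennreal ((1 + \<zeta>) powr q * (c powr (- q) * ((M + \<zeta>) / ((1 - \<zeta>) * M) powr q)) + \<zeta>)"
      by (intro main) auto
  qed simp
  ultimately have "surf_modulus p \<Sigma> \<le> ennreal ((1 + 0) powr q * (c powr (- q) * ((M + 0) / ((1 - 0) * M) powr q)) + 0)"
    by (rule tendsto_lowerbound) simp
  also have "(1 + 0) powr q * (c powr (- q) * ((M + 0) / ((1 - 0) * M) powr q)) + 0 = c powr (- q) * M powr (1 - q)"
    using M(1) by (simp add: powr_diff)
  finally show ?thesis unfolding q_def N_def .
qed

text \<open>Polar coordinates will be applied to \<open>\<eta> (dist x x0)\<close> with a Borel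
  weight. Setting a Borel version of \<open>\<eta>\<close> to 0 on a Borel null set where the two
  may differ gives a pointwise minorant, which can only decrease the right-hand side of the claim,
  without any argument about null sets in space.\<close>

lemma borel_minorant_AE:
  fixes \<eta> :: "real \<Rightarrow> ennreal"
  assumes \<eta>: "\<eta> \<in> borel_measurable (restrict_space lebesgue {a<..<b})"
  obtains \<eta>' where "\<eta>' \<in> borel_measurable borel" "\<And>r. r \<in> {a<..<b} \<Longrightarrow> \<eta>' r \<le> \<eta> r"
    "(\<integral>\<^sup>+r. \<eta>' r * indicator {a<..<b} r \<partial>lborel) = (\<integral>\<^sup>+r. \<eta> r * indicator {a<..<b} r \<partial>lebesgue)"
proof -
  let ?\<eta> = "\<lambda>r. \<eta> r * indicator {a<..<b} r"
  have m: "?\<eta> \<in> borel_measurable lebesgue"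
    using \<eta> by (subst (asm) borel_measurable_restrict_space_iff_ennreal) auto
  from completion_ex_borel_measurable[OF m]
  obtain g where g: "g \<in> borel_measurable lborel" "AE r in lborel. ?\<eta> r = g r" by blast
  have [measurable]: "g \<in> borel_measurable borel" using g(1) by simp
  obtain N where N: "{r \<in> space lborel. \<not> ?\<eta> r = g r} \<subseteq> N" "emeasure lborel N = 0" "N \<in> sets lborel"
    using g(2) by (rule AE_E)
  have Nb [measurable]: "N \<in> sets borel" using N(3) by simp
  define \<eta>' where "\<eta>' r = g r * indicator (- N) r" for r
  have AE_N: "AE r in lborel. r \<notin> N" using N(2,3) by (intro AE_not_in) (auto simp: null_sets_def)
  have out: "?\<eta> r = g r" if "r \<notin> N" for r using N(1) that by auto
  show thesis
  proof (rule that[of \<eta>'])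
    show "\<eta>' \<in> borel_measurable borel" unfolding \<eta>'_def by measurable
    show "\<eta>' r \<le> \<eta> r" if "r \<in> {a<..<b}" for r
      using out[of r] that by (cases "r \<in> N") (auto simp: \<eta>'_def)
    have "(\<integral>\<^sup>+r. ?\<eta> r \<partial>lebesgue) = (\<integral>\<^sup>+r. g r \<partial>lebesgue)"
      using AE_completion[OF g(2)] by (rule nn_integral_cong_AE)
    also have "\<dots> = (\<integral>\<^sup>+r. g r \<partial>lborel)" by (rule nn_integral_completion)
    also have "\<dots> = (\<integral>\<^sup>+r. \<eta>' r * indicator {a<..<b} r \<partial>lborel)"
    proof (rule nn_integral_cong_AE)
      show "AE r in lborel. g r = \<eta>' r * indicator {a<..<b} r"
        using AE_N
      proof eventually_elim
        case (elim r)
        then show ?case using out[OF elim] by (cases "r \<in> {a<..<b}") (auto simp: \<eta>'_def)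
      qed
    qed
    finally show "(\<integral>\<^sup>+r. \<eta>' r * indicator {a<..<b} r \<partial>lborel) = (\<integral>\<^sup>+r. ?\<eta> r \<partial>lebesgue)" by simp
  qed
qed

text \<open>Makes room at both ends, since \<open>C1\<close> and \<open>C2\<close> may touch the
  boundary spheres; by monotone convergence any mass \<open>z\<close> below the whole integral
  survives on a smaller interval.\<close>

lemma nn_integral_interval_shrink:
  fixes \<eta> :: "real \<Rightarrow> ennreal"
  assumes [measurable]: "\<eta> \<in> borel_measurable borel" and ab: "a < b"
    and z: "z < (\<integral>\<^sup>+r. \<eta> r * indicator {a<..<b} r \<partial>lborel)"
  obtains \<tau> where "\<tau> > 0" "a + \<tau> < b - \<tau>" "z < (\<integral>\<^sup>+r. \<eta> r * indicator {a + \<tau><..<b - \<tau>} r \<partial>lborel)"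
proof -
  \<comment> \<open>The offset 3 gives \<open>?t k \<le> (b - a) / 3\<close>, so the shrunken
    intervals are nonempty.\<close>
  let ?t = "\<lambda>k::nat. (b - a) / (real k + 3)"
  let ?f = "\<lambda>k r. \<eta> r * indicator {a + ?t k<..<b - ?t k} r"
  have tpos: "?t k > 0" for k using ab by simp
  have tmono: "?t l \<le> ?t k" if "k \<le> l" for k l using ab that by (intro divide_left_mono) auto
  have inc: "incseq ?f"
  proof (intro monoI le_funI mult_left_mono)
    fix k l :: nat and r assume "k \<le> l"
    from tmono[OF this] show "indicator {a + ?t k<..<b - ?t k} r \<le> (indicator {a + ?t l<..<b - ?t l} r :: ennreal)"
      by (auto simp: indicator_def)
  qed simp
  have sup: "(SUP k. ?f k r) = \<eta> r * indicator {a<..<b} r" for r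
  proof (rule antisym)
    show "(SUP k. ?f k r) \<le> \<eta> r * indicator {a<..<b} r"
    proof (intro SUP_least mult_left_mono)
      fix k show "indicator {a + ?t k<..<b - ?t k} r \<le> (indicator {a<..<b} r :: ennreal)"
        using tpos[of k] by (auto simp: indicator_def)
    qed simp
    show "\<eta> r * indicator {a<..<b} r \<le> (SUP k. ?f k r)"
    proof (cases "r \<in> {a<..<b}")
      case True
      define d where "d = min (r - a) (b - r)"
      have d: "d > 0" using True by (auto simp: d_def)
      obtain k :: nat where k: "(b - a) / d < real k" using reals_Archimedean2 by blast
      then have "b - a < real k * d" using d by (simp add: pos_divide_less_eq)
      also have "\<dots> \<le> (real k + 3) * d" using d by (intro mult_right_mono) auto
      finally have "?t k < d" by (simp add: pos_divide_less_eq mult.commute)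
      then have "r \<in> {a + ?t k<..<b - ?t k}" by (auto simp: d_def)
      then show ?thesis using True by (intro SUP_upper2[of k]) auto
    qed simp
  qed
  have "(\<integral>\<^sup>+r. \<eta> r * indicator {a<..<b} r \<partial>lborel) = (SUP k. \<integral>\<^sup>+r. ?f k r \<partial>lborel)"
    unfolding sup[symmetric] by (rule nn_integral_monotone_convergence_SUP[OF inc]) measurable
  then obtain k where k: "z < (\<integral>\<^sup>+r. ?f k r \<partial>lborel)" using z by (auto simp: less_SUP_iff)
  have "?t k \<le> (b - a) / 3" using ab by (intro divide_left_mono) auto
  moreover have "a + u < b - u" if "u \<le> (b - a) / 3" for u
  proof -
    have "3 * u \<le> b - a" using that by simp
    then show ?thesis using ab by linarith
  qed
  ultimately have "a + ?t k < b - ?t k" by blast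
  then show thesis using that[of "?t k"] tpos k by blast
qed

section \<open>Combination of the source side and the target side\<close>

lemma joining_paths_subset:
  assumes "g \<in> joining_paths E F G" "E \<subseteq> G" "F \<subseteq> G" "t \<in> {0..1}"
  shows "g t \<in> G"
proof -
  consider "t = 0" | "t = 1" | "t \<in> {0<..<1}" using assms(4) by fastforce
  then show ?thesis using assms by cases (auto simp: joining_paths_def)
qed

theorem theorem4p1:
  fixes x0 :: "'a::euclidean_space" and D :: "'a set" and f :: "'a \<Rightarrow> 'a"
    and Q :: "'a \<Rightarrow> real" and p :: real
  assumes n2: "DIM('a) \<ge> 2"
    and domain: "open D" "connected D" "D \<noteq> {}"
    and p_lo: "real DIM('a) - 1 < p" and p_hi: "p \<le> real DIM('a)"
    and Q_meas: "Q \<in> borel_measurable lebesgue"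
    and Q_pos: "\<And>x. Q x > 0"
    and Q_loc: "L_loc ((real DIM('a) - 1) / (p - real DIM('a) + 1)) Q"
    and homeo: "\<exists>g. homeomorphism D (f ` D) f g"
    and bdd: "bounded (f ` D)"
    and lowerQ: "lower_Q_mapping p Q f D x0"
  shows "\<forall>\<epsilon> \<epsilon>0 C1 C2 \<eta>.
           0 < \<epsilon> \<and> \<epsilon> < \<epsilon>0 \<and>
           compact C2 \<and> C2 \<subseteq> D - ball x0 \<epsilon>0 \<and>
           compact C1 \<and> C1 \<subseteq> cball x0 \<epsilon> \<inter> D \<and>
           \<eta> \<in> borel_measurable (restrict_space lebesgue {\<epsilon><..<\<epsilon>0}) \<and>
           (\<integral>\<^sup>+ r. \<eta> r * indicator {\<epsilon><..<\<epsilon>0} r \<partial>lebesgue) = 1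
         \<longrightarrow> path_modulus (p / (p - real DIM('a) + 1))
               ((\<lambda>\<gamma>. f \<circ> \<gamma>) ` joining_paths C1 C2 D)
             \<le> (\<integral>\<^sup>+ x. ennreal (Q x powr ((real DIM('a) - 1) / (p - real DIM('a) + 1)))
                     * epowr (\<eta> (dist x x0)) (p / (p - real DIM('a) + 1))
                     * indicator (annulus x0 \<epsilon> \<epsilon>0) x \<partial>lebesgue)"
proof (intro allI impI, elim conjE)
  fix \<epsilon> \<epsilon>0 :: real and C1 C2 :: "'a set" and \<eta> :: "real \<Rightarrow> ennreal"
  assume \<epsilon>: "0 < \<epsilon>" "\<epsilon> < \<epsilon>0"
    and C2: "compact C2" "C2 \<subseteq> D - ball x0 \<epsilon>0"
    and C1: "compact C1" "C1 \<subseteq> cball x0 \<epsilon> \<inter> D"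
    and \<eta>: "\<eta> \<in> borel_measurable (restrict_space lebesgue {\<epsilon><..<\<epsilon>0})"
      "(\<integral>\<^sup>+ r. \<eta> r * indicator {\<epsilon><..<\<epsilon>0} r \<partial>lebesgue) = 1"
  define N where "N = real DIM('a) - 1"
  define \<alpha> where "\<alpha> = p / (p - real DIM('a) + 1)"
  define q where "q = p / N"
  define s where "s = N / (p - real DIM('a) + 1)"
  define J where "J = (\<integral>\<^sup>+ x. ennreal (Q x powr s) * epowr (\<eta> (dist x x0)) \<alpha> * indicator (annulus x0 \<epsilon> \<epsilon>0) x \<partial>lebesgue)"
  let ?\<Gamma> = "(\<lambda>\<gamma>. f \<circ> \<gamma>) ` joining_paths C1 C2 D"
  have N: "N \<ge> 1" using n2 by (simp add: N_def)
  have pN: "p > N" "p - real DIM('a) + 1 = p - N" using p_lo by (auto simp: N_def)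
  have \<alpha>2: "\<alpha> \<ge> 2"
  proof -
    have "2 * (p - N) \<le> p" using p_hi n2 by (simp add: N_def)
    then show ?thesis using pN by (simp add: \<alpha>_def pos_le_divide_eq)
  qed
  have q1: "q > 1" using pN N by (simp add: q_def)
  have inv: "N / p = 1 / q" "(p - real DIM('a) + 1) / p = 1 / \<alpha>" by (auto simp: q_def \<alpha>_def)
  have conj: "1 / q + 1 / \<alpha> = 1"
  proof -
    have "N / p + (p - N) / p = 1" unfolding add_divide_distrib[symmetric] using pN N by simp
    then show ?thesis unfolding inv[symmetric] pN(2) .
  qed
  have "path_modulus \<alpha> ?\<Gamma> \<le> J"
  proof (cases "J = top")
    case False
    then obtain j where j: "j \<ge> 0" "J = ennreal j" by (cases J) auto
    obtain finv where hom: "homeomorphism D (f ` D) f finv" using homeo by blast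
    have contf: "continuous_on D f" and injf: "inj_on f D"
      using hom homeomorphism_cont1 by (auto simp: homeomorphism_def inj_on_def) metis
    have opf: "open (f ` A)" if "open A" "A \<subseteq> D" for A
      using that contf injf by (intro invariance_of_domain) (auto intro: continuous_on_subset inj_on_subset)
    have opD: "open (f ` D)" using opf domain(1) by auto
    obtain c where c: "c > 0" "\<And>v A::'a set. norm v = 1 \<Longrightarrow> A \<in> sets borel \<Longrightarrow>
        hausdorff_outer (DIM('a) - 1) (A \<inter> {x. x \<bullet> v = 0}) = ennreal c * emeasure (perp_measure v) A"
      using hausdorff_eq_perp_measure[OF n2] by metis
    obtain \<eta>' where \<eta>'m [measurable]: "\<eta>' \<in> borel_measurable borel" and \<eta>'le: "\<And>r. r \<in> {\<epsilon><..<\<epsilon>0} \<Longrightarrow> \<eta>' r \<le> \<eta> r"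
      and \<eta>'1: "(\<integral>\<^sup>+r. \<eta>' r * indicator {\<epsilon><..<\<epsilon>0} r \<partial>lborel) = 1"
      using borel_minorant_AE[OF \<eta>(1)] \<eta>(2) by metis
    \<comment> \<open>For these curves all translates by less than \<open>1 / (k + 1)\<close> remain
      in f(D), where the image of a sphere separates. Compactness of each curve makes the families
      exhaust the whole one.\<close>
    define \<Gamma> where "\<Gamma> k = {g \<in> ?\<Gamma>. \<forall>t\<in>{0..1}. ball (g t) (1 / (real k + 1)) \<subseteq> f ` D}" for k :: nat
    have \<Gamma>inc: "incseq \<Gamma>"
    proof (intro monoI subsetI)
      fix k l :: nat and g assume kl: "k \<le> l" and g: "g \<in> \<Gamma> k"
      have "1 / (real l + 1) \<le> 1 / (real k + 1)" using kl by (intro divide_left_mono) auto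
      then have "ball (g t) (1 / (real l + 1)) \<subseteq> ball (g t) (1 / (real k + 1))" for t by (rule subset_ball)
      then show "g \<in> \<Gamma> l" using g unfolding \<Gamma>_def by blast
    qed
    have C1D: "C1 \<subseteq> D" and C2D: "C2 \<subseteq> D" using C1 C2 by auto
    have \<Gamma>UN: "(\<Union>k. \<Gamma> k) = ?\<Gamma>"
    proof (rule antisym)
      show "?\<Gamma> \<subseteq> (\<Union>k. \<Gamma> k)"
      proof
        fix g assume g: "g \<in> ?\<Gamma>"
        then obtain \<gamma> where \<gamma>: "\<gamma> \<in> joining_paths C1 C2 D" "g = f \<circ> \<gamma>" by blast
        have \<gamma>D: "\<gamma> ` {0..1} \<subseteq> D" using joining_paths_subset[OF \<gamma>(1) C1D C2D] by auto
        have "continuous_on {0..1} \<gamma>" using \<gamma>(1) by (simp add: joining_paths_def path_def)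
        then have "compact (g ` {0..1})"
          unfolding \<gamma>(2) using \<gamma>D contf
          by (intro compact_continuous_image continuous_on_compose) (auto intro: continuous_on_subset)
        moreover have "g ` {0..1} \<subseteq> f ` D" using \<gamma>D \<gamma>(2) by auto
        ultimately obtain e where e: "e > 0" "(\<Union>x\<in>g ` {0..1}. ball x e) \<subseteq> f ` D"
          using compact_subset_open_imp_ball_epsilon_subset[OF _ opD] by metis
        obtain k :: nat where k: "1 / (real k + 1) < e"
          using reals_Archimedean[OF e(1)] by (auto simp: inverse_eq_divide add.commute)
        have "ball (g t) (1 / (real k + 1)) \<subseteq> f ` D" if "t \<in> {0..1}" for t
        proof -
          have "ball (g t) (1 / (real k + 1)) \<subseteq> ball (g t) e" using k by (intro subset_ball) simp
          also have "\<dots> \<subseteq> f ` D" using e(2) imageI[OF that, of g] by blast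
          finally show ?thesis .
        qed
        then show "g \<in> (\<Union>k. \<Gamma> k)" using g unfolding \<Gamma>_def by blast
      qed
    qed (auto simp: \<Gamma>_def)
    \<comment> \<open>The empty cases are settled first, because a point of \<open>C2\<close> is
      needed to see that the radii are allowed in the lower \<open>Q\<close>-condition; a vanishing
      modulus is trivial and could not be divided by.\<close>
    have key: "path_modulus \<alpha> (\<Gamma> k) \<le> ennreal j" for k
    proof (cases "path_modulus \<alpha> (\<Gamma> k) = 0 \<or> C1 = {} \<or> C2 = {}")
      case True
      have "path_modulus \<alpha> (\<Gamma> k) = 0" if "C1 = {} \<or> C2 = {}"
      proof -
        have "\<Gamma> k = {}" using that by (auto simp: \<Gamma>_def joining_paths_def)
        then have "path_modulus \<alpha> (\<Gamma> k) \<le> (\<integral>\<^sup>+x. epowr 0 \<alpha> \<partial>(lebesgue :: 'a measure))"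
          by (intro path_modulus_le) (simp add: path_adm_def)
        then show ?thesis by simp
      qed
      then show ?thesis using True by auto
    next
      case False
      then have ne: "C1 \<noteq> {}" "C2 \<noteq> {}" and M0: "path_modulus \<alpha> (\<Gamma> k) \<noteq> 0" by auto
      have fC: "compact (f ` C1)" "compact (f ` C2)"
        using C1 C2 C1D C2D contf by (auto intro!: compact_continuous_image intro: continuous_on_subset)
      have "C1 \<inter> C2 = {}" using C1(2) C2(2) \<epsilon> by fastforce
      then have "f ` C1 \<inter> f ` C2 = {}" using C1D C2D injf by (metis image_empty inj_on_image_Int)
      then obtain d where d: "d > 0" "\<And>x y. x \<in> f ` C1 \<Longrightarrow> y \<in> f ` C2 \<Longrightarrow> d \<le> dist x y"
        using separate_compact_closed[OF fC(1) compact_imp_closed[OF fC(2)]] by metis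
      have "path_modulus \<alpha> (\<Gamma> k) < top"
      proof -
        \<comment> \<open>Every curve has length at least \<open>d\<close>, the gap between the two
          image sets, so this density is admissible; its energy is finite because f(D) is
          bounded.\<close>
        let ?\<rho> = "\<lambda>y. ennreal (1 / d) * indicator (f ` D) y"
        have fDm [measurable]: "f ` D \<in> sets borel" using opD by (rule borel_open)
        have "1 \<le> line_integral ?\<rho> g" if g: "g \<in> \<Gamma> k" "rectifiable_path g" for g
        proof -
          obtain \<gamma> where \<gamma>: "\<gamma> \<in> joining_paths C1 C2 D" "g = f \<circ> \<gamma>" using g(1) by (auto simp: \<Gamma>_def)
          have "d \<le> dist (g 0) (g 1)" using \<gamma> by (intro d(2)) (auto simp: joining_paths_def)
          then have "1 \<le> 1 / d * dist (g 1) (g 0)" using d(1) by (simp add: dist_commute)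
          from ennreal_leI[OF this] have "1 \<le> ennreal (1 / d) * ennreal (dist (g 1) (g 0))"
            using d(1) by (simp add: ennreal_mult'[symmetric])
          also have "\<dots> = (\<Sum>i<1::nat. ennreal (1 / d) * ennreal (dist (g (real (Suc i) / real 1)) (g (real i / real 1))))" by simp
          also have "\<dots> \<le> line_integral ?\<rho> g"
          proof (rule line_integral_ge_partition[OF g(2)])
            fix i :: nat and t :: real assume "i < 1" "real i / real 1 < t" "t \<le> real (Suc i) / real 1"
            then have "t \<in> {0..1}" by auto
            then have "g t \<in> f ` D" using joining_paths_subset[OF \<gamma>(1) C1D C2D] \<gamma>(2) by auto
            then show "ennreal (1 / d) \<le> ?\<rho> (g t)" by simp
          qed simp
          finally show ?thesis .
        qed
        then have "?\<rho> \<in> path_adm (\<Gamma> k)" by (auto simp: path_adm_def)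
        then have "path_modulus \<alpha> (\<Gamma> k) \<le> (\<integral>\<^sup>+x. epowr (?\<rho> x) \<alpha> \<partial>lebesgue)" by (rule path_modulus_le)
        also have "\<dots> = (\<integral>\<^sup>+x. ennreal ((1 / d) powr \<alpha>) * indicator (f ` D) x \<partial>lebesgue)"
          using d(1) by (intro nn_integral_cong) (auto simp: indicator_def)
        also have "\<dots> = ennreal ((1 / d) powr \<alpha>) * emeasure lborel (f ` D)"
          by (subst nn_integral_cmult_indicator) (auto intro: fDm)
        also have "\<dots> < top" using emeasure_bounded_finite[OF bdd] by (simp add: ennreal_mult_less_top)
        finally show ?thesis .
      qed
      then obtain M where M: "M > 0" "path_modulus \<alpha> (\<Gamma> k) = ennreal M"
        using M0 by (cases "path_modulus \<alpha> (\<Gamma> k)") auto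
      \<comment> \<open>Shrinking the interval of radii costs some mass of \<open>\<eta>'\<close>,
        so the inequality is proved for every \<open>z < 1\<close> and completed by density.\<close>
      have "z \<le> (j / M) powr (1 / \<alpha>)" if z: "z < 1" for z :: real
      proof (cases "z \<le> 0")
        case True
        then show ?thesis by (rule order_trans) simp
      next
        case False
        have "ennreal z < (\<integral>\<^sup>+r. \<eta>' r * indicator {\<epsilon><..<\<epsilon>0} r \<partial>lborel)"
          unfolding \<eta>'1 using z False by (simp add: ennreal_less_one_iff)
        then obtain \<tau> where \<tau>: "\<tau> > 0" "\<epsilon> + \<tau> < \<epsilon>0 - \<tau>"
            "ennreal z < (\<integral>\<^sup>+r. \<eta>' r * indicator {\<epsilon> + \<tau><..<\<epsilon>0 - \<tau>} r \<partial>lborel)"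
          using nn_integral_interval_shrink[OF \<eta>'m \<epsilon>(2)] by metis
        define a where "a = \<epsilon> + \<tau>"
        define b where "b = \<epsilon>0 - \<tau>"
        have ab: "0 < a" "a < b" "\<epsilon> < a" "b < \<epsilon>0" using \<tau> \<epsilon> by (auto simp: a_def b_def)
        define \<Sigma> where "\<Sigma> = {sphere x0 r \<inter> D | r. a < r \<and> r < b}"
        let ?U = "\<lambda>r. f ` (D \<inter> ball x0 r)" and ?V = "\<lambda>r. f ` (D - cball x0 r)"
        have opU: "open (?U r)" "open (?V r)" for r
          using domain(1) by (auto intro!: opf)
        have "f ` C1 \<subseteq> ?U a"
        proof (rule image_mono)
          show "C1 \<subseteq> D \<inter> ball x0 a" using C1(2) ab(3) by force
        qed
        then obtain d1 where d1: "d1 > 0" "(\<Union>x\<in>f ` C1. ball x d1) \<subseteq> ?U a"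
          using compact_subset_open_imp_ball_epsilon_subset[OF fC(1) opU(1)] by metis
        have "f ` C2 \<subseteq> ?V b"
        proof (rule image_mono)
          show "C2 \<subseteq> D - cball x0 b" using C2(2) ab(4) by force
        qed
        then obtain d2 where d2: "d2 > 0" "(\<Union>x\<in>f ` C2. ball x d2) \<subseteq> ?V b"
          using compact_subset_open_imp_ball_epsilon_subset[OF fC(2) opU(2)] by metis
        \<comment> \<open>The first bound keeps small translates of the curves in f(D); the other
          two keep translates of the end points on their sides of every image surface with
          \<open>a < r < b\<close>.\<close>
        define \<delta> where "\<delta> = min (1 / (real k + 1)) (min d1 d2)"
        have \<delta>: "\<delta> > 0" "\<delta> \<le> 1 / (real k + 1)" "\<delta> \<le> d1" "\<delta> \<le> d2" using d1 d2 by (auto simp: \<delta>_def)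
        have split: "f ` D = ?U r \<union> f ` (sphere x0 r \<inter> D) \<union> ?V r" for r by force
        have disj: "?U r \<inter> ?V r = {}" "?U r \<inter> f ` (sphere x0 r \<inter> D) = {}" "?V r \<inter> f ` (sphere x0 r \<inter> D) = {}" for r
        proof -
          have "f ` A \<inter> f ` B = {}" if "A \<subseteq> D" "B \<subseteq> D" "A \<inter> B = {}" for A B
            using inj_on_image_Int[OF injf that(1,2)] that(3) by simp
          note * = this
          show "?U r \<inter> ?V r = {}" "?U r \<inter> f ` (sphere x0 r \<inter> D) = {}" "?V r \<inter> f ` (sphere x0 r \<inter> D) = {}"
            by (intro *; auto)+
        qed
        \<comment> \<open>The image of a spherical section is f(D) without the images of its inside
          and outside, all of them open by invariance of domain.\<close>
        have Sm: "f ` (sphere x0 r \<inter> D) \<in> sets borel" for r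
        proof -
          have "X = A - B - E" if "A = B \<union> X \<union> E" "B \<inter> X = {}" "E \<inter> X = {}" for X A B E :: "'a set"
            using that by blast
          from this[OF split disj(2,3)] have "f ` (sphere x0 r \<inter> D) = f ` D - ?U r - ?V r" .
          then show ?thesis using opD opU by auto
        qed
        have "surf_modulus p ((\<lambda>S. f ` S) ` \<Sigma>) \<le> ennreal (c powr (- (p / (real DIM('a) - 1))) * M powr (1 - p / (real DIM('a) - 1)))"
        proof (rule surf_modulus_le_of_crossing[OF n2 c(1) p_lo p_hi bdd borel_open[OF opD] _ _ \<delta>(1) _ M(1) M(2)[unfolded \<alpha>_def]])
          show "S \<in> sets borel" "S \<subseteq> f ` D" if "S \<in> (\<lambda>S. f ` S) ` \<Sigma>" for S
            using that Sm unfolding \<Sigma>_def by auto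
          fix S g assume S: "S \<in> (\<lambda>S. f ` S) ` \<Sigma>" "hausdorff_outer (DIM('a) - 1) S < top"
            and g: "g \<in> \<Gamma> k" "rectifiable_path g"
          obtain r where r: "a < r" "r < b" "S = f ` (sphere x0 r \<inter> D)" using S(1) unfolding \<Sigma>_def by auto
          obtain \<gamma> where \<gamma>: "\<gamma> \<in> joining_paths C1 C2 D" "g = f \<circ> \<gamma>" using g(1) by (auto simp: \<Gamma>_def)
          show "ennreal c * emeasure lborel (ball (0::'a) \<delta>)
              \<le> line_integral (\<lambda>y. hausdorff_outer (DIM('a) - 1) (S \<inter> ball y \<delta>)) g"
          proof (rule line_integral_crossing_ge[OF n2 c _ S(2) g(2) \<delta>(1) opU(1)[of r] opU(2)[of r] disj(1)])
            show "S \<in> sets borel" using Sm r(3) by simp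
            have ends: "g 0 \<in> f ` C1" "g 1 \<in> f ` C2" using \<gamma> by (auto simp: joining_paths_def)
            have "ball (g 0) \<delta> \<subseteq> ball (g 0) d1" using \<delta>(3) by (rule subset_ball)
            also have "\<dots> \<subseteq> ?U a" using d1(2) ends(1) by blast
            also have "\<dots> \<subseteq> ?U r" using r(1) by (intro image_mono) auto
            finally show "ball (g 0) \<delta> \<subseteq> ?U r" .
            have "ball (g 1) \<delta> \<subseteq> ball (g 1) d2" using \<delta>(4) by (rule subset_ball)
            also have "\<dots> \<subseteq> ?V b" using d2(2) ends(2) by blast
            also have "\<dots> \<subseteq> ?V r" using r(2) by (intro image_mono) auto
            finally show "ball (g 1) \<delta> \<subseteq> ?V r" .
            fix t :: real assume t: "t \<in> {0..1}"
            have "ball (g t) \<delta> \<subseteq> ball (g t) (1 / (real k + 1))" using \<delta>(2) by (rule subset_ball)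
            also have "\<dots> \<subseteq> f ` D" using g(1) t unfolding \<Gamma>_def by blast
            finally show "ball (g t) \<delta> \<subseteq> ?U r \<union> S \<union> ?V r" unfolding r(3) using split[of r] by simp
          qed
        qed
        then have mod: "surf_modulus p ((\<lambda>S. f ` S) ` \<Sigma>) \<le> ennreal (c powr (- q) * M powr (1 - q))" by (simp add: q_def N_def)
        \<comment> \<open>A point of \<open>C2\<close> has distance at least
          \<open>\<epsilon>0 > b\<close> from \<open>x0\<close>, so \<open>b\<close> is an allowed
          outer radius in the lower \<open>Q\<close>-condition.\<close>
        have "ennreal b < (SUP x\<in>D. ennreal (dist x x0))"
        proof -
          obtain x where x: "x \<in> C2" using ne by blast
          have "b < dist x x0" using x C2(2) ab(4) by (auto simp: dist_commute subset_iff)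
          then have "ennreal b < ennreal (dist x x0)" using ab by (simp add: ennreal_less_iff)
          then show ?thesis using x C2D by (auto simp: less_SUP_iff)
        qed
        then have "(INF \<rho> \<in> ext_adm p \<Sigma>. \<integral>\<^sup>+ x. epowr (\<rho> x) p / ennreal (Q x) * indicator (D \<inter> annulus x0 a b) x \<partial>lebesgue)
            \<le> surf_modulus p ((\<lambda>S. f ` S) ` \<Sigma>)"
          using lowerQ ab unfolding lower_Q_mapping_def Let_def \<Sigma>_def by auto
        also note mod
        finally have INF_le: "(INF \<rho> \<in> ext_adm p \<Sigma>. \<integral>\<^sup>+ x. epowr (\<rho> x) p / ennreal (Q x) * indicator (D \<inter> annulus x0 a b) x \<partial>lebesgue)
            \<le> ennreal (c powr (- q) * M powr (1 - q))" .
        define Y where "Y = c powr (- q) * M powr (1 - q)"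
        have Y: "Y > 0" using c(1) M(1) by (simp add: Y_def)
        \<comment> \<open>The infimum over extensively admissible densities need not be attained,
          hence the slack \<open>e\<close>, which tends to 0 afterwards.\<close>
        have zle: "z \<le> c * ((Y + e) powr (1 / q) * j powr (1 / \<alpha>))" if e: "e > 0" for e
        proof -
          have "(INF \<rho> \<in> ext_adm p \<Sigma>. \<integral>\<^sup>+ x. epowr (\<rho> x) p / ennreal (Q x) * indicator (D \<inter> annulus x0 a b) x \<partial>lebesgue) < ennreal (Y + e)"
            using INF_le e Y by (intro order_le_less_trans[OF INF_le]) (simp add: Y_def[symmetric] ennreal_less_iff del: ennreal_plus)
          then obtain \<rho> where \<rho>: "\<rho> \<in> ext_adm p \<Sigma>"
            "(\<integral>\<^sup>+ x. epowr (\<rho> x) p / ennreal (Q x) * indicator (D \<inter> annulus x0 a b) x \<partial>lebesgue) < ennreal (Y + e)"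
            (is "?X < _") unfolding INF_less_iff by blast
          let ?J = "\<integral>\<^sup>+x. ennreal (Q x powr s) * epowr (\<eta>' (dist x x0)) \<alpha> * indicator (annulus x0 a b) x \<partial>lebesgue"
          have "?J \<le> J"
            unfolding J_def
          proof (intro nn_integral_mono)
            fix x
            show "ennreal (Q x powr s) * epowr (\<eta>' (dist x x0)) \<alpha> * indicator (annulus x0 a b) x
              \<le> ennreal (Q x powr s) * epowr (\<eta> (dist x x0)) \<alpha> * indicator (annulus x0 \<epsilon> \<epsilon>0) x"
            proof (cases "x \<in> annulus x0 a b")
              case True
              then have "dist x x0 \<in> {\<epsilon><..<\<epsilon>0}" using ab by (auto simp: annulus_def)
              moreover from this have "x \<in> annulus x0 \<epsilon> \<epsilon>0" by (auto simp: annulus_def)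
              ultimately show ?thesis using True \<alpha>2 by (auto intro!: mult_left_mono epowr_mono \<eta>'le)
            qed simp
          qed
          have "ennreal z \<le> (\<integral>\<^sup>+r. \<eta>' r * indicator {a<..<b} r \<partial>lborel)" using \<tau>(3) by (simp add: a_def b_def less_imp_le)
          also have "\<dots> \<le> ennreal c * (epowr ?X (1 / q) * epowr ?J (1 / \<alpha>))"
            unfolding inv[symmetric] unfolding \<alpha>_def s_def N_def
            by (rule ext_adm_lower_bound[OF n2 c p_lo borel_open[OF domain(1)] ab(1,2) \<rho>(1)[unfolded \<Sigma>_def] \<eta>'m Q_meas Q_pos])
          also have "\<dots> \<le> ennreal c * (epowr (ennreal (Y + e)) (1 / q) * epowr (ennreal j) (1 / \<alpha>))"
            using \<rho>(2) \<open>?J \<le> J\<close> j(2) q1 \<alpha>2 by (intro mult_left_mono mult_mono epowr_mono) auto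
          also have "\<dots> = ennreal (c * ((Y + e) powr (1 / q) * j powr (1 / \<alpha>)))"
            using j(1) Y e c(1) by (simp add: ennreal_mult del: ennreal_plus)
          finally show ?thesis using c(1) by (subst (asm) ennreal_le_iff) auto
        qed
        have "((\<lambda>e. c * ((Y + e) powr (1 / q) * j powr (1 / \<alpha>))) \<longlongrightarrow> c * ((Y + 0) powr (1 / q) * j powr (1 / \<alpha>))) (at_right 0)"
          using Y by (intro tendsto_intros) auto
        moreover have "\<forall>\<^sub>F e in at_right 0. z \<le> c * ((Y + e) powr (1 / q) * j powr (1 / \<alpha>))"
          using eventually_at_right_less by (rule eventually_mono) (rule zle)
        ultimately have "z \<le> c * ((Y + 0) powr (1 / q) * j powr (1 / \<alpha>))"
          by (rule tendsto_lowerbound) simp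
        \<comment> \<open>Taking the power \<open>1 / q\<close> of \<open>Y\<close> leaves the
          exponent \<open>-1\<close> on \<open>c\<close>, which cancels the factor in front, and
          \<open>(1 - q) / q = - 1 / \<alpha>\<close> on \<open>M\<close>.\<close>
        also have "c * ((Y + 0) powr (1 / q) * j powr (1 / \<alpha>)) = (j / M) powr (1 / \<alpha>)"
        proof -
          have "Y powr (1 / q) = c powr (- q * (1 / q)) * M powr ((1 - q) * (1 / q))"
            unfolding Y_def powr_mult powr_powr ..
          also have "- q * (1 / q) = -1" using q1 by simp
          also have "(1 - q) * (1 / q) = - (1 / \<alpha>)" using conj q1 by (simp add: field_simps)
          also have "c powr - 1 = 1 / c" using c(1) by (simp add: powr_minus_divide)
          finally have "c * (Y powr (1 / q) * j powr (1 / \<alpha>)) = j powr (1 / \<alpha>) * M powr (- (1 / \<alpha>))" using c(1) by simp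
          also have "\<dots> = j powr (1 / \<alpha>) / M powr (1 / \<alpha>)" by (simp add: powr_minus_divide)
          also have "\<dots> = (j / M) powr (1 / \<alpha>)" using j(1) M(1) by (simp add: powr_divide)
          finally show ?thesis by simp
        qed
        finally show ?thesis .
      qed
      then have one: "1 \<le> (j / M) powr (1 / \<alpha>)" by (rule dense_le)
      have "1 \<le> j / M"
      proof (rule ccontr)
        assume "\<not> 1 \<le> j / M"
        then have "(j / M) powr (1 / \<alpha>) < 1 powr (1 / \<alpha>)"
          using j(1) M(1) \<alpha>2 by (intro powr_less_mono2) auto
        then show False using one by simp
      qed
      then have "M \<le> j" using M(1) by simp
      then show ?thesis unfolding M(2) by (rule ennreal_leI)
    qed
    from path_modulus_UN_le[OF \<alpha>2 \<Gamma>inc key] show ?thesis unfolding \<Gamma>UN j(2) .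
  qed simp
  then show "path_modulus (p / (p - real DIM('a) + 1)) ?\<Gamma>
     \<le> (\<integral>\<^sup>+ x. ennreal (Q x powr ((real DIM('a) - 1) / (p - real DIM('a) + 1)))
             * epowr (\<eta> (dist x x0)) (p / (p - real DIM('a) + 1)) * indicator (annulus x0 \<epsilon> \<epsilon>0) x \<partial>lebesgue)"
    unfolding J_def \<alpha>_def s_def N_def .
qed

end
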